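(* Let $G$ be a finite abelian group, and let $S\subseteq G$ be such that $S\cap(-S)=\emptyset$ and $|S|\ge 2$. Then one of the following holds. (i) $$|\Sigma(S)|\ge \frac{|S|(|S|-1)}{2}+3.$$ (ii) There is a non-empty subset $S'\subseteq S$ for which $$|\Sigma(S')|>\frac{|\langle S'\rangle|}{2}.$$ Furthermore, if $|G|$ is odd then property (i) may be replaced by (i') $$|\Sigma(S)|\ge \frac{|S|(|S|+1)}{2}+\xi(S);$$ that is, if $|G|$ is odd, then (i') or (ii) holds.
   Context: For a subset $S$ of a finite abelian group $G$, $\Sigma(S)=\{\sum_{x\in X}x : X\subseteq S\}$ is the set of all subset sums of $S$ (the empty sum $0$ is included), $-S=\{-x:x\in S\}$, and $\langle S\rangle$ is the subgroup of $G$ generated by $S$. The parameter $\xi(S)$ is defined as follows: if $|S|$ is even, $\xi(S)=1$; if $|S|$ is odd, $\xi(S)=1$ when $2|S|^2+3|S|\le 2|\langle S\rangle|+5$, and $\xi(S)=0$ when $2|S|^2+3|S|> 2|\langle S\rangle|+5$. *)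

theory Defs
  imports Complex_Main "HOL-Computational_Algebra.Group_Closure"
begin

text \<open>The ambient group is a type of class \<open>ab_group_add\<close>, written additively. The subgroup
  \<open>\<langle>S\<rangle>\<close> generated by \<open>S\<close> is \<open>group_closure S\<close>, and \<open>-S\<close> is the image \<open>uminus ` S\<close>.\<close>

definition subset_sums :: "'a::ab_group_add set \<Rightarrow> 'a set" where
  "subset_sums S = {\<Sum>x\<in>X. x | X. X \<subseteq> S}"

definition xi :: "'a::ab_group_add set \<Rightarrow> nat" where
  "xi S = (if even (card S) then 1
           else if 2 * card S ^ 2 + 3 * card S \<le> 2 * card (group_closure S) + 5 then 1
           else 0)"

end

theory Submission
  imports Defs "HOL-Library.Set_Algebras"
begin

text \<open>
  If (ii) fails, then \<open>2 |\<Sigma>(T)| \<le> |\<langle>T\<rangle>|\<close> for all non-empty \<open>T \<subseteq> S\<close>, a property inherited by subsets and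
  preserved by changing signs, so one can argue by induction on \<open>k = |S|\<close>. Let \<open>B = \<Sigma>(S)\<close>,
  \<open>Q = S \<union> -S \<union> {0}\<close> and \<open>H = \<langle>S\<rangle>\<close>. Removing \<open>x\<close> from \<open>S\<close> costs at least \<open>|(B + x) - B|\<close> subset sums, and
  this defect is subadditive in \<open>x\<close>. If it is at most \<open>m\<close> on \<open>S\<close>, it is at most \<open>m j\<close> on the \<open>j\<close>-fold sumset
  of \<open>Q\<close>, which contradicts the count of all differences of \<open>B\<close> once these sumsets grow fast enough.

  By Hamidoune's isoperimetric method \<open>|X + Q| - |X|\<close> is minimised by a subgroup \<open>K\<close>. If the minimum is
  \<open>2k\<close>, the sumsets of \<open>Q\<close> grow by \<open>2k\<close> in each step. For odd \<open>|G|\<close> a Vosper-type theorem and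
  parity improve this to \<open>2k + 2\<close>, unless \<open>Q\<close> is essentially a progression. If the minimum is
  smaller, then \<open>S\<close> almost fills cosets of \<open>K\<close>. The same counting for the \<open>K\<close>-periodic set \<open>\<Sigma>(S) + K\<close> then
  lets one remove \<open>t\<close> suitable elements, each of which costs \<open>(|K + Q| - |K|) / 2\<close> subset sums, and the
  induction hypothesis applies to what is left.\<close>

section \<open>Subgroups and sumsets\<close>

text \<open>The step from k - 1 to k elements must gain k - 1 subset sums for (i) and k for (i'), up
  to the change of \<xi>; so the count of differences only has to refute that all defects are
  smaller. The failure of (ii) provides the room: 2 |B| \<le> |H| lets the sumsets of Q grow to size
  2 |B| before H is exhausted. Write |K + Q| = |K| + 2 z and e = k - z. Removing t elements at cost
  z each and applying induction to the other k - t closes (i) for t = 2 e, with surplus e. For (i')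
  the same t falls short by e, while t = 2 e + 2 leaves a surplus of e + 1, which also pays for
  \<xi>. The obstacle is that defects are under control only for the periodic set \<Sigma>(S) + K.
  Density overcomes it: if a subset of S splits a class modulo K, then changing it inside that class
  and inside K reaches the whole coset of its sum. So what \<Sigma>(S) misses of \<Sigma>(S) + K
  comes from unions of whole classes, and the number of missed elements does not drop when elements
  are removed, as long as every class outside K is still met.\<close>

lemma even_card_fixpoint_free_involution:
  assumes "finite A" "\<And>x. x \<in> A \<Longrightarrow> f x \<in> A" "\<And>x. x \<in> A \<Longrightarrow> f (f x) = x" "\<And>x. x \<in> A \<Longrightarrow> f x \<noteq> x"
  shows "even (card A)"
  using assms
proof (induction "card A" arbitrary: A rule: less_induct)
  case less
  show ?case
  proof (cases "A = {}")
    case False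
    then obtain x where x: "x \<in> A" by auto
    let ?B = "A - {x, f x}"
    have fx: "f x \<in> A" "f x \<noteq> x" using less.prems x by auto
    have "card A = Suc (card (A - {x}))" "card (A - {x}) = Suc (card (A - {x} - {f x}))"
      using x fx less.prems(1) by (metis card_Suc_Diff1, metis card_Suc_Diff1 finite_Diff insert_Diff insert_iff)
    then have c: "card A = card ?B + 2" by (simp add: Diff_insert[symmetric] insert_commute)
    have "even (card ?B)"
    proof (rule less.hyps)
      fix y assume y: "y \<in> ?B"
      show "f y \<in> ?B" using y less.prems(2,3) x by (metis Diff_iff insert_iff singletonD)
    qed (use c less.prems in auto)
    then show ?thesis using c by simp
  qed simp
qed

definition subgrp :: "'a::ab_group_add set \<Rightarrow> bool" where
  "subgrp K \<longleftrightarrow> 0 \<in> K \<and> (\<forall>x\<in>K. \<forall>y\<in>K. x - y \<in> K)"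

lemma subgrp_zero: "subgrp K \<Longrightarrow> 0 \<in> K"
  by (simp add: subgrp_def)

lemma subgrp_diff: "subgrp K \<Longrightarrow> x \<in> K \<Longrightarrow> y \<in> K \<Longrightarrow> x - y \<in> K"
  by (simp add: subgrp_def)

lemma subgrp_minus: "subgrp K \<Longrightarrow> x \<in> K \<Longrightarrow> - x \<in> K"
  by (metis diff_0 subgrp_def)

lemma subgrp_add: "subgrp K \<Longrightarrow> x \<in> K \<Longrightarrow> y \<in> K \<Longrightarrow> x + y \<in> K"
  by (metis diff_minus_eq_add subgrp_diff subgrp_minus)

lemma subgrp_minus_iff: "subgrp K \<Longrightarrow> - x \<in> K \<longleftrightarrow> x \<in> K"
  by (metis minus_minus subgrp_minus)

lemma subgrp_add_cancel_right: "subgrp K \<Longrightarrow> y \<in> K \<Longrightarrow> x + y \<in> K \<longleftrightarrow> x \<in> K"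
  by (metis add_diff_cancel_right' subgrp_add subgrp_diff)

lemma subgrp_sum: "subgrp K \<Longrightarrow> (\<And>x. x \<in> A \<Longrightarrow> f x \<in> K) \<Longrightarrow> sum f A \<in> K"
  by (induction A rule: infinite_finite_induct) (auto intro: subgrp_add subgrp_zero)

lemma subgrp_group_closure: "subgrp (group_closure S)"
  by (simp add: subgrp_def group_closure.diff)

lemma subset_group_closure: "S \<subseteq> group_closure S"
  by (auto intro: group_closure.base)

lemma group_closure_least:
  assumes "subgrp K" "S \<subseteq> K"
  shows "group_closure S \<subseteq> K"
proof
  fix x assume "x \<in> group_closure S"
  then show "x \<in> K"
  proof induction
    case (base s)
    then show ?case using assms subgrp_zero by blast
  next
    case (diff s t)
    then show ?case using assms(1) subgrp_diff by blast
  qed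
qed

lemma card_translate: "card ((+) (x::'a::ab_group_add) ` A) = card A"
  by (simp add: card_image)

text \<open>Translation by \<open>a\<close> is an injection of the finite set \<open>M\<close> into
  itself, hence onto, and so takes the value 0: this yields inverses.\<close>

lemma subgrp_of_add_closed:
  fixes M :: "'a::{finite,ab_group_add} set"
  assumes "0 \<in> M" "\<And>a b. a \<in> M \<Longrightarrow> b \<in> M \<Longrightarrow> a + b \<in> M"
  shows "subgrp M"
proof -
  have "- a \<in> M" if a: "a \<in> M" for a
  proof -
    have "(+) a ` M \<subseteq> M" using assms(2)[OF a] by blast
    moreover have "card ((+) a ` M) = card M" by (rule card_translate)
    ultimately have "(+) a ` M = M" by (intro card_subset_eq) auto
    then obtain b where "b \<in> M" "0 = a + b" using assms(1) by blast
    then show ?thesis by (metis add_eq_0_iff)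
  qed
  then have "a - b \<in> M" if "a \<in> M" "b \<in> M" for a b
    using assms(2)[of a "- b"] that by simp
  then show ?thesis using assms(1) by (simp add: subgrp_def)
qed

lemma card_reflect: "card (uminus ` A) = card (A :: 'a::ab_group_add set)"
  by (simp add: card_image)

lemma set_plus_memI: "a \<in> A \<Longrightarrow> b \<in> B \<Longrightarrow> a + b \<in> A + (B :: 'a::ab_group_add set)"
  by blast

lemma set_plus_iff: "x \<in> A + B \<longleftrightarrow> (\<exists>a\<in>A. \<exists>b\<in>B. x = a + (b :: 'a::ab_group_add))"
  by (auto simp: set_plus_def)

lemma set_plus_iff_diff: "x \<in> A + B \<longleftrightarrow> (\<exists>a\<in>A. x - a \<in> (B :: 'a::ab_group_add set))"
proof
  assume "\<exists>a\<in>A. x - a \<in> B"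
  then obtain a where "a \<in> A" "x - a \<in> B" by blast
  then have "a + (x - a) \<in> A + B" by (rule set_plus_memI)
  then show "x \<in> A + B" by simp
next
  assume "x \<in> A + B"
  then obtain a b where "a \<in> A" "b \<in> B" "x = a + b" by (auto simp: set_plus_iff)
  then show "\<exists>a\<in>A. x - a \<in> B" by (intro bexI[of _ a]) simp_all
qed

lemma subset_set_plus: "0 \<in> B \<Longrightarrow> A \<subseteq> A + (B :: 'a::ab_group_add set)"
proof
  fix x assume "0 \<in> B" "x \<in> A"
  then show "x \<in> A + B" unfolding set_plus_iff_diff by (intro bexI[of _ x]) simp_all
qed

lemma set_plus_subset_subgrp: "subgrp K \<Longrightarrow> A \<subseteq> K \<Longrightarrow> B \<subseteq> K \<Longrightarrow> A + B \<subseteq> K"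
  unfolding set_plus_iff subset_iff using subgrp_add by blast

lemma subgrp_set_plus: "subgrp K \<Longrightarrow> K + K = K"
  by (rule equalityI) (simp_all add: set_plus_subset_subgrp subset_set_plus subgrp_zero)

lemma set_plus_absorb: "subgrp K \<Longrightarrow> (A + K) + K = A + K"
  by (simp add: add.assoc subgrp_set_plus)

text \<open>Removing one coset \<open>y + K\<close> from \<open>Y\<close> leaves a periodic set. For
  a subgroup \<open>Y\<close> containing \<open>K\<close> this is Lagrange's theorem.\<close>

lemma card_subgrp_dvd_periodic:
  fixes Y :: "'a::ab_group_add set"
  assumes K: "subgrp K" and fin: "finite Y" and per: "Y + K = Y"
  shows "card K dvd card Y"
  using fin per
proof (induction "card Y" arbitrary: Y rule: less_induct)
  case less
  show ?case
  proof (cases "Y = {}")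
    case False
    then obtain y where y: "y \<in> Y" by blast
    let ?C = "(+) y ` K"
    have mem: "v \<in> ?C \<longleftrightarrow> v - y \<in> K" for v by (auto intro: image_eqI[of _ _ "v - y"])
    have "y + k \<in> Y + K" if "k \<in> K" for k using y that by (rule set_plus_memI)
    then have CY: "?C \<subseteq> Y" using less.prems(2) by auto
    have yC: "y \<in> ?C" using mem subgrp_zero[OF K] by simp
    have "Y - ?C + K \<subseteq> Y - ?C"
    proof
      fix v assume "v \<in> Y - ?C + K"
      then obtain w k where wk: "w \<in> Y - ?C" "k \<in> K" "v = w + k" unfolding set_plus_iff by blast
      have "v \<in> Y + K" unfolding wk(3) using wk by (intro set_plus_memI) auto
      moreover have "v \<notin> ?C"
        using wk(1) subgrp_add_cancel_right[OF K wk(2), of "w - y"] mem by (simp add: wk(3) algebra_simps)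
      ultimately show "v \<in> Y - ?C" using less.prems(2) by simp
    qed
    then have "Y - ?C + K = Y - ?C" using subset_set_plus[OF subgrp_zero[OF K]] by blast
    moreover have "card (Y - ?C) < card Y" using y yC less.prems(1) by (intro psubset_card_mono) auto
    ultimately have "card K dvd card (Y - ?C)" using less.hyps[of "Y - ?C"] less.prems(1) by blast
    moreover have "card Y = card (Y - ?C) + card K"
      using CY less.prems(1) card_mono[OF _ CY] finite_subset[OF CY]
      by (simp add: card_Diff_subset card_translate)
    ultimately show ?thesis by simp
  qed simp
qed

section \<open>Symmetric sets and the parity of their orders\<close>

definition symm :: "'a::ab_group_add set \<Rightarrow> bool" where
  "symm A \<longleftrightarrow> (\<forall>x\<in>A. - x \<in> A)"

lemma symm_minus_iff: "symm A \<Longrightarrow> - x \<in> A \<longleftrightarrow> x \<in> A"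
  by (metis minus_minus symm_def)

lemma symm_set_plus:
  assumes "symm A" "symm B"
  shows "symm (A + B)"
  unfolding symm_def
proof
  fix x assume "x \<in> A + B"
  then obtain a b where "a \<in> A" "b \<in> B" "x = a + b" by (auto simp: set_plus_iff)
  moreover from this assms have "- a + - b \<in> A + B" by (intro set_plus_memI) (auto simp: symm_def)
  ultimately show "- x \<in> A + B" by (simp only: minus_add_distrib)
qed

lemma symm_subgrp: "subgrp K \<Longrightarrow> symm K"
  by (simp add: symm_def subgrp_minus)

text \<open>Negation pairs off the non-zero elements, none of which is its own inverse. The parity
  arguments for sumsets of symmetric sets rest on this.\<close>

lemma odd_card_symm:
  fixes A :: "'a::ab_group_add set"
  assumes tors: "\<And>x::'a. x + x = 0 \<Longrightarrow> x = 0" and "finite A" "symm A" "0 \<in> A"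
  shows "odd (card A)"
proof -
  have "even (card (A - {0}))"
  proof (rule even_card_fixpoint_free_involution[where f = uminus])
    show "- x \<noteq> x" if "x \<in> A - {0}" for x
    proof
      assume "- x = x"
      then have "x + x = 0" by (metis add.right_inverse)
      then show False using tors[of x] that by blast
    qed
  qed (use assms(2-4) in \<open>auto simp: symm_def\<close>)
  moreover have "card A = Suc (card (A - {0}))"
    using assms(2,4) by (rule card_Suc_Diff1[symmetric])
  ultimately show ?thesis by simp
qed

text \<open>Translation by a non-zero \<open>x\<close> with \<open>x + x = 0\<close> would be a
  fixed-point-free involution of the whole group.\<close>

lemma no_2_torsion_of_odd_card:
  assumes "odd (card (UNIV :: 'a::{finite,ab_group_add} set))" "(x::'a) + x = 0"
  shows "x = 0"
proof (rule ccontr)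
  assume "x \<noteq> 0"
  have "x + (x + y) = y" for y using assms(2) by (metis add.assoc add.left_neutral)
  then have "even (card (UNIV :: 'a set))"
    using \<open>x \<noteq> 0\<close> by (intro even_card_fixpoint_free_involution[where f = "(+) x"]) auto
  then show False using assms by simp
qed

section \<open>Subset sums and shift defects\<close>

lemma subset_sumsI: "X \<subseteq> S \<Longrightarrow> \<Sum>X \<in> subset_sums S"
  by (auto simp: subset_sums_def)

lemma subset_sumsE:
  assumes "y \<in> subset_sums S"
  obtains X where "X \<subseteq> S" "y = \<Sum>X"
  using assms by (auto simp: subset_sums_def)

lemma zero_in_subset_sums: "0 \<in> subset_sums S"
  using subset_sumsI[of "{}" S] by simp

lemma subset_sums_mono: "S \<subseteq> T \<Longrightarrow> subset_sums S \<subseteq> subset_sums T"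
  by (auto simp: subset_sums_def)

lemma subset_sums_empty: "subset_sums {} = {0}"
  by (auto simp: subset_sums_def)

lemma subset_sums_closed: "subgrp K \<Longrightarrow> S \<subseteq> K \<Longrightarrow> subset_sums S \<subseteq> K"
  by (auto simp: subset_sums_def intro!: subgrp_sum)

lemma subset_sums_subset_closure: "subset_sums S \<subseteq> group_closure S"
  by (intro subset_sums_closed subgrp_group_closure subset_group_closure)

lemma subset_sums_insert:
  fixes x :: "'a::{finite,ab_group_add}"
  assumes "x \<notin> A"
  shows "subset_sums (insert x A) = subset_sums A \<union> (+) x ` subset_sums A"
proof -
  have im: "subset_sums B = (\<lambda>X. \<Sum>X) ` Pow B" for B :: "'a set" by (auto simp: subset_sums_def)
  have "(\<lambda>X. \<Sum>(insert x X)) ` Pow A = (\<lambda>X. x + \<Sum>X) ` Pow A"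
    using assms by (intro image_cong sum.insert) auto
  then show ?thesis unfolding im Pow_insert image_Un image_image by simp
qed

definition shift_defect :: "'a::ab_group_add set \<Rightarrow> 'a \<Rightarrow> nat" where
  "shift_defect B x = card {b \<in> B. b + x \<notin> B}"

lemma card_Int_shift:
  fixes B :: "'a::{finite,ab_group_add} set"
  shows "card {b \<in> B. b + x \<in> B} + shift_defect B x = card B"
proof -
  have "card {b \<in> B. b + x \<in> B} + card {b \<in> B. b + x \<notin> B}
      = card ({b \<in> B. b + x \<in> B} \<union> {b \<in> B. b + x \<notin> B})"
    by (intro card_Un_disjoint[symmetric]) auto
  also have "{b \<in> B. b + x \<in> B} \<union> {b \<in> B. b + x \<notin> B} = B" by auto
  finally show ?thesis by (simp add: shift_defect_def)
qed

text \<open>A pair \<open>b\<close>, \<open>b + x\<close> in \<open>B\<close>, read backwards, is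
  such a pair for \<open>- x\<close>; so equally many points stay in \<open>B\<close> under both
  shifts.\<close>

lemma shift_defect_minus:
  fixes B :: "'a::{finite,ab_group_add} set"
  shows "shift_defect B (- x) = shift_defect B x"
proof -
  have "bij_betw ((+) x) {b \<in> B. b + x \<in> B} {b \<in> B. b + - x \<in> B}"
    by (rule bij_betw_byWitness[where f' = "(+) (- x)"]) (auto simp: add.commute)
  then have "card {b \<in> B. b + x \<in> B} = card {b \<in> B. b + - x \<in> B}" by (rule bij_betw_same_card)
  then show ?thesis using card_Int_shift[of B x] card_Int_shift[of B "- x"] by linarith
qed

lemma shift_defect_zero: "shift_defect B 0 = 0"
  by (simp add: shift_defect_def)

text \<open>A point leaving \<open>B\<close> under \<open>x + y\<close> leaves it already under
  \<open>x\<close>, or reaches \<open>b + x\<close> in \<open>B\<close> and leaves from there under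
  \<open>y\<close>.\<close>

lemma shift_defect_add:
  fixes B :: "'a::{finite,ab_group_add} set"
  shows "shift_defect B (x + y) \<le> shift_defect B x + shift_defect B y"
proof -
  let ?M = "{b \<in> B. b + x \<in> B \<and> b + x + y \<notin> B}"
  have "card ?M = card ((\<lambda>b. b + x) ` ?M)" by (intro card_image[symmetric] inj_onI) auto
  also have "\<dots> \<le> shift_defect B y" unfolding shift_defect_def by (intro card_mono) auto
  finally have "card ?M \<le> shift_defect B y" .
  moreover have "shift_defect B (x + y) \<le> card ({b \<in> B. b + x \<notin> B} \<union> ?M)"
    unfolding shift_defect_def by (intro card_mono) (auto simp: add.assoc)
  moreover have "card ({b \<in> B. b + x \<notin> B} \<union> ?M) \<le> shift_defect B x + card ?M"
    unfolding shift_defect_def by (rule card_Un_le)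
  ultimately show ?thesis by linarith
qed

text \<open>To leave \<open>H - B\<close> by \<open>x\<close> is to enter \<open>B\<close>, which
  read backwards is to leave \<open>B\<close> by \<open>- x\<close>. A set with more than half of
  \<open>H\<close> may thus be replaced by its complement.\<close>

lemma shift_defect_Diff:
  fixes B :: "'a::{finite,ab_group_add} set"
  assumes H: "subgrp H" and "B \<subseteq> H" "x \<in> H"
  shows "shift_defect (H - B) x = shift_defect B x"
proof -
  have "bij_betw ((+) x) {b \<in> H - B. b + x \<notin> H - B} {b \<in> B. b + - x \<notin> B}"
  proof (rule bij_betw_byWitness[where f' = "(+) (- x)"])
    show "(+) x ` {b \<in> H - B. b + x \<notin> H - B} \<subseteq> {b \<in> B. b + - x \<notin> B}"
      using assms subgrp_add[OF H] by (auto simp: add.commute)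
    show "(+) (- x) ` {b \<in> B. b + - x \<notin> B} \<subseteq> {b \<in> H - B. b + x \<notin> H - B}"
      using assms subgrp_diff[OF H] by (auto simp: add.commute)
  qed auto
  then have "shift_defect (H - B) x = shift_defect B (- x)"
    unfolding shift_defect_def by (rule bij_betw_same_card)
  then show ?thesis by (simp only: shift_defect_minus)
qed

text \<open>Every \<open>a\<close> in \<open>A\<close> has both \<open>a\<close> and
  \<open>a + x\<close> in the union, so at least \<open>|A|\<close> points of the union stay in it
  under translation by \<open>x\<close>.\<close>

lemma card_insert_shift:
  fixes A :: "'a::{finite,ab_group_add} set"
  shows "card A + shift_defect (A \<union> (+) x ` A) x \<le> card (A \<union> (+) x ` A)"
proof -
  let ?B = "A \<union> (+) x ` A"
  have "card A = card ((\<lambda>b. b) ` A)" by simp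
  also have "\<dots> \<le> card {b \<in> ?B. b + x \<in> ?B}"
    by (intro card_mono) (auto simp: add.commute)
  finally show ?thesis using card_Int_shift[of ?B x] by linarith
qed

lemma card_subset_sums_remove:
  fixes S :: "'a::{finite,ab_group_add} set"
  assumes "x \<in> S"
  shows "card (subset_sums (S - {x})) + shift_defect (subset_sums S) x \<le> card (subset_sums S)"
  using card_insert_shift[of "subset_sums (S - {x})" x] subset_sums_insert[of x "S - {x}"] assms
  by (simp add: insert_absorb)

text \<open>Each pair of elements of \<open>B\<close> has one difference, so summing
  \<open>|B \<inter> (B + c)| = |B| - shift_defect B c\<close> over the \<open>c\<close> in the last layer gives at most \<open>|B|\<^sup>2\<close>.\<close>

lemma layer_bound:
  fixes B :: "'a::{finite,ab_group_add} set" and C :: "nat \<Rightarrow> 'a set" and m :: nat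
  assumes incr: "\<And>j. C j \<subseteq> C (Suc j)"
    and bound: "\<And>j c. c \<in> C j \<Longrightarrow> shift_defect B c \<le> m * j"
  shows "int m * (\<Sum>j<q. int (card (C j))) + (int (card B) - int m * int q) * int (card (C q))
         \<le> int (card B) ^ 2"
proof -
  \<comment> \<open>Summation by parts: an element that first appears in layer \<open>j\<close> is
    charged \<open>m * j\<close>, in total \<open>m\<close> times the sum of
    \<open>|C q| - |C j|\<close> over \<open>j < q\<close>.\<close>
  have "(\<Sum>c\<in>C q. int (shift_defect B c)) \<le> int m * (int q * int (card (C q)) - (\<Sum>j<q. int (card (C j))))" for q
  proof (induction q)
    case 0
    have "(\<Sum>c\<in>C 0. int (shift_defect B c)) = 0" using bound[of _ 0] by (intro sum.neutral) auto
    then show ?case by simp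
  next
    case (Suc q)
    have "(\<Sum>c\<in>C (Suc q). int (shift_defect B c))
        = (\<Sum>c\<in>C q. int (shift_defect B c)) + (\<Sum>c\<in>C (Suc q) - C q. int (shift_defect B c))"
      by (simp add: sum.subset_diff[OF incr[of q]] del: of_nat_sum)
    also have "(\<Sum>c\<in>C (Suc q) - C q. int (shift_defect B c)) \<le> (\<Sum>c\<in>C (Suc q) - C q. int (m * Suc q))"
      using bound[of _ "Suc q"] by (intro sum_mono) (simp only: of_nat_le_iff DiffD1)
    also have "\<dots> = int m * (int q + 1) * (int (card (C (Suc q))) - int (card (C q)))"
    proof -
      have "card (C (Suc q) - C q) = card (C (Suc q)) - card (C q)" "card (C q) \<le> card (C (Suc q))"
        using incr[of q] by (simp_all add: card_Diff_subset card_mono)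
      then have e: "int (card (C (Suc q) - C q)) = int (card (C (Suc q))) - int (card (C q))" by linarith
      show ?thesis unfolding sum_constant of_nat_mult of_nat_Suc e by (simp add: algebra_simps)
    qed
    finally show ?case using Suc.IH by (simp add: algebra_simps)
  qed
  note up = this[of q]
  have "(\<Sum>c\<in>C q. card {b \<in> B. b + c \<in> B}) = card (SIGMA c:C q. {b \<in> B. b + c \<in> B})" by simp
  also have "\<dots> = card ((\<lambda>(c, b). (b, b + c)) ` (SIGMA c:C q. {b \<in> B. b + c \<in> B}))"
    by (intro card_image[symmetric] inj_onI) auto
  also have "\<dots> \<le> card (B \<times> B)" by (intro card_mono) auto
  finally have "(\<Sum>c\<in>C q. card {b \<in> B. b + c \<in> B}) \<le> card B * card B" by simp
  then have "(\<Sum>c\<in>C q. int (card {b \<in> B. b + c \<in> B})) \<le> int (card B) * int (card B)"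
    by (simp flip: of_nat_mult of_nat_sum)
  moreover have "int (card {b \<in> B. b + c \<in> B}) = int (card B) - int (shift_defect B c)" for c
    using card_Int_shift[of B c] by linarith
  ultimately have "int (card (C q)) * int (card B) - (\<Sum>c\<in>C q. int (shift_defect B c)) \<le> int (card B) * int (card B)"
    by (simp add: sum_subtractf)
  then show ?thesis using up by (simp add: algebra_simps power2_eq_square)
qed

text \<open>Since \<open>m * q \<le> |B|\<close>, the layer sizes enter \<open>layer_bound\<close>
  with non-negative coefficients and may be replaced by lower bounds.\<close>

lemma layer_bound_card:
  fixes B :: "'a::{finite,ab_group_add} set" and C :: "nat \<Rightarrow> 'a set" and m :: nat and g :: "nat \<Rightarrow> int"
  assumes "\<And>j. C j \<subseteq> C (Suc j)"
    and "\<And>j c. c \<in> C j \<Longrightarrow> shift_defect B c \<le> m * j"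
    and g: "\<And>j. j \<le> q \<Longrightarrow> g j \<le> int (card (C j))" and q: "int m * int q \<le> int (card B)"
  shows "int m * (\<Sum>j<q. g j) + (int (card B) - int m * int q) * g q \<le> int (card B) ^ 2"
proof -
  have "int m * (\<Sum>j<q. g j) \<le> int m * (\<Sum>j<q. int (card (C j)))"
    using g by (intro mult_left_mono sum_mono) auto
  moreover have "(int (card B) - int m * int q) * g q \<le> (int (card B) - int m * int q) * int (card (C q))"
    using g q by (intro mult_left_mono) auto
  ultimately show ?thesis using layer_bound[of C B m q, OF assms(1) assms(2)] by linarith
qed

text \<open>The starting set is \<open>{0}\<close> for plain sets of subset sums and
  \<open>K\<close> for \<open>K\<close>-periodic sets, whose defects vanish on all of
  \<open>K\<close>.\<close>

fun iter_plus :: "'a::ab_group_add set \<Rightarrow> 'a set \<Rightarrow> nat \<Rightarrow> 'a set" where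
  "iter_plus X Q 0 = X"
| "iter_plus X Q (Suc j) = iter_plus X Q j + Q"

lemma iter_plus_incr: "0 \<in> Q \<Longrightarrow> iter_plus X Q j \<subseteq> iter_plus X Q (Suc j)"
  by (simp add: subset_set_plus)

lemma iter_plus_subset: "subgrp H \<Longrightarrow> X \<subseteq> H \<Longrightarrow> Q \<subseteq> H \<Longrightarrow> iter_plus X Q j \<subseteq> H"
  by (induction j) (simp_all add: set_plus_subset_subgrp)

lemma iter_plus_nonempty: "X \<noteq> {} \<Longrightarrow> 0 \<in> Q \<Longrightarrow> iter_plus X Q j \<noteq> {}"
  by (induction j) (simp, metis iter_plus_incr subset_empty)

lemma iter_plus_card:
  fixes X Q H :: "'a::{finite,ab_group_add} set"
  assumes H: "subgrp H" "X \<subseteq> H" "Q \<subseteq> H" and X: "X \<noteq> {}" "0 \<in> Q" and N: "N \<le> card H"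
    and growth: "\<And>Y. Y \<subseteq> H \<Longrightarrow> Y \<noteq> {} \<Longrightarrow> Y + Q \<noteq> H \<Longrightarrow> card Y + c \<le> card (Y + Q)"
  shows "min N (card X + c * j) \<le> card (iter_plus X Q j)"
proof (induction j)
  case (Suc j)
  show ?case
  proof (cases "iter_plus X Q j + Q = H")
    case False
    have "card (iter_plus X Q j) + c \<le> card (iter_plus X Q j + Q)"
      using growth[OF iter_plus_subset[OF H] iter_plus_nonempty[OF X] False] .
    then show ?thesis using Suc.IH by simp
  qed (use N in simp)
qed simp

lemma iter_plus_symm: "symm X \<Longrightarrow> symm Q \<Longrightarrow> symm (iter_plus X Q j)"
  by (induction j) (simp_all add: symm_set_plus)

lemma shift_defect_iter_plus:
  fixes B :: "'a::{finite,ab_group_add} set"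
  assumes "\<And>c. c \<in> X \<Longrightarrow> shift_defect B c = 0" "\<And>c. c \<in> Q \<Longrightarrow> shift_defect B c \<le> m"
  shows "c \<in> iter_plus X Q j \<Longrightarrow> shift_defect B c \<le> m * j"
proof (induction j arbitrary: c)
  case 0
  then show ?case using assms(1) by simp
next
  case (Suc j)
  then obtain a b where ab: "a \<in> iter_plus X Q j" "b \<in> Q" "c = a + b" by (auto simp: set_plus_iff)
  have "shift_defect B c \<le> shift_defect B a + shift_defect B b"
    unfolding ab(3) by (rule shift_defect_add)
  then show ?case using Suc.IH[OF ab(1)] assms(2)[OF ab(2)] by simp
qed

text \<open>Changing the sign of one element turns the summand \<open>{0, x}\<close> into
  \<open>{0, - x}\<close>, a translate of it, and so only translates the set of subset sums.\<close>

lemma subset_sums_flip: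
  fixes A :: "'a::{finite,ab_group_add} set"
  assumes "inj_on f A" "\<And>x. x \<in> A \<Longrightarrow> f x = x \<or> f x = - x"
  shows "\<exists>c. subset_sums (f ` A) = (+) c ` subset_sums A"
proof -
  have "finite A" by simp
  then show ?thesis using assms
  proof (induction A rule: finite_induct)
    case empty
    then show ?case by (intro exI[of _ 0]) (simp add: subset_sums_empty)
  next
    case (insert x A)
    then obtain c where c: "subset_sums (f ` A) = (+) c ` subset_sums A" by auto
    have fx: "f x \<notin> f ` A" using insert.prems(1) insert.hyps(2) by auto
    have 1: "subset_sums (f ` insert x A) = (+) c ` subset_sums A \<union> (+) (f x + c) ` subset_sums A"
      using subset_sums_insert[OF fx] by (simp add: c image_image add.assoc)
    have 2: "subset_sums (insert x A) = subset_sums A \<union> (+) x ` subset_sums A"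
      using subset_sums_insert[OF insert.hyps(2)] .
    show ?case
    proof (cases "f x = x")
      case True
      then show ?thesis unfolding 1 2
        by (intro exI[of _ c]) (simp add: image_Un image_image ac_simps)
    next
      case False
      then have "f x = - x" using insert.prems(2) by auto
      then show ?thesis unfolding 1 2
        by (intro exI[of _ "c - x"]) (simp add: image_Un image_image algebra_simps Un_commute)
    qed
  qed
qed

text \<open>Both sets choose one element from each of the same pairs \<open>{v, - v}\<close>, so one
  arises from the other by changing signs.\<close>

lemma antisymmetric_same_span:
  fixes S T :: "'a::{finite,ab_group_add} set"
  assumes S: "S \<inter> uminus ` S = {}" and T: "T \<inter> uminus ` T = {}"
    and eq: "S \<union> uminus ` S = T \<union> uminus ` T"
  shows "card S = card T" "card (subset_sums S) = card (subset_sums T)"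
proof -
  define f where "f x = (if x \<in> T then x else - x)" for x
  have neg: "- x \<notin> S" if "x \<in> S" for x using S that by (metis IntI emptyE imageI minus_minus)
  have negT: "- x \<notin> T" if "x \<in> T" for x using T that by (metis IntI emptyE imageI minus_minus)
  have inj: "inj_on f S"
    using neg by (auto simp: inj_on_def f_def split: if_splits)
  have "f ` S = T"
  proof
    show "f ` S \<subseteq> T"
    proof
      fix y assume "y \<in> f ` S"
      then obtain x where x: "x \<in> S" "y = f x" by auto
      then have "x \<in> T \<or> x \<in> uminus ` T" using eq by blast
      then show "y \<in> T" using x by (auto simp: f_def)
    qed
    show "T \<subseteq> f ` S"
    proof
      fix y assume y: "y \<in> T"
      then have "y \<in> S \<or> - y \<in> S" using eq by (metis UnE UnI1 imageE minus_minus)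
      then show "y \<in> f ` S"
      proof
        assume "y \<in> S" then show ?thesis using y by (intro image_eqI[of _ _ y]) (simp_all add: f_def)
      next
        assume "- y \<in> S" then show ?thesis using negT[OF y] by (intro image_eqI[of _ _ "- y"]) (simp_all add: f_def)
      qed
    qed
  qed
  then show "card S = card T" using card_image[OF inj] by simp
  obtain c where "subset_sums (f ` S) = (+) c ` subset_sums S"
    using subset_sums_flip[OF inj] unfolding f_def by meson
  then show "card (subset_sums S) = card (subset_sums T)"
    using \<open>f ` S = T\<close> by (simp add: card_translate)
qed

lemma group_closure_same_span:
  assumes "S \<union> uminus ` S = T \<union> uminus ` (T :: 'a::ab_group_add set)"
  shows "group_closure S = group_closure T"
proof -
  have "group_closure S \<subseteq> group_closure T" if "S \<union> uminus ` S = T \<union> uminus ` T" for S T :: "'a set"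
  proof (intro group_closure_least subgrp_group_closure subsetI)
    fix x assume "x \<in> S"
    then have "x \<in> T \<or> x \<in> uminus ` T" using that by blast
    then show "x \<in> group_closure T" using subset_group_closure[of T] by auto
  qed
  then show ?thesis using assms by (intro equalityI) simp_all
qed

section \<open>Sumsets under inclusion, translation and reflection\<close>

lemma set_plus_mono_left: "A \<subseteq> B \<Longrightarrow> A + C \<subseteq> B + (C :: 'a::ab_group_add set)"
  unfolding set_plus_iff subset_iff by blast

lemma card_set_plus_ge:
  fixes X :: "'a::{finite,ab_group_add} set"
  shows "0 \<in> Q \<Longrightarrow> card X \<le> card (X + Q)"
  by (intro card_mono subset_set_plus) simp_all

lemma translate_set_plus: "(+) c ` X + Q = (+) (c :: 'a::ab_group_add) ` (X + Q)"
proof (intro set_eqI iffI)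
  fix z assume "z \<in> (+) c ` X + Q"
  then obtain x q where "x \<in> X" "q \<in> Q" "z = (c + x) + q" by (auto simp: set_plus_iff)
  then show "z \<in> (+) c ` (X + Q)" using set_plus_memI[of x X q Q] by (auto simp: add.assoc)
next
  fix z assume "z \<in> (+) c ` (X + Q)"
  then obtain x q where "x \<in> X" "q \<in> Q" "z = (c + x) + q" by (auto simp: set_plus_iff add.assoc)
  then show "z \<in> (+) c ` X + Q" using set_plus_memI[of "c + x" "(+) c ` X" q Q] by auto
qed

lemma reflect_set_plus:
  assumes "symm Q"
  shows "uminus ` X + Q = uminus ` (X + (Q :: 'a::ab_group_add set))"
proof (intro set_eqI iffI)
  fix z assume "z \<in> uminus ` X + Q"
  then obtain x q where xq: "x \<in> X" "q \<in> Q" "z = - x + q" by (auto simp: set_plus_iff)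
  have "x + - q \<in> X + Q" using assms xq by (intro set_plus_memI) (auto simp: symm_def)
  then show "z \<in> uminus ` (X + Q)" using xq(3) by (intro image_eqI[of _ _ "x + - q"]) simp_all
next
  fix z assume "z \<in> uminus ` (X + Q)"
  then obtain x q where xq: "x \<in> X" "q \<in> Q" "z = - (x + q)" by (auto simp: set_plus_iff)
  have "- x + - q \<in> uminus ` X + Q" using assms xq by (intro set_plus_memI) (auto simp: symm_def)
  then show "z \<in> uminus ` X + Q" unfolding xq(3) minus_add_distrib .
qed

lemma mem_translate_minus: "y \<in> (+) (- a) ` N \<longleftrightarrow> a + y \<in> (N :: 'a::ab_group_add set)"
proof
  assume "a + y \<in> N"
  then show "y \<in> (+) (- a) ` N" by (intro image_eqI[of _ _ "a + y"]) simp_all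
qed auto

section \<open>Isoperimetric subgroups\<close>

text \<open>Hamidoune's isoperimetric method: fragments minimising \<open>|X + Q| - |X|\<close> and then \<open>|X|\<close>
  among the sets with \<open>|X| \<ge> r\<close> and \<open>|H - (X + Q)| \<ge> r\<close>. The submodularity of \<open>X \<mapsto> |X + Q|\<close>
  makes two such atoms meeting in \<open>r\<close> elements equal. Symmetry of \<open>Q\<close> makes the complement
  of \<open>N + Q\<close> again a fragment, hence \<open>|N| \<le> |H - (N + Q)|\<close>.\<close>

lemma atom_exists:
  fixes Q H :: "'a::{finite,ab_group_add} set"
  assumes H: "subgrp H" and Q: "Q \<subseteq> H" "symm Q" "0 \<in> Q"
    and X: "X \<subseteq> H" "r \<le> card X" "r + card (X + Q) \<le> card H"
  obtains N where "N \<subseteq> H" "r \<le> card N" "r + card (N + Q) \<le> card H"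
    "\<And>Y. Y \<subseteq> H \<Longrightarrow> r \<le> card Y \<Longrightarrow> r + card (Y + Q) \<le> card H \<Longrightarrow> card (N + Q) + card Y \<le> card (Y + Q) + card N"
    "\<And>N'. N' \<subseteq> H \<Longrightarrow> card N' = card N \<Longrightarrow> card (N' + Q) = card (N + Q) \<Longrightarrow> r \<le> card (N \<inter> N') \<Longrightarrow> N' = N"
proof -
  define frag where "frag Y \<longleftrightarrow> Y \<subseteq> H \<and> r \<le> card Y \<and> r + card (Y + Q) \<le> card H" for Y
  define c where "c = card (UNIV :: 'a set)"
  have cle: "card Y \<le> c" for Y :: "'a set" unfolding c_def by (intro card_mono) auto
  \<comment> \<open>Lexicographic minimisation in one number: no set has more than \<open>c\<close>
    elements, so the boundary dominates and the size decides among equal boundaries.\<close>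
  define M where "M Y = (card (Y + Q) - card Y) * (c + 1) + card Y" for Y
  have "frag X" using X by (simp add: frag_def)
  then obtain N where N: "frag N" and min: "\<And>Y. frag Y \<Longrightarrow> M N \<le> M Y"
    using ex_has_least_nat[of frag X M] by blast
  define k where "k = card (N + Q) - card N"
  have k: "card (N + Q) = card N + k" using card_set_plus_ge[OF Q(3), of N] by (simp add: k_def)
  have ge: "card Y + k \<le> card (Y + Q)" if "frag Y" for Y
  proof (rule ccontr)
    assume "\<not> card Y + k \<le> card (Y + Q)"
    then have "Suc (card (Y + Q) - card Y) \<le> k" using card_set_plus_ge[OF Q(3), of Y] by linarith
    then have "Suc (card (Y + Q) - card Y) * (c + 1) \<le> k * (c + 1)" by (rule mult_le_mono1)
    then show False using min[OF that] cle[of Y] by (simp add: M_def k_def)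
  qed
  have small: "card N \<le> card Y" if "frag Y" "card (Y + Q) = card Y + k" for Y
    using min[OF that(1)] that(2) by (simp add: M_def k_def)
  have "card N + k \<le> card H" using N k by (simp add: frag_def)
  have NQ: "N + Q \<subseteq> H" using N Q(1) H by (simp add: frag_def set_plus_subset_subgrp)
  define N' where "N' = H - (N + Q)"
  have cN': "card N' = card H - (card N + k)" using NQ k by (simp add: N'_def card_Diff_subset)
  have sub: "N' + Q \<subseteq> H - N"
  proof
    fix z assume "z \<in> N' + Q"
    then obtain y q where yq: "y \<in> N'" "q \<in> Q" "z = y + q" by (auto simp: set_plus_iff)
    have "z \<notin> N"
    proof
      assume "z \<in> N"
      then have "z + - q \<in> N + Q" using yq Q(2) by (intro set_plus_memI) (auto simp: symm_def)
      then show False using yq by (simp add: N'_def)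
    qed
    moreover have "z \<in> H" using yq Q(1) H by (auto simp: N'_def intro: subgrp_add)
    ultimately show "z \<in> H - N" by simp
  qed
  have cN'Q: "card (N' + Q) \<le> card H - card N"
    using card_mono[OF _ sub] N by (simp add: frag_def card_Diff_subset)
  have fN': "frag N'"
    using N cN' cN'Q k by (auto simp: frag_def N'_def[symmetric]) (simp add: N'_def)
  have dual: "2 * card N + k \<le> card H"
    using ge[OF fN'] cN' cN'Q \<open>card N + k \<le> card H\<close> small[OF fN'] by linarith
  show ?thesis
  proof (rule that)
    show "N \<subseteq> H" "r \<le> card N" "r + card (N + Q) \<le> card H" using N by (simp_all add: frag_def)
    show "card (N + Q) + card Y \<le> card (Y + Q) + card N"
      if "Y \<subseteq> H" "r \<le> card Y" "r + card (Y + Q) \<le> card H" for Y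
      using ge[of Y] that k by (simp add: frag_def)
    show "T = N" if T: "T \<subseteq> H" "card T = card N" "card (T + Q) = card (N + Q)" "r \<le> card (N \<inter> T)" for T
    proof (rule ccontr)
      assume "T \<noteq> N"
      have lt: "card (N \<inter> T) < card N"
      proof (rule ccontr)
        assume "\<not> card (N \<inter> T) < card N"
        then have "card (N \<inter> T) = card N" using card_mono[of N "N \<inter> T"] by simp
        then have "N \<inter> T = N" by (intro card_subset_eq) auto
        then have "N \<subseteq> T" by auto
        then have "N = T" using T(2) by (intro card_subset_eq) auto
        then show False using \<open>T \<noteq> N\<close> by simp
      qed
      have "card ((N \<inter> T) + Q) \<le> card (N + Q)" by (intro card_mono set_plus_mono_left) auto
      then have fI: "frag (N \<inter> T)" using N T by (auto simp: frag_def)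
      \<comment> \<open>As a fragment smaller than the atom, \<open>N \<inter> T\<close> has
        boundary larger than \<open>k\<close>. By submodularity the union then has boundary below
        \<open>k\<close>, and \<open>dual\<close> keeps its sumset far enough from \<open>H\<close>
        for it to be a fragment.\<close>
      have I: "card (N \<inter> T) + k < card ((N \<inter> T) + Q)"
        using ge[OF fI] small[OF fI] lt by linarith
      have U: "(N \<union> T) + Q = (N + Q) \<union> (T + Q)" by (rule Un_set_plus)
      have "card (N + Q) + card (T + Q) = card ((N \<union> T) + Q) + card ((N + Q) \<inter> (T + Q))"
        unfolding U by (intro card_Un_Int) auto
      moreover have "card ((N \<inter> T) + Q) \<le> card ((N + Q) \<inter> (T + Q))"
        by (intro card_mono Int_greatest set_plus_mono_left) auto
      moreover have "card N + card T = card (N \<union> T) + card (N \<inter> T)" by (intro card_Un_Int) auto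
      ultimately have "card ((N \<union> T) + Q) < card (N \<union> T) + k" "card ((N \<union> T) + Q) + r \<le> card H"
        using I T k dual by linarith+
      moreover have "r \<le> card (N \<union> T)"
        using N card_mono[of "N \<union> T" N] by (simp add: frag_def)
      ultimately show False using ge[of "N \<union> T"] N T by (simp add: frag_def)
    qed
  qed
qed

lemma translate_subset: "subgrp H \<Longrightarrow> c \<in> H \<Longrightarrow> N \<subseteq> H \<Longrightarrow> (+) c ` N \<subseteq> H"
  using subgrp_add by blast

text \<open>For \<open>r = 1\<close>, two translates of an atom that meet are equal. The translate
  through 0 is therefore mapped to itself by subtracting any of its elements.\<close>

lemma isoperimetric_subgroup:
  fixes Q H :: "'a::{finite,ab_group_add} set"
  assumes H: "subgrp H" and Q: "Q \<subseteq> H" "symm Q" "0 \<in> Q" "Q \<noteq> H"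
  obtains L where "subgrp L" "L \<subseteq> H" "L + Q \<noteq> H"
    "\<And>Y. Y \<subseteq> H \<Longrightarrow> Y \<noteq> {} \<Longrightarrow> Y + Q \<noteq> H \<Longrightarrow> card (L + Q) + card Y \<le> card (Y + Q) + card L"
proof -
  have lt: "1 + card (Y + Q) \<le> card H \<longleftrightarrow> Y + Q \<noteq> H" if "Y \<subseteq> H" for Y
  proof -
    have "Y + Q \<subseteq> H" using that H Q by (simp add: set_plus_subset_subgrp)
    then have "Y + Q \<noteq> H \<longrightarrow> card (Y + Q) < card H" by (simp add: psubset_card_mono psubsetI)
    then show ?thesis by auto
  qed
  have pos: "1 \<le> card Y \<longleftrightarrow> Y \<noteq> {}" for Y :: "'a set" by (simp add: Suc_le_eq card_gt_0_iff)
  have Q0: "{0} + Q = Q" by (auto simp: set_plus_iff)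
  have "{0} \<subseteq> H" using subgrp_zero[OF H] by simp
  then obtain N where N: "N \<subseteq> H" "1 \<le> card N" "1 + card (N + Q) \<le> card H"
    and min: "\<And>Y. Y \<subseteq> H \<Longrightarrow> 1 \<le> card Y \<Longrightarrow> 1 + card (Y + Q) \<le> card H \<Longrightarrow> card (N + Q) + card Y \<le> card (Y + Q) + card N"
    and uniq: "\<And>N'. N' \<subseteq> H \<Longrightarrow> card N' = card N \<Longrightarrow> card (N' + Q) = card (N + Q) \<Longrightarrow> 1 \<le> card (N \<inter> N') \<Longrightarrow> N' = N"
    using atom_exists[OF H Q(1-3), of "{0}" 1] Q(4) lt[of "{0}"] Q0 by (metis One_nat_def card.empty card_insert_disjoint empty_iff finite.emptyI order_refl)
  obtain a where a: "a \<in> N" using N(2) by (metis One_nat_def card.empty equals0I not_one_le_zero)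
  have shift: "(+) (- y) ` N = N" if "a + y \<in> N" for y
  proof (rule uniq)
    have "y \<in> H" using that a N(1) subgrp_diff[OF H, of "a + y" a] by auto
    then show "(+) (- y) ` N \<subseteq> H" using N(1) H subgrp_minus by (intro translate_subset) auto
    have "a \<in> (+) (- y) ` N" using that by (intro image_eqI[of _ _ "a + y"]) auto
    then show "1 \<le> card (N \<inter> (+) (- y) ` N)" using a unfolding pos by blast
  qed (simp_all only: translate_set_plus card_translate)
  define L where "L = (+) (- a) ` N"
  have memL: "y \<in> L \<longleftrightarrow> a + y \<in> N" for y
    unfolding L_def by (rule mem_translate_minus)
  have cL: "card L = card N" "card (L + Q) = card (N + Q)"
    by (simp_all only: L_def translate_set_plus card_translate)
  have LH: "L \<subseteq> H" using a N(1) subgrp_minus[OF H, of a] unfolding L_def by (intro translate_subset H) auto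
  show ?thesis
  proof (rule that)
    show "subgrp L" unfolding subgrp_def
    proof (intro conjI ballI)
      show "0 \<in> L" using a by (simp add: memL)
      fix x y assume xy: "x \<in> L" "y \<in> L"
      have "- y + (a + x) \<in> (+) (- y) ` N" using xy by (simp add: memL)
      then have "- y + (a + x) \<in> N" using shift[of y] xy by (simp add: memL)
      then show "x - y \<in> L" by (simp add: memL algebra_simps)
    qed
    show "L \<subseteq> H" by (rule LH)
    show "L + Q \<noteq> H" using N(3) cL lt[OF LH] by simp
    show "card (L + Q) + card Y \<le> card (Y + Q) + card L" if "Y \<subseteq> H" "Y \<noteq> {}" "Y + Q \<noteq> H" for Y
      using min[OF that(1)] that lt[OF that(1)] pos[of Y] cL by simp
  qed
qed

text \<open>Vosper's dichotomy for symmetric \<open>Q\<close>. A 2-atom \<open>N\<close> meets its reflection \<open>a + b - N\<close> in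
  \<open>a\<close> and \<open>b\<close>, so it equals it for all distinct \<open>a, b \<in> N\<close>. With three elements in \<open>N\<close> this
  forces all differences of \<open>N\<close> to be periods.\<close>

lemma vosper_symmetric:
  fixes Q H :: "'a::{finite,ab_group_add} set"
  assumes H: "subgrp H" and Q: "Q \<subseteq> H" "symm Q" "0 \<in> Q"
    and X: "X \<subseteq> H" "2 \<le> card X" "2 + card (X + Q) \<le> card H" "card (X + Q) + 1 \<le> card X + card Q"
  obtains x where "x \<in> H" "x \<noteq> 0" "card (Q \<union> (+) x ` Q) \<le> card Q + 1" "2 + card (Q \<union> (+) x ` Q) \<le> card H"
  | K where "subgrp K" "K \<subseteq> H" "K \<noteq> {0}" "K + Q \<noteq> H" "card (K + Q) + 1 \<le> card K + card Q"
proof -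
  obtain N where N: "N \<subseteq> H" "2 \<le> card N" "2 + card (N + Q) \<le> card H"
    and min: "\<And>Y. Y \<subseteq> H \<Longrightarrow> 2 \<le> card Y \<Longrightarrow> 2 + card (Y + Q) \<le> card H \<Longrightarrow> card (N + Q) + card Y \<le> card (Y + Q) + card N"
    and uniq: "\<And>N'. N' \<subseteq> H \<Longrightarrow> card N' = card N \<Longrightarrow> card (N' + Q) = card (N + Q) \<Longrightarrow> 2 \<le> card (N \<inter> N') \<Longrightarrow> N' = N"
    using atom_exists[OF H Q X(1-3)] by metis
  have NQ: "card (N + Q) + 1 \<le> card N + card Q" using min[OF X(1-3)] X(4) by linarith
  have refl: "(+) (a + b) ` uminus ` N = N" if ab: "a \<in> N" "b \<in> N" "a \<noteq> b" for a b
  proof (rule uniq)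
    show "(+) (a + b) ` uminus ` N \<subseteq> H"
      using N(1) ab H by (intro translate_subset) (auto intro: subgrp_add subgrp_minus)
    have "{a, b} \<subseteq> N \<inter> (+) (a + b) ` uminus ` N"
      using ab by (auto simp: image_iff intro!: bexI[of _ b] bexI[of _ a])
    then have "card {a, b} \<le> card (N \<inter> (+) (a + b) ` uminus ` N)" by (intro card_mono) auto
    then show "2 \<le> card (N \<inter> (+) (a + b) ` uminus ` N)" using ab by simp
  qed (simp_all add: translate_set_plus reflect_set_plus[OF Q(2)] card_translate card_reflect)
  obtain a where a: "a \<in> N" using N(2) by fastforce
  define L where "L = (+) (- a) ` N"
  have memL: "y \<in> L \<longleftrightarrow> a + y \<in> N" for y
    unfolding L_def by (rule mem_translate_minus)
  have cL: "card L = card N" "card (L + Q) = card (N + Q)"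
    by (simp_all only: L_def translate_set_plus card_translate)
  have LH: "L \<subseteq> H" using a N(1) subgrp_minus[OF H, of a] unfolding L_def by (intro translate_subset H) auto
  have L0: "0 \<in> L" using a by (simp add: memL)
  show ?thesis
  proof (cases "card N = 2")
    case True
    then have "card (L - {0}) = 1" using cL L0 by simp
    then obtain x where "L - {0} = {x}" by (auto simp: card_1_singleton_iff)
    then have x: "L = {0, x}" "x \<noteq> 0" using L0 by auto
    have "{0, x} + Q = Q \<union> (+) x ` Q" by (auto simp: set_plus_iff)
    then have "card (Q \<union> (+) x ` Q) = card (N + Q)" using x(1) cL by simp
    then show ?thesis using that(1)[of x] x LH N(3) NQ True by auto
  next
    case False
    \<comment> \<open>The reflections with sums \<open>d + c\<close> and \<open>d + b\<close>
      compose to this translation. Each needs two distinct points of \<open>N\<close>, hence the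
      third element \<open>d\<close>.\<close>
    have per: "(+) (b - c) ` N = N" if bc: "b \<in> N" "c \<in> N" for b c
    proof (cases "b = c")
      case False
      have "card {b, c} < card N" using \<open>card N \<noteq> 2\<close> N(2) False by simp
      then have "\<not> N \<subseteq> {b, c}" using card_mono[of "{b, c}" N] by auto
      then obtain d where d: "d \<in> N" "d \<noteq> b" "d \<noteq> c" by auto
      have "(+) (b - c) ` N = (+) (b - c) ` (+) (d + c) ` uminus ` N"
        using refl[of d c] d bc by simp
      also have "\<dots> = (+) (d + b) ` uminus ` N" by (simp add: image_image algebra_simps)
      also have "\<dots> = N" using refl[of d b] d bc by simp
      finally show ?thesis .
    qed (simp add: image_def)
    have "subgrp L" unfolding subgrp_def
    proof (intro conjI ballI)
      fix x y assume xy: "x \<in> L" "y \<in> L"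
      have "a + x + - (a + y) + a \<in> (+) (a + x - (a + y)) ` N" using a by simp
      then have "a + x + - (a + y) + a \<in> N" using per[of "a + x" "a + y"] xy by (simp add: memL)
      then show "x - y \<in> L" by (simp add: memL algebra_simps)
    qed (rule L0)
    moreover have "L \<noteq> {0}" using cL N(2) by auto
    moreover have "L + Q \<noteq> H" using cL N(3) by auto
    ultimately show ?thesis using that(2)[of L] LH cL NQ by simp
  qed
qed

section \<open>Sums of a fixed number of elements of a dense part of a coset\<close>

definition restricted_sums :: "'a::ab_group_add set \<Rightarrow> nat \<Rightarrow> 'a set" where
  "restricted_sums T j = {\<Sum>A | A. A \<subseteq> T \<and> card A = j}"

text \<open>Taking complements in \<open>T\<close> turns a sum \<open>y\<close> into
  \<open>\<Sum>T - y\<close>.\<close>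

lemma card_restricted_sums_compl:
  fixes T :: "'a::{finite,ab_group_add} set"
  assumes "j \<le> card T"
  shows "card (restricted_sums T j) = card (restricted_sums T (card T - j))"
proof -
  have "(\<lambda>y. \<Sum>T - y) ` restricted_sums T i \<subseteq> restricted_sums T (card T - i)" for i
  proof
    fix z assume "z \<in> (\<lambda>y. \<Sum>T - y) ` restricted_sums T i"
    then obtain A where A: "A \<subseteq> T" "card A = i" "z = \<Sum>T - \<Sum>A" by (auto simp: restricted_sums_def)
    then have "z = \<Sum>(T - A)" "card (T - A) = card T - i"
      by (simp_all add: sum_diff card_Diff_subset)
    then show "z \<in> restricted_sums T (card T - i)" unfolding restricted_sums_def by blast
  qed
  note * = this[THEN card_mono[OF finite]]
  have "card ((\<lambda>y. \<Sum>T - y) ` restricted_sums T i) = card (restricted_sums T i)" for i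
    by (intro card_image inj_onI) simp
  then show ?thesis using *[of j] *[of "card T - j"] assms by simp
qed

text \<open>Greedy choice: a new pair \<open>{p, c - p}\<close> has to avoid \<open>F\<close>, the
  reflection of \<open>F\<close> and the pairs already chosen. \<open>F\<close> holds the elements
  reserved for the part of the sum that varies.\<close>

lemma pairs_with_given_sum:
  fixes P F :: "'a::{finite,ab_group_add} set"
  assumes "\<And>y. y \<in> P \<Longrightarrow> c - y \<in> P \<and> c - y \<noteq> y" and "2 * q + 2 * card F \<le> card P"
  shows "\<exists>A. A \<subseteq> P \<and> A \<inter> F = {} \<and> card A = 2 * q \<and> (\<forall>y\<in>A. c - y \<in> A) \<and> \<Sum>A = (\<Sum>i<q. c)"
  using assms(2)
proof (induction q)
  case 0
  show ?case by (intro exI[of _ "{}"]) simp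
next
  case (Suc q)
  then obtain A where A: "A \<subseteq> P" "A \<inter> F = {}" "card A = 2 * q" "\<forall>y\<in>A. c - y \<in> A" "\<Sum>A = (\<Sum>i<q. c)"
    by auto
  let ?X = "F \<union> (\<lambda>y. c - y) ` F \<union> A"
  have "card ?X \<le> card (F \<union> (\<lambda>y. c - y) ` F) + card A" by (rule card_Un_le)
  also have "card (F \<union> (\<lambda>y. c - y) ` F) \<le> card F + card ((\<lambda>y. c - y) ` F)" by (rule card_Un_le)
  also have "card ((\<lambda>y. c - y) ` F) \<le> card F" by (intro card_image_le) simp
  finally have "card ?X < card P" using A(3) Suc.prems by simp
  then have "\<not> P \<subseteq> ?X" using card_mono[of ?X P] by auto
  then obtain p where p: "p \<in> P" "p \<notin> F" "p \<notin> (\<lambda>y. c - y) ` F" "p \<notin> A" by auto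
  have cp: "c - p \<notin> A" using A(4) p(4) by (metis diff_diff_eq2 add_diff_cancel_left')
  have cF: "c - p \<notin> F"
  proof
    assume "c - p \<in> F"
    then have "p \<in> (\<lambda>y. c - y) ` F" by (intro image_eqI[of _ _ "c - p"]) simp_all
    then show False using p by simp
  qed
  have ne: "c - p \<in> P" "c - p \<noteq> p" using assms(1)[OF p(1)] by auto
  let ?A = "insert p (insert (c - p) A)"
  have "card ?A = 2 * Suc q" using A(3) p(4) cp ne by simp
  moreover have "\<Sum>?A = (\<Sum>i<Suc q. c)" using A(5) p(4) cp ne by simp
  moreover have "\<forall>y\<in>?A. c - y \<in> ?A" using A(4) by auto
  ultimately show ?case using A(1,2) p cF ne by (intro exI[of _ ?A]) auto
qed

text \<open>If doubling is injective on \<open>K\<close>, then \<open>x + x\<close> has only the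
  root \<open>x\<close> in the coset. Otherwise doubling is not onto \<open>K\<close>, and some
  value has no root there at all.\<close>

lemma doubling_sparse_value:
  fixes K :: "'a::{finite,ab_group_add} set"
  assumes K: "subgrp K"
  obtains c where "c - (x + x) \<in> K" "card {y. y - x \<in> K \<and> y + y = c} \<le> 1"
proof (cases "inj_on (\<lambda>k. k + k) K")
  case True
  have "y = x" if "y - x \<in> K" "y + y = x + x" for y
  proof -
    have "(y - x) + (y - x) = 0 + 0" using that(2) by (simp add: algebra_simps)
    then have "y - x = 0" using inj_onD[OF True] that(1) subgrp_zero[OF K] by blast
    then show ?thesis by simp
  qed
  then have "{y. y - x \<in> K \<and> y + y = x + x} \<subseteq> {x}" by blast
  then have "card {y. y - x \<in> K \<and> y + y = x + x} \<le> card {x}" by (intro card_mono) auto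
  then show ?thesis using that[of "x + x"] subgrp_zero[OF K] by simp
next
  case False
  have "(\<lambda>k. k + k) ` K \<subseteq> K" using subgrp_add[OF K] by blast
  moreover have "(\<lambda>k. k + k) ` K \<noteq> K" using False by (metis eq_card_imp_inj_on finite)
  ultimately obtain k where k: "k \<in> K" "k \<notin> (\<lambda>k. k + k) ` K" by blast
  have "y + y \<noteq> x + x + k" if "y - x \<in> K" for y
  proof
    assume "y + y = x + x + k"
    then have "k = (y - x) + (y - x)" by (simp add: algebra_simps)
    then show False using k(2) that by blast
  qed
  then have "{y. y - x \<in> K \<and> y + y = x + x + k} = {}" by blast
  then have "card {y. y - x \<in> K \<and> y + y = x + x + k} = 0" by (simp only: card.empty)
  then show ?thesis using that[of "x + x + k"] k by (simp only: add_diff_cancel_left' zero_le)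
qed

text \<open>Sums of \<open>j \<le> |T| / 2\<close> elements: fix \<open>c\<close> so that most of \<open>T\<close> splits into pairs with
  sum \<open>c\<close>, use \<open>\<lfloor>(j - 1) / 2\<rfloor>\<close> such pairs, and let the remaining one or two elements vary.\<close>

lemma card_restricted_sums_half:
  fixes T K :: "'a::{finite,ab_group_add} set"
  assumes K: "subgrp K" and T: "\<And>y. y \<in> T \<Longrightarrow> y - x \<in> K"
    and big: "4 * (card K - card T) < card K" and s: "s \<in> K" "s + s \<noteq> 0"
    and j: "1 \<le> j" "2 * j \<le> card T"
  shows "card T \<le> card (restricted_sums T j)"
proof -
  let ?E = "(+) x ` K"
  have memE: "y \<in> ?E \<longleftrightarrow> y - x \<in> K" for y using mem_translate_minus[of y "- x" K] by simp
  have TE: "T \<subseteq> ?E" using T memE by blast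
  have cE: "card ?E = card K" by (rule card_translate)
  define w where "w = card K - card T"
  have TK: "card T \<le> card K" using card_mono[OF _ TE] cE by simp
  have cET: "card (?E - T) = w" using TE cE by (simp add: card_Diff_subset w_def)
  obtain c where c: "c - (x + x) \<in> K" "card {y. y - x \<in> K \<and> y + y = c} \<le> 1"
    using doubling_sparse_value[OF K] .
  have refl: "c' - y \<in> ?E" if "c' - (x + x) \<in> K" "y \<in> ?E" for c' y
  proof -
    have "(c' - (x + x)) - (y - x) \<in> K" using that memE subgrp_diff[OF K] by blast
    moreover have "(c' - (x + x)) - (y - x) = c' - y - x" by (simp add: algebra_simps)
    ultimately show ?thesis unfolding memE by simp
  qed
  define P where "P = {y \<in> T. c - y \<in> T \<and> c - y \<noteq> y}"
  have P1: "c - y \<in> P \<and> c - y \<noteq> y" if "y \<in> P" for y using that by (auto simp: P_def)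
  have bad: "card {y \<in> ?E. c' - y \<notin> T} \<le> w" if "c' - (x + x) \<in> K" for c'
  proof -
    have "card {y \<in> ?E. c' - y \<notin> T} = card ((\<lambda>y. c' - y) ` {y \<in> ?E. c' - y \<notin> T})"
      by (intro card_image[symmetric] inj_onI) simp
    also have "\<dots> \<le> card (?E - T)" using refl[OF that] by (intro card_mono) auto
    finally show ?thesis using cET by simp
  qed
  \<comment> \<open>An element of the coset fails to be in \<open>P\<close> if it is one of the
    \<open>w\<close> elements missing from \<open>T\<close>, if its partner is, or if it is its own
    partner.\<close>
  have "?E \<subseteq> P \<union> ((?E - T) \<union> ({y \<in> ?E. c - y \<notin> T} \<union> {y. y - x \<in> K \<and> y + y = c}))"
    by (auto simp: P_def memE algebra_simps)
  then have "card ?E \<le> card (P \<union> ((?E - T) \<union> ({y \<in> ?E. c - y \<notin> T} \<union> {y. y - x \<in> K \<and> y + y = c})))"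
    by (intro card_mono) auto
  also have "\<dots> \<le> card P + (card (?E - T) + (card {y \<in> ?E. c - y \<notin> T} + card {y. y - x \<in> K \<and> y + y = c}))"
    by (intro order_trans[OF card_Un_le] add_left_mono)+ simp
  finally have cP: "card K \<le> card P + 2 * w + 1" using bad[OF c(1)] c(2) cE cET by simp
  \<comment> \<open>Rounding \<open>card P\<close> up to an even number matters for even
    \<open>j\<close>: with \<open>|T| = 8\<close>, \<open>w = 2\<close> and \<open>q = 1\<close> the
    count gives 5, and 6 are required.\<close>
  have evP: "even (card P)"
    by (rule even_card_fixpoint_free_involution[where f = "\<lambda>y. c - y"]) (use P1 in auto)
  have inE: "\<Sum>A \<in> restricted_sums T j" if "A \<subseteq> T" "card A = j" for A
    using that unfolding restricted_sums_def by blast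
  show ?thesis
  proof (cases "odd j")
    case True
    then obtain q where q: "j = 2 * q + 1" by (rule oddE)
    let ?s = "\<Sum>i<q. c"
    have "?s + y \<in> restricted_sums T j" if y: "y \<in> T" for y
    proof (cases "q = 0")
      case True
      then show ?thesis using inE[of "{y}"] y q by simp
    next
      case False
      have "4 * w < card K" "card K = card T + w" using big TK by (simp_all add: w_def)
      moreover obtain p where "card P = 2 * p" using evP by (rule evenE)
      ultimately have "2 * q + 2 * card {y} \<le> card P" using cP False j q by simp
      then obtain A where "A \<subseteq> P" "A \<inter> {y} = {}" "card A = 2 * q" "\<Sum>A = ?s"
        using pairs_with_given_sum[of P c q "{y}"] P1 by blast
      then show ?thesis using inE[of "insert y A"] y q by (auto simp: P_def add.commute)
    qed
    then have "(+) ?s ` T \<subseteq> restricted_sums T j" by blast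
    then have "card ((+) ?s ` T) \<le> card (restricted_sums T j)" by (intro card_mono) auto
    then show ?thesis by (simp only: card_translate)
  next
    case False
    then obtain q where q: "j = 2 * q + 2" using j(1) by (metis One_nat_def add_2_eq_Suc' evenE mult_Suc_right nat.exhaust not_one_le_zero mult_0_right add.commute)
    let ?s = "\<Sum>i<q. c"
    \<comment> \<open>Since \<open>s + s \<noteq> 0\<close>, translation by \<open>s\<close> moves
      the roots of \<open>d\<close> off themselves inside the coset, so they fill at most half of
      it.\<close>
    have fix_half: "2 * card {y \<in> ?E. y + y = d} \<le> card K" for d
    proof -
      let ?D = "{y \<in> ?E. y + y = d}"
      have "card ?D + card ((+) s ` ?D) = card (?D \<union> (+) s ` ?D)"
      proof (intro card_Un_disjoint[symmetric])
        have False if z: "z \<in> ?D" "z \<in> (+) s ` ?D" for z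
        proof -
          obtain y where y: "y \<in> ?D" "z = s + y" using z(2) by blast
          have "s + y + (s + y) = d" "y + y = d" using y z(1) by simp_all
          then have "(s + s) + d = d" by (simp add: algebra_simps)
          then show False using s(2) by simp
        qed
        then show "?D \<inter> (+) s ` ?D = {}" by blast
      qed auto
      also have "\<dots> \<le> card ?E"
      proof (intro card_mono Un_least)
        show "(+) s ` ?D \<subseteq> ?E"
        proof
          fix z assume "z \<in> (+) s ` ?D"
          then obtain y where "y - x \<in> K" "z - x = s + (y - x)" using memE by (auto simp: algebra_simps)
          then show "z \<in> ?E" using subgrp_add[OF K s(1)] memE by metis
        qed
      qed auto
      finally show ?thesis using cE by (simp add: card_translate)
    qed
    \<comment> \<open>Otherwise the coset is covered by two sets of size at most \<open>w\<close>
      and the roots of \<open>d\<close>, at most half of it, against \<open>4 * w < |K|\<close>. So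
      for even \<open>j\<close> the sums even fill a whole coset.\<close>
    have pair: "\<exists>y\<in>T. \<exists>z\<in>T. y \<noteq> z \<and> y + z = d" if d: "d - (x + x) \<in> K" for d
    proof (rule ccontr)
      assume no: "\<not> ?thesis"
      have "?E \<subseteq> (?E - T) \<union> ({y \<in> ?E. d - y \<notin> T} \<union> {y \<in> ?E. y + y = d})"
      proof
        fix y assume y: "y \<in> ?E"
        have "y \<noteq> d - y \<longrightarrow> \<not> (y \<in> T \<and> d - y \<in> T)" using no by force
        moreover have "y = d - y \<longrightarrow> y + y = d" by (metis diff_add_cancel)
        ultimately show "y \<in> (?E - T) \<union> ({y \<in> ?E. d - y \<notin> T} \<union> {y \<in> ?E. y + y = d})" using y by blast
      qed
      then have "card ?E \<le> card ((?E - T) \<union> ({y \<in> ?E. d - y \<notin> T} \<union> {y \<in> ?E. y + y = d}))"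
        by (intro card_mono) auto
      also have "\<dots> \<le> card (?E - T) + (card {y \<in> ?E. d - y \<notin> T} + card {y \<in> ?E. y + y = d})"
        by (intro order_trans[OF card_Un_le] add_left_mono card_Un_le)
      finally show False using cE cET bad[OF d] fix_half[of d] big by (simp add: w_def)
    qed
    have "?s + d \<in> restricted_sums T j" if d: "d - (x + x) \<in> K" for d
    proof -
      obtain y z where yz: "y \<in> T" "z \<in> T" "y \<noteq> z" "y + z = d" using pair[OF d] by blast
      show ?thesis
      proof (cases "q = 0")
        case True
        then show ?thesis using inE[of "{y, z}"] yz q by simp
      next
        case False
        have "4 * w < card K" "card K = card T + w" using big TK by (simp_all add: w_def)
        moreover obtain p where p: "card P = 2 * p" using evP by (rule evenE)
        moreover have "1 \<le> q" using False by simp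
        ultimately have "\<not> p \<le> q + 1" using cP j q by linarith
        then have "2 * q + 2 * card {y, z} \<le> card P" using yz(3) p by simp
        then obtain A where "A \<subseteq> P" "A \<inter> {y, z} = {}" "card A = 2 * q" "\<Sum>A = ?s"
          using pairs_with_given_sum[of P c q "{y, z}"] P1 by blast
        moreover from this have "A \<subseteq> T" by (auto simp: P_def)
        ultimately show ?thesis using inE[of "insert y (insert z A)"] yz(1-3) q
          by (simp add: ac_simps flip: yz(4))
      qed
    qed
    then have "(+) (?s + (x + x)) ` K \<subseteq> restricted_sums T j" by (auto simp: add.assoc)
    then have "card ((+) (?s + (x + x)) ` K) \<le> card (restricted_sums T j)" by (intro card_mono) auto
    then show ?thesis using TK by (simp only: card_translate)
  qed
qed

lemma card_restricted_sums:
  fixes T K :: "'a::{finite,ab_group_add} set"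
  assumes "subgrp K" "\<And>y. y \<in> T \<Longrightarrow> y - x \<in> K" "4 * (card K - card T) < card K"
    and "s \<in> K" "s + s \<noteq> 0" "1 \<le> j" "j < card T"
  shows "card T \<le> card (restricted_sums T j)"
proof (cases "2 * j \<le> card T")
  case False
  then have "card T \<le> card (restricted_sums T (card T - j))"
    using assms(7) by (intro card_restricted_sums_half[OF assms(1-5)]) auto
  then show ?thesis using card_restricted_sums_compl[of j T] assms(7) by simp
qed (use card_restricted_sums_half[OF assms(1-5)] assms(6) in blast)

section \<open>Numerical estimates for the layers\<close>

text \<open>In the estimates below \<open>q\<close> is the number of layers for which the given lower bounds on the
  layer sizes are incompatible with the inequality of \<open>layer_bound_card\<close>.\<close>

lemma sum_affine: "(\<Sum>j<q. 1 + 2 * k * int j) = int q + k * int q * (int q - 1)"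
  by (induction q) (simp_all add: algebra_simps)

lemma sum_affine':
  "1 \<le> q \<Longrightarrow> (\<Sum>j<q. if j = 0 then 1 else (2 * k + 2) * int j - 1) = 2 - int q + (k + 1) * int q * (int q - 1)"
  by (induction q rule: nat_induct_at_least) (simp_all add: algebra_simps)

text \<open>The cap \<open>n\<close> can act only in the last layer, where any lower bound
  \<open>N\<close> for the capped size will do.\<close>

lemma capped_layers:
  fixes g :: "nat \<Rightarrow> int" and m b n N :: int
  assumes "m * int q \<le> b" "\<And>j. j < q \<Longrightarrow> g j \<le> n" "N \<le> n" "N \<le> g q"
    and "b\<^sup>2 < m * (\<Sum>j<q. g j) + (b - m * int q) * N"
  shows "b\<^sup>2 < m * (\<Sum>j<q. min n (g j)) + (b - m * int q) * min n (g q)"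
proof -
  have "(\<Sum>j<q. min n (g j)) = (\<Sum>j<q. g j)" using assms(2) by (intro sum.cong) (simp_all add: min_absorb2)
  moreover have "(b - m * int q) * N \<le> (b - m * int q) * min n (g q)"
    using assms(1,3,4) by (intro mult_left_mono) auto
  ultimately show ?thesis using assms(5) by simp
qed

lemma affine_layers_le: "0 \<le> k \<Longrightarrow> 1 + 2 * k * (int q - 1) \<le> n \<Longrightarrow> j < q \<Longrightarrow> 1 + 2 * k * int j \<le> (n :: int)"
  by (rule order_trans[of _ "1 + 2 * k * (int q - 1)"]) (auto intro!: mult_left_mono)

text \<open>Sizes are measured in units of \<open>|K|\<close>: \<open>u\<close> stands for
  \<open>size_out\<close>, \<open>y\<close> for the periodic set, and all defects are supposed to be
  at most \<open>u - 1\<close>. The choice is \<open>y div u\<close> layers;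
  \<open>u * (u - 1) \<le> y\<close> makes this at least \<open>u - 1\<close>.\<close>

lemma periodic_layers:
  fixes u y :: int
  assumes u: "1 \<le> u" and y: "1 \<le> y" "u * (u - 1) \<le> y"
  shows "\<exists>q. (u - 1) * int q \<le> y \<and> y\<^sup>2 < (u - 1) * (\<Sum>j<q. min (2 * y) (1 + 2 * u * int j))
    + (y - (u - 1) * int q) * min (2 * y) (1 + 2 * u * int q)"
proof -
  define q where "q = nat (y div u)"
  define e where "e = y mod u"
  have q: "int q = y div u" using u y by (simp add: q_def pos_imp_zdiv_nonneg_iff)
  have ye: "y = u * int q + e" unfolding q e_def by simp
  have e: "0 \<le> e" "e < u" using u by (simp_all add: e_def)
  have "u * (u - 1) < u * (int q + 1)" using y(2) ye e by (simp add: algebra_simps)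
  then have qu: "u - 1 \<le> int q" using u by (simp add: mult_less_cancel_left)
  have q1: "(u - 1) * int q \<le> y" using ye e by (simp add: algebra_simps)
  have cap: "1 + 2 * u * int j \<le> 2 * y" if "j < q" for j
    using affine_layers_le[of u q "2 * y" j] that u ye e by (simp add: algebra_simps)
  show ?thesis
  proof (intro exI[of _ q] conjI)
    show "(u - 1) * int q \<le> y" by (rule q1)
    show "y\<^sup>2 < (u - 1) * (\<Sum>j<q. min (2 * y) (1 + 2 * u * int j))
      + (y - (u - 1) * int q) * min (2 * y) (1 + 2 * u * int q)"
    \<comment> \<open>If \<open>e = 0\<close>, layer \<open>q\<close> has the bound
      \<open>2 * y + 1\<close>, just above the cap \<open>2 * y\<close>.\<close>
    proof (cases "e = 0")
      case True
      show ?thesis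
      proof (rule capped_layers[OF q1 cap])
        have "0 < int q" using y(1) ye True u by (cases q) auto
        have "0 < int q * (u * (int q - u + 2) - 1)"
        proof (cases "u = 1")
          case False
          have "u * 1 \<le> u * (int q - u + 2)" using qu u by (intro mult_left_mono) auto
          then have "0 < u * (int q - u + 2) - 1" using False u by linarith
          then show ?thesis using \<open>0 < int q\<close> by (rule mult_pos_pos[rotated])
        qed (use \<open>0 < int q\<close> in simp)
        then show "y\<^sup>2 < (u - 1) * (\<Sum>j<q. 1 + 2 * u * int j) + (y - (u - 1) * int q) * (2 * y)"
          unfolding sum_affine ye True by (simp add: algebra_simps power2_eq_square)
      qed (use ye True in auto)
    next
      case False
      show ?thesis
      proof (rule capped_layers[OF q1 cap])
        have "u * (u - 1) * 1 \<le> u * int q * (int q - u + 2)"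
          using qu u by (intro mult_mono) auto
        moreover have "e * (e - 1) \<le> (u - 1) * (u - 2)"
          using e False by (intro mult_mono) auto
        ultimately have "0 < u * int q * (int q - u + 2) + e * (1 - e)"
          using e False by (simp add: algebra_simps)
        then show "y\<^sup>2 < (u - 1) * (\<Sum>j<q. 1 + 2 * u * int j) + (y - (u - 1) * int q) * (1 + 2 * u * int q)"
          unfolding sum_affine ye by (simp add: algebra_simps power2_eq_square)
      qed (use ye e False in auto)
    qed
  qed
qed

lemma general_layers:
  fixes k m b :: int
  assumes k: "3 \<le> k" and m: "0 \<le> m" "m \<le> k - 2" and b: "2 * b = (k - 1) * (k - 2) + 6 + 2 * m"
  shows "\<exists>q. m * int q \<le> b \<and> b\<^sup>2 < m * (\<Sum>j<q. min (2 * b) (1 + 2 * k * int j))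
    + (b - m * int q) * min (2 * b) (1 + 2 * k * int q)"
proof -
  have main: ?thesis if t: "m * Q \<le> b" "1 + 2 * k * (Q - 1) \<le> 2 * b" "N \<le> 2 * b" "N \<le> 1 + 2 * k * Q"
    "b\<^sup>2 < m * (Q + k * Q * (Q - 1)) + (b - m * Q) * N" "0 \<le> Q" for Q N
  proof -
    obtain q where q: "Q = int q" using t(6) by (metis nonneg_int_cases)
    have "m * int q \<le> b" using t q by simp
    then show ?thesis
      using capped_layers[of m q b "\<lambda>j. 1 + 2 * k * int j" "2 * b" N] affine_layers_le[of k q "2 * b"]
        t k unfolding q sum_affine by (intro exI[of _ q]) auto
  qed
  consider q where "k = 2 * q + 1" | q where "k = 2 * q" by (metis evenE oddE)
  then show ?thesis
  proof cases
    case (1 q)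
    have q: "1 \<le> q" using k 1 by simp
    have bq: "b = 2 * q * q - q + 3 + m" using b unfolding 1 by (simp add: algebra_simps)
    have mq: "m * q \<le> (2 * q - 1) * q" using m(2) q 1 by (intro mult_right_mono) auto
    show ?thesis
    \<comment> \<open>This decides which is smaller for the last layer: the cap \<open>2 * b\<close>
      or \<open>1 + 2 * k * q = 4 * q * q + 2 * q + 1\<close>.\<close>
    proof (cases "m \<le> 2 * q - 3")
      case True
      define p where "p = 2 * q - 3 - m"
      have p: "0 \<le> p" "p \<le> 2 * q - 3" and mp: "m = 2 * q - 3 - p" using True m by (auto simp: p_def)
      have q2: "2 \<le> q" using p by simp
      have "0 \<le> q * p * ((q - 1) * (q - 1))" "0 \<le> q * p * (2 * q - 3 - p)" "0 \<le> q * p * (q - 2)"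
        "0 < q * q" "0 \<le> p * p" "0 \<le> q * q * q" "0 \<le> q * p" using p q2 by simp_all
      then have "0 < 2 * (q * q * q * p) + 4 * (q * q * q) + 3 * (q * q * p) + 10 * (q * q) - 2 * (q * p * p) - 8 * (q * p)"
        by (simp add: algebra_simps)
      then have "0 < 2 * (q * q * q * p) + 4 * (q * q * q) + 3 * (q * q * p) + 10 * (q * q) - 2 * (q * p * p) - 8 * (q * p) + p * p"
        using zero_le_square[of p] by linarith
      moreover have "0 \<le> p * (q - 1)" using p q by simp
      ultimately show ?thesis
        by (intro main[of q "2 * b"]) (use mq q True m in \<open>simp_all add: bq 1 mp algebra_simps power2_eq_square\<close>)
    next
      case False
      then consider "m = 2 * q - 1" | "m = 2 * q - 2" using m 1 by linarith
      then show ?thesis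
      proof cases
        case a: 1
        have "1 * q \<le> q * q" using q by (intro mult_right_mono) auto
        then have "0 < 4 * (q * q) + 2 * q - 2" using q by linarith
        then show ?thesis using q
          by (intro main[of q "4 * q * q + 2 * q + 1"]) (simp_all add: bq 1 a algebra_simps power2_eq_square)
      next
        case a: 2
        have "0 < 2 * (q * q * q) + 7 * (q * q) + 3 * q" using q by (intro add_pos_pos) simp_all
        then show ?thesis using q
          by (intro main[of q "4 * q * q + 2 * q + 1"]) (simp_all add: bq 1 a algebra_simps power2_eq_square)
      qed
    qed
  next
    case (2 q)
    have q: "2 \<le> q" using k 2 by simp
    have bq: "b = 2 * q * q - 3 * q + 4 + m" using b unfolding 2 by (simp add: algebra_simps)
    show ?thesis
    \<comment> \<open>The condition says that layer \<open>q - 1\<close> stays below the cap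
      \<open>2 * b\<close>; otherwise only \<open>q - 1\<close> layers precede the capped
      one.\<close>
    proof (cases "2 * q - 7 \<le> 2 * m")
      case True
      define p where "p = 2 * q - 2 - m"
      have p: "0 \<le> p" "p \<le> 2 * q - 2" and mp: "m = 2 * q - 2 - p" using m 2 by (auto simp: p_def)
      have "0 \<le> q * p * ((q - 1) * (q - 1))" "0 \<le> q * p * (2 * q - 2 - p)" "0 \<le> p * (q - 2)"
        "0 < q * q" "0 \<le> p * p" "0 \<le> q * p" using p q by simp_all
      then have "0 \<le> 2 * (q * q * q * p) - 2 * (q * p * p) + q * p - 4 * p"
        using q by (simp add: algebra_simps)
      then have "0 < 2 * (q * q * q * p) + 3 * (q * q) - 2 * (q * p * p) + q * p + 2 * q + p * p - 4 * p + 4"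
        using q zero_le_square[of p] zero_le_square[of q] by linarith
      moreover have "0 \<le> p * (q - 1)" using p q by simp
      moreover have "m * q \<le> (2 * q - 2) * q" using m(2) q 2 by (intro mult_right_mono) auto
      ultimately show ?thesis
        by (intro main[of q "2 * b"]) (use q True m in \<open>simp_all add: bq 2 mp algebra_simps power2_eq_square\<close>)
    next
      case False
      define r where "r = q - 1"
      define p where "p = r - 3 - m"
      have rp: "q = r + 1" "m = r - 3 - p" "0 \<le> p" "p \<le> r - 3" using False m by (auto simp: p_def r_def)
      have "0 \<le> r * p * (r - p)" using rp by simp
      then have A: "0 \<le> 2 * (r * r * p) - 2 * (r * p * p)" by (simp add: algebra_simps)
      have B: "r * p \<le> r * r" using rp by (intro mult_left_mono) auto
      have C: "0 \<le> r * r * r * p" "0 \<le> r * r * r * r" "0 \<le> r * r * r" "0 < r * r" using rp by simp_all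
      have "0 \<le> p * r" using rp by simp
      then have D: "1 + p \<le> p * r + (r * r + r * 4)" "p \<le> p * r + (r * r + r * 5)"
        using C rp(3,4) by linarith+
      have "0 < 2 * (r * r * r * r) + 2 * (r * r * r * p) + 10 * (r * r * r) + 2 * (r * r * p) + 15 * (r * r)
        - 2 * (r * p * p) - 9 * (r * p) + 3 * r + p * p"
        using A B C rp zero_le_square[of p] by linarith
      moreover have "m * r \<le> r * r" using rp by (intro mult_right_mono) auto
      ultimately show ?thesis
        by (intro main[of r "2 * b"]) (use m rp(3,4) D in \<open>simp_all add: bq 2 rp(1,2) algebra_simps power2_eq_square\<close>)
    qed
  qed
qed

text \<open>The size \<open>(2 * k + 2) * j - 1\<close> is \<open>|Q| = 2 * k + 1\<close> plus
  \<open>2 * k + 2\<close> for each further step. The cap is the order \<open>n\<close> of the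
  group, because one case needs a last layer larger than \<open>2 * b\<close>.\<close>

lemma odd_layers:
  fixes k m b n :: int
  assumes k: "3 \<le> k" and m: "0 \<le> m" and n: "2 * b \<le> n"
    and b: "even k \<and> (2 * b = k * (k - 1) + 2 * m \<and> m \<le> k - 1 \<or> 2 * b = k * (k + 1) \<and> m = k - 1) \<or>
      odd k \<and> 2 * b = k * (k - 1) + 2 + 2 * m \<and> (m \<le> k - 2 \<or> m = k - 1 \<and> 2 * k\<^sup>2 + 3 * k \<le> 2 * n + 5)"
  shows "\<exists>q. m * int q \<le> b \<and> b\<^sup>2 < m * (\<Sum>j<q. min n (if j = 0 then 1 else (2 * k + 2) * int j - 1))
    + (b - m * int q) * min n (if q = 0 then 1 else (2 * k + 2) * int q - 1)"
proof -
  have main: ?thesis if t: "m * Q \<le> b" "(2 * k + 2) * (Q - 1) \<le> n" "1 \<le> n" "N \<le> n" "N \<le> (2 * k + 2) * Q - 1"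
    "b\<^sup>2 < m * (2 - Q + (k + 1) * Q * (Q - 1)) + (b - m * Q) * N" "1 \<le> Q" for Q N
  proof -
    obtain q where q: "Q = int q" using t(7) by (metis nonneg_int_cases zero_le_one order_trans)
    have q1: "1 \<le> q" using t(7) q by simp
    have "(if j = 0 then 1 else (2 * k + 2) * int j - 1) \<le> n" if "j < q" for j
    proof -
      have "(2 * k + 2) * int j \<le> (2 * k + 2) * (Q - 1)" using that k q by (intro mult_left_mono) auto
      then show ?thesis using \<open>1 \<le> n\<close> \<open>(2 * k + 2) * (Q - 1) \<le> n\<close> by simp
    qed
    moreover have "m * int q \<le> b" using t q by simp
    ultimately show ?thesis
      using capped_layers[of m q b "\<lambda>j. if j = 0 then 1 else (2 * k + 2) * int j - 1" n N]
        t q1 unfolding q sum_affine'[OF q1] by (intro exI[of _ q]) auto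
  qed
  consider q where "k = 2 * q" | q where "k = 2 * q - 1"
    by (metis evenE oddE add_diff_cancel_right' distrib_left mult.right_neutral one_add_one add.assoc add_diff_eq)
  then show ?thesis
  proof cases
    case (1 q)
    have q: "2 \<le> q" using k 1 by simp
    have qq: "2 * q \<le> q * q" using q by (intro mult_right_mono) auto
    have b': "b = 2 * q * q - q + m \<and> m \<le> 2 * q - 1 \<or> b = 2 * q * q + q \<and> m = 2 * q - 1"
      using b unfolding 1 by (auto simp: algebra_simps)
    then show ?thesis
    proof (elim disjE conjE)
      assume bq: "b = 2 * q * q - q + m" and "m \<le> 2 * q - 1"
      define p where "p = 2 * q - 1 - m"
      have p: "0 \<le> p" "p \<le> 2 * q - 1" and mp: "m = 2 * q - 1 - p" using m \<open>m \<le> 2 * q - 1\<close> by (auto simp: p_def)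
      have "4 * (q * q) - 2 * q + 2 * m \<le> n" using n unfolding bq by (simp add: algebra_simps)
      then have n1: "1 \<le> n" using qq q m by linarith
      have "0 \<le> q * p * (2 * q - 1 - p)" "0 \<le> q * p * ((q - 2) * (4 * q + 6))" "0 \<le> q * p" "0 \<le> p * p"
        using p q by simp_all
      then have "0 < 4 * (q * q * q * p) + 6 * (q * q * p) - 4 * (q * p * p) - 8 * (q * p) + 4 * q - 2"
        using q by (simp add: algebra_simps)
      then have "0 < 4 * (q * q * q * p) + 6 * (q * q * p) - 4 * (q * p * p) - 8 * (q * p) + 4 * q + 2 * (p * p) - 2"
        using zero_le_square[of p] by linarith
      moreover have "m * q \<le> (2 * q - 1) * q" using mp p q by (intro mult_right_mono) auto
      moreover have "0 \<le> p * (q - 1)" using p q by simp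
      ultimately show ?thesis
        by (intro main[of q "2 * b"]) (use q p m n n1 in \<open>simp_all add: bq 1 mp algebra_simps power2_eq_square\<close>)
    next
      assume bq: "b = 2 * q * q + q" and mp: "m = 2 * q - 1"
      have "4 * (q * q) + 2 * q \<le> n" using n unfolding bq by (simp add: algebra_simps)
      then have n1: "1 \<le> n" using qq q m by linarith
      show ?thesis
        by (intro main[of q "4 * q * q + 2 * q - 1"]) (use q m n n1 in \<open>simp_all add: bq 1 mp algebra_simps power2_eq_square\<close>)
    qed
  next
    case (2 q)
    have q: "2 \<le> q" using k 2 by simp
    have bq: "b = 2 * q * q - 3 * q + 2 + m" using b unfolding 2 by (auto simp: algebra_simps)
    have m2: "m \<le> 2 * q - 3 \<or> m = 2 * q - 2 \<and> 8 * q * q - 2 * q - 6 \<le> 2 * n"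
      using b unfolding 2 by (auto simp: algebra_simps power2_eq_square)
    have qq: "2 * q \<le> q * q" using q by (intro mult_right_mono) auto
    have "4 * (q * q) - 6 * q + 4 + 2 * m \<le> n" using n unfolding bq by (simp add: algebra_simps)
      then have n1: "1 \<le> n" using qq q m by linarith
    \<comment> \<open>The condition \<open>q - 2 \<le> m\<close> amounts to
      \<open>4 * q * (q - 1) \<le> 2 * b\<close>, so that \<open>q\<close> layers fit below
      \<open>2 * b\<close>; otherwise \<open>q - 1\<close> layers are used.\<close>
    consider "m = 2 * q - 2" "8 * q * q - 2 * q - 6 \<le> 2 * n" | "q - 2 \<le> m" "m \<le> 2 * q - 3" | "m < q - 2"
      using m2 by linarith
    then show ?thesis
    proof cases
      case a: 1
      \<comment> \<open>The critical case of \<xi>: the last layer is taken as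
        \<open>4 q^2 - q - 3 = (2 k^2 + 3 k - 5) / 2\<close>, which the condition in
        \<open>xi\<close> guarantees to be at most \<open>n\<close>. With \<open>2 * b\<close> in
        its place the inequality for \<open>q\<close> layers fails from \<open>q = 6\<close>
        on.\<close>
      show ?thesis
        by (intro main[of q "4 * q * q - q - 3"]) (use q qq n n1 a in \<open>simp_all add: bq 2 a(1) algebra_simps power2_eq_square\<close>)
    next
      case a: 2
      define p where "p = 2 * q - 3 - m"
      have p: "0 \<le> p" "p \<le> q - 1" and mp: "m = 2 * q - 3 - p" using a by (auto simp: p_def)
      have "0 \<le> q * p * (q - 1 - p)" "0 \<le> q * p * ((q - 2) * (4 * q + 4))" "0 \<le> q * p" "0 \<le> p * p"
        "0 \<le> (q - 2) * (q * q)" using p q by simp_all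
      then have "0 \<le> 4 * (q * q * q * p) - 4 * (q * p * p) - 10 * (q * p)"
        by (simp add: algebra_simps)
      moreover have "2 * (q * q) \<le> q * (q * q)" using q by (intro mult_right_mono) auto
      ultimately have "0 < 4 * (q * q * q * p) + 4 * (q * (q * q)) - 2 * (q * q) - 4 * (q * p * p) - 10 * (q * p) + 6 * q + 2 * (p * p) - 10"
        using q qq zero_le_square[of p] by linarith
      moreover have "0 \<le> p * (q - 1)" using p q by simp
      moreover have "m * q \<le> (2 * q - 3) * q" using a q by (intro mult_right_mono) auto
      ultimately show ?thesis
        by (intro main[of q "2 * b"]) (use q qq p n n1 in \<open>simp_all add: bq 2 mp algebra_simps power2_eq_square\<close>)
    next
      case 3
      define r where "r = q - 1"
      define p where "p = r - 2 - m"
      have rp: "q = r + 1" "m = r - 2 - p" "0 \<le> p" "p \<le> r - 2" using 3 m by (auto simp: p_def r_def)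
      have "0 \<le> r * p * (r - p)" using rp by simp
      then have A: "0 \<le> 4 * (r * r * p) - 4 * (r * p * p)" by (simp add: algebra_simps)
      have B: "r * p \<le> r * r" using rp by (intro mult_left_mono) auto
      have C: "0 \<le> r * r * r * p" "0 \<le> r * r * r * r" "0 < r * r * r" using rp by simp_all
      have "0 \<le> p * r" using rp by simp
      then have D: "1 + p \<le> p * r + (r * r + r * 4)" "p \<le> p * r + (r * r + r * 5)"
        using rp(3,4) zero_le_square[of r] by linarith+
      have "0 < 4 * (r * r * r * r) + 4 * (r * r * r * p) + 16 * (r * r * r) + 4 * (r * r * p) + 14 * (r * r)
        - 4 * (r * p * p) - 14 * (r * p) + 2 * (p * p) - 6"
        using A B C rp zero_le_square[of p] by linarith
      moreover have "2 * r \<le> r * r" using rp by (intro mult_right_mono) auto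
      moreover have "m * r \<le> r * r" using rp by (intro mult_right_mono) auto
      ultimately show ?thesis
        by (intro main[of r "2 * b"])
          (use m rp(3,4) n n1 D in \<open>simp_all add: bq 2 rp(1,2) algebra_simps power2_eq_square\<close>)
    qed
  qed
qed

section \<open>Sets that almost fill cosets\<close>

lemma sum_const_card:
  fixes A :: "'a::{finite,ab_group_add} set"
  shows "(\<Sum>a\<in>A. x :: 'a) = (\<Sum>i<card A. x)"
proof -
  have "finite A" by simp
  then show ?thesis by (induction A rule: finite_induct) (simp_all add: add.commute)
qed

lemma sum_Un_disjoint:
  fixes A B :: "'a::{finite,ab_group_add} set"
  shows "A \<inter> B = {} \<Longrightarrow> \<Sum>(A \<union> B) = \<Sum>A + \<Sum>B"
  by (simp add: sum.union_disjoint)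

definition sym_gens :: "'a::ab_group_add set \<Rightarrow> 'a set" where
  "sym_gens S = insert 0 (S \<union> uminus ` S)"

lemma symm_sym_gens: "symm (sym_gens S)"
  by (auto simp: symm_def sym_gens_def)

lemma sym_gens_subset: "subgrp H \<Longrightarrow> S \<subseteq> H \<Longrightarrow> sym_gens S \<subseteq> H"
  by (auto simp: sym_gens_def subgrp_zero subgrp_minus)

lemma zero_in_sym_gens: "0 \<in> sym_gens S"
  by (simp add: sym_gens_def)

text \<open>The points that leave \<open>Y\<close> under \<open>x\<close> form a
  \<open>K\<close>-periodic set again, so their number is a multiple of \<open>|K|\<close>.\<close>

lemma shift_defect_periodic:
  fixes Y :: "'a::{finite,ab_group_add} set"
  assumes K: "subgrp K" and Y: "Y + K = Y"
  shows "c \<in> K \<Longrightarrow> shift_defect Y c = 0" "card K dvd shift_defect Y x"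
proof -
  have mem: "y + k \<in> Y \<longleftrightarrow> y \<in> Y" if "k \<in> K" for y k
  proof
    assume "y \<in> Y"
    then have "y + k \<in> Y + K" using that by (rule set_plus_memI)
    then show "y + k \<in> Y" unfolding Y .
  next
    assume "y + k \<in> Y"
    then have "(y + k) + - k \<in> Y + K" using subgrp_minus[OF K that] by (rule set_plus_memI)
    then show "y \<in> Y" unfolding Y by simp
  qed
  then show "c \<in> K \<Longrightarrow> shift_defect Y c = 0" by (simp add: shift_defect_def)
  let ?Z = "{b \<in> Y. b + x \<notin> Y}"
  have "?Z + K \<subseteq> ?Z"
  proof
    fix v assume "v \<in> ?Z + K"
    then obtain b k where b: "b \<in> ?Z" "k \<in> K" "v = b + k" by (auto simp: set_plus_iff)
    have e: "b + k + x = b + x + k" by (simp add: ac_simps)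
    have "b + k + x \<notin> Y" unfolding e using mem[of k "b + x"] b(1,2) by simp
    then show "v \<in> ?Z" using mem[of k b] b by simp
  qed
  then have "?Z + K = ?Z" using subset_set_plus[OF subgrp_zero[OF K], of ?Z] by (rule equalityI)
  then show "card K dvd shift_defect Y x" unfolding shift_defect_def
    by (intro card_subgrp_dvd_periodic[OF K]) auto
qed

text \<open>The choice of signs makes the union of the cosets met by \<open>S - K\<close> disjoint
  from its negative, and both are disjoint from \<open>K\<close>.\<close>

lemma card_coset_sym_gens:
  fixes S K :: "'a::{finite,ab_group_add} set"
  assumes K: "subgrp K"
    and signs: "\<And>x y. x \<in> S \<Longrightarrow> y \<in> S \<Longrightarrow> x \<notin> K \<Longrightarrow> y \<notin> K \<Longrightarrow> x + y \<notin> K"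
  shows "card (K + sym_gens S) = card K + 2 * card ((S - K) + K)"
proof -
  let ?P = "(S - K) + K"
  have "K + sym_gens S = K \<union> (?P \<union> uminus ` ?P)"
  proof (intro set_eqI iffI)
    fix v assume "v \<in> K + sym_gens S"
    then obtain k q where v: "k \<in> K" "q \<in> sym_gens S" "v = k + q" by (auto simp: set_plus_iff)
    consider "q \<in> K" | "q \<in> S - K" | "- q \<in> S - K"
      using v(2) subgrp_zero[OF K] subgrp_minus_iff[OF K, of q] by (auto simp: sym_gens_def)
    then show "v \<in> K \<union> (?P \<union> uminus ` ?P)"
    proof cases
      case 1 then show ?thesis using v subgrp_add[OF K] by auto
    next
      case 2
      then have "q + k \<in> ?P" using v by (intro set_plus_memI)
      then show ?thesis using v by (simp add: add.commute)
    next
      case 3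
      then have "- q + - k \<in> ?P" using v subgrp_minus[OF K] by (intro set_plus_memI) auto
      moreover have "v = - (- q + - k)" using v by (simp add: algebra_simps)
      ultimately show ?thesis by blast
    qed
  next
    fix v assume "v \<in> K \<union> (?P \<union> uminus ` ?P)"
    then consider "v \<in> K" | s k where "s \<in> S" "k \<in> K" "v = s + k" | s k where "s \<in> S" "k \<in> K" "v = - (s + k)"
      by (auto simp: set_plus_iff)
    then show "v \<in> K + sym_gens S"
    proof cases
      case 1 then show ?thesis using subset_set_plus[OF zero_in_sym_gens] by blast
    next
      case 2
      then have "k + s \<in> K + sym_gens S" by (intro set_plus_memI) (auto simp: sym_gens_def)
      then show ?thesis using 2 by (simp add: add.commute)
    next
      case 3
      then have "- k + - s \<in> K + sym_gens S" using subgrp_minus[OF K] by (intro set_plus_memI) (auto simp: sym_gens_def)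
      then show ?thesis unfolding 3 minus_add_distrib by (simp only: add.commute)
    qed
  qed
  moreover have "K \<inter> (?P \<union> uminus ` ?P) = {}"
  proof -
    have "s + k \<notin> K" if "s \<in> S - K" "k \<in> K" for s k
      using that subgrp_add_cancel_right[OF K] by simp
    then have "v \<notin> K" if "v \<in> ?P" for v using that by (auto simp: set_plus_iff)
    moreover have "- v \<notin> K" if "v \<in> ?P" for v using calculation[OF that] subgrp_minus_iff[OF K] by simp
    ultimately show ?thesis by blast
  qed
  moreover have "?P \<inter> uminus ` ?P = {}"
  proof (rule ccontr)
    assume "?P \<inter> uminus ` ?P \<noteq> {}"
    then obtain v w where vw: "v \<in> ?P" "w \<in> ?P" "v = - w" by blast
    obtain s k where s: "s \<in> S - K" "k \<in> K" "v = s + k" using vw(1) unfolding set_plus_iff by blast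
    obtain t l where t: "t \<in> S - K" "l \<in> K" "w = t + l" using vw(2) unfolding set_plus_iff by blast
    note sk = s(1,2) t(1,2) vw(3)[unfolded s(3) t(3)]
    have "s + t = - (k + l)" using sk(5) by (simp add: algebra_simps eq_neg_iff_add_eq_0)
    then show False using signs[of s t] sk subgrp_minus[OF K subgrp_add[OF K sk(2,4)]] by auto
  qed
  ultimately show ?thesis
    by (simp add: card_Un_disjoint card_reflect)
qed

text \<open>The case in which \<open>Q = S \<union> -S \<union> {0}\<close> almost fills a union of \<open>K\<close>-cosets, with the signs of
  the elements of \<open>S - K\<close> chosen such that no two of them lie in opposite cosets.\<close>

locale coset_structure =
  fixes S K H :: "'a::{finite,ab_group_add} set"
  assumes K: "subgrp K" and H: "subgrp H" and KH: "K \<subseteq> H" and SH: "S \<subseteq> H" and SK: "\<not> S \<subseteq> K"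
    and signs: "\<And>x y. x \<in> S \<Longrightarrow> y \<in> S \<Longrightarrow> x \<notin> K \<Longrightarrow> y \<notin> K \<Longrightarrow> x + y \<notin> K"
    and dense: "\<And>x. x \<in> S \<Longrightarrow> x \<notin> K \<Longrightarrow> 4 * (card K - card {y \<in> S. y - x \<in> K}) < card K"
    and fill: "\<And>x. x \<in> S \<Longrightarrow> x \<notin> K \<Longrightarrow> card K < card {y \<in> S. y - x \<in> K} + card (subset_sums (S \<inter> K))"
    and tors: "\<exists>s\<in>K. s + s \<noteq> 0"
    and growth: "\<And>Y. Y \<subseteq> H \<Longrightarrow> Y \<noteq> {} \<Longrightarrow> Y + sym_gens S \<noteq> H \<Longrightarrow>
      card (K + sym_gens S) + card Y \<le> card (Y + sym_gens S) + card K"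
    and half: "2 * card (subset_sums S) \<le> card H"
begin

definition cls :: "'a \<Rightarrow> 'a set" where
  "cls x = {y \<in> S. y - x \<in> K}"

text \<open>By \<open>card_K_sym_gens\<close> this is half of \<open>|K + Q| - |K|\<close>, the cost
  in subset sums aimed at for each removed element.\<close>

definition size_out :: nat where
  "size_out = card ((S - K) + K)"

definition thick :: "'a set \<Rightarrow> 'a set" where
  "thick A = subset_sums A + K"

lemma cls_self: "x \<in> S \<Longrightarrow> x \<in> cls x"
  by (simp add: cls_def subgrp_zero[OF K])

lemma cls_eq: "y \<in> cls x \<Longrightarrow> cls y = cls x"
proof -
  assume "y \<in> cls x"
  then have "y - x \<in> K" by (simp add: cls_def)
  then have "z - y \<in> K \<longleftrightarrow> z - x \<in> K" for z
    using subgrp_add_cancel_right[OF K, of "y - x" "z - y"] by simp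
  then show ?thesis by (simp add: cls_def)
qed

lemma cls_disjoint_K: "x \<notin> K \<Longrightarrow> cls x \<inter> K = {}"
proof -
  assume "x \<notin> K"
  have "y \<notin> K" if "y - x \<in> K" for y
  proof
    assume "y \<in> K"
    then have "y - (y - x) \<in> K" using that by (rule subgrp_diff[OF K])
    then show False using \<open>x \<notin> K\<close> by simp
  qed
  then show ?thesis by (auto simp: cls_def)
qed

lemma cls_subset: "cls x \<subseteq> S"
  by (auto simp: cls_def)

lemma card_K_pos: "0 < card K"
  using subgrp_zero[OF K] by (auto simp: card_gt_0_iff)

lemma card_K_sym_gens: "card (K + sym_gens S) = card K + 2 * size_out"
  unfolding size_out_def by (rule card_coset_sym_gens[OF K signs])

lemma card_K_dvd_size_out: "card K dvd size_out"
  unfolding size_out_def by (intro card_subgrp_dvd_periodic[OF K] set_plus_absorb[OF K]) simp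

lemma size_out_pos: "0 < size_out"
proof -
  obtain x where "x \<in> S - K" using SK by auto
  then have "x \<in> (S - K) + K" using subset_set_plus[OF subgrp_zero[OF K]] by blast
  then show ?thesis unfolding size_out_def by (auto simp: card_gt_0_iff)
qed

lemma thick_subset: "A \<subseteq> S \<Longrightarrow> thick A \<subseteq> H"
  unfolding thick_def by (intro set_plus_subset_subgrp[OF H] subset_sums_closed[OF H] KH order_trans[OF _ SH])

lemma thick_periodic: "thick A + K = thick A"
  unfolding thick_def by (rule set_plus_absorb[OF K])

lemma subset_sums_le_thick: "card (subset_sums A) \<le> card (thick A)"
  unfolding thick_def by (rule card_set_plus_ge[OF subgrp_zero[OF K]])

lemma thickI: "X \<subseteq> A \<Longrightarrow> y - \<Sum>X \<in> K \<Longrightarrow> y \<in> thick A"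
  unfolding thick_def set_plus_iff_diff using subset_sumsI by blast

lemma thickE:
  assumes "y \<in> thick A"
  obtains X where "X \<subseteq> A" "y - \<Sum>X \<in> K"
  using assms unfolding thick_def set_plus_iff_diff by (auto elim: subset_sumsE)

text \<open>Pigeonhole in one coset of \<open>K\<close>: the sums of \<open>j\<close> elements of
  the class number at least as many as the class, by \<open>card_restricted_sums\<close>, and
  together with the subset sums of \<open>S \<inter> K\<close> they exceed \<open>|K|\<close>. So
  \<open>A \<inter> cls x\<close> and \<open>A \<inter> K\<close> can be exchanged for sets that
  correct the sum to \<open>y\<close>.\<close>

lemma full_coset:
  assumes A: "A \<subseteq> S" and x: "x \<in> S" "x \<notin> K" and meet: "A \<inter> cls x \<noteq> {}" "\<not> cls x \<subseteq> A"
    and y: "y - \<Sum>A \<in> K"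
  shows "y \<in> subset_sums S"
proof -
  define T where "T = cls x"
  define j where "j = card (A \<inter> T)"
  define J where "J = (\<Sum>i<j. x)"
  define A1 where "A1 = A - T - K"
  have TK: "T \<inter> K = {}" using cls_disjoint_K[OF x(2)] by (simp add: T_def)
  have Tsum: "\<Sum>B - (\<Sum>i<card B. x) \<in> K" if "B \<subseteq> T" for B
  proof -
    have "(\<Sum>b\<in>B. b - x) \<in> K" using that by (intro subgrp_sum[OF K]) (auto simp: T_def cls_def)
    then show ?thesis by (simp add: sum_subtractf sum_const_card)
  qed
  have j: "1 \<le> j" "j < card T"
  proof -
    show "1 \<le> j" using meet(1) by (simp add: j_def T_def Suc_le_eq card_gt_0_iff)
    have "A \<inter> T \<subset> T" using meet(2) by (auto simp: T_def)
    then show "j < card T" unfolding j_def by (intro psubset_card_mono) auto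
  qed
  let ?U = "restricted_sums T j"
  let ?V = "(\<lambda>s. y - \<Sum>A1 - s) ` subset_sums (S \<inter> K)"
  obtain s where s: "s \<in> K" "s + s \<noteq> 0" using tors by blast
  have U: "card T \<le> card ?U"
    using dense[OF x] by (intro card_restricted_sums[of K T x s j] K s j) (auto simp: T_def cls_def)
  have V: "card ?V = card (subset_sums (S \<inter> K))" by (intro card_image inj_onI) simp
  have UV: "?U \<union> ?V \<subseteq> (+) J ` K"
  proof
    fix v assume "v \<in> ?U \<union> ?V"
    then have "v - J \<in> K"
    proof
      assume "v \<in> ?U"
      then show ?thesis using Tsum by (auto simp: restricted_sums_def J_def)
    next
      assume "v \<in> ?V"
      then obtain Z where Z: "Z \<subseteq> S \<inter> K" "v = y - \<Sum>A1 - \<Sum>Z" by (auto elim: subset_sumsE)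
      have "A = A1 \<union> ((A \<inter> T) \<union> (A \<inter> K))" by (auto simp: A1_def)
      moreover have "\<Sum>(A1 \<union> ((A \<inter> T) \<union> (A \<inter> K))) = \<Sum>A1 + (\<Sum>(A \<inter> T) + \<Sum>(A \<inter> K))"
        using TK by (subst sum_Un_disjoint, force simp: A1_def, subst sum_Un_disjoint) auto
      ultimately have "\<Sum>A = \<Sum>A1 + (\<Sum>(A \<inter> T) + \<Sum>(A \<inter> K))" by simp
      then have "v - J = (y - \<Sum>A) + (\<Sum>(A \<inter> T) - J) + \<Sum>(A \<inter> K) - \<Sum>Z"
        using Z by (simp add: algebra_simps)
      moreover have "\<Sum>(A \<inter> K) \<in> K" "\<Sum>Z \<in> K" using Z by (auto intro!: subgrp_sum[OF K])
      moreover have "\<Sum>(A \<inter> T) - J \<in> K" using Tsum[of "A \<inter> T"] by (simp add: J_def j_def)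
      ultimately show ?thesis using y by (simp only: subgrp_diff[OF K] subgrp_add[OF K])
    qed
    then show "v \<in> (+) J ` K" using mem_translate_minus[of v "- J" K] by simp
  qed
  have "?U \<inter> ?V \<noteq> {}"
  proof
    assume "?U \<inter> ?V = {}"
    then have "card (?U \<union> ?V) = card ?U + card ?V" by (intro card_Un_disjoint) auto
    moreover have "card (?U \<union> ?V) \<le> card ((+) J ` K)" using UV by (intro card_mono) auto
    ultimately show False using U V fill[OF x] by (simp add: card_translate T_def cls_def)
  qed
  then obtain v where v: "v \<in> ?U" "v \<in> ?V" by blast
  obtain B where B: "B \<subseteq> T" "v = \<Sum>B" using v(1) by (auto simp: restricted_sums_def)
  obtain Z where Z: "Z \<subseteq> S \<inter> K" "v = y - \<Sum>A1 - \<Sum>Z" using v(2) by (auto elim: subset_sumsE)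
  note BZ = B(1) Z(1) trans[OF B(2)[symmetric] Z(2)]
  have "\<Sum>(A1 \<union> (B \<union> Z)) = \<Sum>A1 + (\<Sum>B + \<Sum>Z)"
    using TK BZ by (subst sum_Un_disjoint, force simp: A1_def, subst sum_Un_disjoint) auto
  then have "y = \<Sum>(A1 \<union> (B \<union> Z))" using BZ(3) by (simp add: algebra_simps)
  moreover have "A1 \<union> (B \<union> Z) \<subseteq> S" using A BZ cls_subset by (auto simp: A1_def T_def)
  ultimately show ?thesis using subset_sumsI by blast
qed

text \<open>An element of \<open>thick S\<close> that is not a subset sum is represented, modulo \<open>K\<close>, only by unions of
  whole classes. Subtracting the part of such a representation that lies outside \<open>A\<close> injects
  the defect of \<open>S\<close> into the defect of \<open>A\<close>.\<close>

lemma defect_transfer: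
  assumes A: "A \<subseteq> S" and meets: "\<And>x. x \<in> S \<Longrightarrow> x \<notin> K \<Longrightarrow> cls x \<inter> A \<noteq> {}"
  shows "card (thick S) + card (subset_sums A) \<le> card (subset_sums S) + card (thick A)"
proof -
  let ?E = "thick S - subset_sums S"
  have "\<exists>X. X \<subseteq> S - K \<and> y - \<Sum>X \<in> K" if "y \<in> ?E" for y
  proof -
    have "y \<in> thick S" using that by simp
    then obtain X where X: "X \<subseteq> S" "y - \<Sum>X \<in> K" by (rule thickE)
    have "(X - K) \<union> (X \<inter> K) = X" "(X - K) \<inter> (X \<inter> K) = {}" by blast+
    then have "\<Sum>X = \<Sum>(X - K) + \<Sum>(X \<inter> K)"
      using sum_Un_disjoint[of "X - K" "X \<inter> K"] by simp
    then have e: "y - \<Sum>(X - K) = (y - \<Sum>X) + \<Sum>(X \<inter> K)" by (simp add: algebra_simps)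
    have "\<Sum>(X \<inter> K) \<in> K" by (rule subgrp_sum[OF K]) simp
    then have "y - \<Sum>(X - K) \<in> K" unfolding e by (rule subgrp_add[OF K X(2)])
    then show ?thesis using X(1) by (intro exI[of _ "X - K"]) auto
  qed
  then have "\<forall>y\<in>?E. \<exists>X. X \<subseteq> S - K \<and> y - \<Sum>X \<in> K" by (rule ballI)
  from bchoice[OF this] have "\<exists>R. \<forall>y\<in>?E. R y \<subseteq> S - K \<and> y - \<Sum>(R y) \<in> K" .
  then obtain R where "\<forall>y\<in>?E. R y \<subseteq> S - K \<and> y - \<Sum>(R y) \<in> K" ..
  then have R: "\<And>y. y \<in> ?E \<Longrightarrow> R y \<subseteq> S - K" "\<And>y. y \<in> ?E \<Longrightarrow> y - \<Sum>(R y) \<in> K" by blast+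
  \<comment> \<open>By \<open>full_coset\<close>, a representation of an element outside
    \<open>subset_sums S\<close> cannot split a class.\<close>
  have ext: "cls x \<subseteq> X" if "y \<in> ?E" "X \<subseteq> S" "y - \<Sum>X \<in> K" "x \<in> X" "x \<notin> K" for y X x
  proof -
    have "x \<in> S" "x \<in> X \<inter> cls x" using that cls_self by auto
    then show ?thesis using full_coset[of X x y] that by auto
  qed
  define f where "f y = y - \<Sum>(R y - A)" for y
  have split: "\<Sum>(R y) = \<Sum>(R y \<inter> A) + \<Sum>(R y - A)" for y
  proof -
    have "(R y \<inter> A) \<union> (R y - A) = R y" "(R y \<inter> A) \<inter> (R y - A) = {}" by blast+
    then show ?thesis using sum_Un_disjoint[of "R y \<inter> A" "R y - A"] by simp
  qed
  have inj: "inj_on f ?E"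
  proof (rule inj_onI)
    fix y1 y2 assume y: "y1 \<in> ?E" "y2 \<in> ?E" "f y1 = f y2"
    \<comment> \<open>Exchange: the part of \<open>R y1\<close> inside \<open>A\<close> with the
      part of \<open>R y2\<close> outside it represents \<open>y2\<close> modulo \<open>K\<close>,
      because \<open>f\<close> agrees on \<open>y1\<close> and \<open>y2\<close>. So this mixed set,
      too, consists of whole classes.\<close>
    let ?X = "(R y1 \<inter> A) \<union> (R y2 - A)"
    have "\<Sum>?X = \<Sum>(R y1 \<inter> A) + \<Sum>(R y2 - A)" by (intro sum_Un_disjoint) auto
    then have "y2 - \<Sum>?X = f y2 - \<Sum>(R y1 \<inter> A)" by (simp add: f_def algebra_simps)
    also have "\<dots> = y1 - \<Sum>(R y1)" unfolding y(3)[symmetric] by (simp add: f_def split[of y1] algebra_simps)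
    finally have X: "y2 - \<Sum>?X \<in> K" using R(2)[OF y(1)] by simp
    have XS: "?X \<subseteq> S - K" using R(1)[OF y(1)] R(1)[OF y(2)] A by auto
    \<comment> \<open>\<open>R y1\<close> and \<open>?X\<close> are unions of whole classes that
      agree on \<open>A\<close>, and \<open>A\<close> meets every class; hence they
      coincide.\<close>
    have "R y1 - A = R y2 - A"
    proof (intro set_eqI iffI)
      fix a assume a: "a \<in> R y1 - A"
      have aS: "a \<in> S" "a \<notin> K" using a R(1)[OF y(1)] by auto
      have "cls a \<subseteq> R y1" using ext[OF y(1) _ R(2)[OF y(1)], of a] R(1)[OF y(1)] a aS by auto
      moreover obtain b where b: "b \<in> cls a" "b \<in> A" using meets[OF aS] by blast
      ultimately have bX: "b \<in> ?X" by blast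
      then have "cls b \<subseteq> ?X" using ext[OF y(2) _ X, of b] XS by auto
      then have "a \<in> ?X" using cls_eq[OF b(1)] cls_self[OF aS(1)] by auto
      then show "a \<in> R y2 - A" using a by auto
    next
      fix a assume a: "a \<in> R y2 - A"
      then have aX: "a \<in> ?X" by auto
      have aS: "a \<in> S" "a \<notin> K" using aX XS by auto
      have sub: "cls a \<subseteq> ?X" using ext[OF y(2) _ X aX] XS aS by auto
      obtain b where b: "b \<in> cls a" "b \<in> A" using meets[OF aS] by blast
      then have b1: "b \<in> R y1" using sub by auto
      have "cls b \<subseteq> R y1" using ext[OF y(1) _ R(2)[OF y(1)] b1] R(1)[OF y(1)] b1 by auto
      then show "a \<in> R y1 - A" using cls_eq[OF b(1)] cls_self[OF aS(1)] a by auto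
    qed
    then show "y1 = y2" using y(3) by (simp add: f_def)
  qed
  have "f ` ?E \<subseteq> thick A - subset_sums A"
  proof
    fix v assume "v \<in> f ` ?E"
    then obtain y where y: "y \<in> ?E" "v = y - \<Sum>(R y - A)" by (auto simp: f_def)
    have "v - \<Sum>(R y \<inter> A) = y - \<Sum>(R y)" using y(2) split[of y] by (simp add: algebra_simps)
    then have "v \<in> thick A" using R(2)[OF y(1)] by (intro thickI[of "R y \<inter> A"]) auto
    moreover have "v \<notin> subset_sums A"
    proof
      assume "v \<in> subset_sums A"
      then obtain X where X: "X \<subseteq> A" "v = \<Sum>X" by (rule subset_sumsE)
      have "\<Sum>(X \<union> (R y - A)) = \<Sum>X + \<Sum>(R y - A)" using X by (intro sum_Un_disjoint) auto
      then have "y = \<Sum>(X \<union> (R y - A))" using X(2) y(2) by (simp add: diff_eq_eq)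
      moreover have "X \<union> (R y - A) \<subseteq> S" using X A R(1)[OF y(1)] by auto
      ultimately show False using y(1) subset_sumsI[of "X \<union> (R y - A)" S] by auto
    qed
    ultimately show "v \<in> thick A - subset_sums A" by simp
  qed
  then have "card ?E \<le> card (thick A - subset_sums A)" using card_inj_on_le[OF inj] by simp
  moreover have "subset_sums B \<subseteq> thick B" for B
    unfolding thick_def by (rule subset_set_plus[OF subgrp_zero[OF K]])
  ultimately show ?thesis
    using subset_sums_le_thick[of S] subset_sums_le_thick[of A] by (simp add: card_Diff_subset)
qed

text \<open>Both \<open>|Y|\<close> and the shift defects of \<open>Y\<close> are multiples of \<open>|K|\<close>, so it suffices to exclude that all
  defects are at most \<open>size_out - |K|\<close>.\<close>

lemma large_defect:
  assumes A: "A \<subseteq> S" and meets: "\<And>x. x \<in> S \<Longrightarrow> x \<notin> K \<Longrightarrow> cls x \<inter> A \<noteq> {}"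
    and Y: "Y + K = Y" "Y \<noteq> {}" "2 * card Y \<le> card H"
    and big: "size_out * (size_out - card K) \<le> card K * card Y"
  shows "\<exists>x\<in>A - K. size_out \<le> shift_defect Y x"
proof (rule ccontr)
  assume "\<not> ?thesis"
  then have small: "shift_defect Y x < size_out" if "x \<in> A - K" for x using that by force
  define h where "h = card K"
  have h: "0 < h" using card_K_pos by (simp add: h_def)
  obtain u where u: "size_out = h * u" using card_K_dvd_size_out by (auto simp: h_def)
  have u1: "1 \<le> u" using u size_out_pos by (cases u) auto
  have "h dvd card Y" unfolding h_def by (rule card_subgrp_dvd_periodic[OF K _ Y(1)]) simp
  then obtain y where y: "card Y = h * y" by auto
  have "0 < card Y" using Y(2) by (simp add: card_gt_0_iff)
  then have y1: "1 \<le> y" using y by (cases y) auto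
  have "h * u * (h * (u - 1)) \<le> h * (h * y)"
    using big unfolding u y h_def[symmetric] by (simp add: diff_mult_distrib2)
  then have "(h * h) * (u * (u - 1)) \<le> (h * h) * y" by (simp only: ac_simps)
  then have yu: "u * (u - 1) \<le> y" using h by simp
  define m where "m = h * (u - 1)"
  have le_m: "shift_defect Y x \<le> m" if "x \<in> A - K" for x
  proof -
    obtain d where d: "shift_defect Y x = h * d"
      using shift_defect_periodic(2)[OF K Y(1), of x] by (auto simp: h_def)
    then have "d < u" using small[OF that] u h by simp
    then have "h * d \<le> h * (u - 1)" by (intro mult_le_mono2) simp
    then show ?thesis using d by (simp add: m_def)
  qed
  have zero: "shift_defect Y c = 0" if "c \<in> K" for c using shift_defect_periodic(1)[OF K Y(1) that] .
  have tr: "shift_defect Y c \<le> shift_defect Y d" if "c - d \<in> K" for c d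
    using shift_defect_add[of Y d "c - d"] zero[OF that] by simp
  \<comment> \<open>Defects of a periodic set depend only on the coset, and \<open>A\<close> meets
    every class, so \<open>A\<close> controls the defects on all of \<open>S\<close>.\<close>
  have gen: "shift_defect Y q \<le> m" if q: "q \<in> S" for q
  proof (cases "q \<in> K")
    case False
    obtain a where a: "a \<in> cls q" "a \<in> A" using meets[OF q False] by blast
    have "a \<notin> K" using a(1) cls_disjoint_K[OF False] by blast
    moreover have "q - a \<in> K" using a(1) subgrp_minus[OF K, of "a - q"] by (simp add: cls_def)
    ultimately show ?thesis using tr[of q a] le_m[of a] a(2) by simp
  qed (simp add: zero)
  have KQ: "shift_defect Y c \<le> m" if c: "c \<in> K + sym_gens S" for c
  proof -
    obtain k q where kq: "k \<in> K" "q \<in> sym_gens S" "c = k + q" using c unfolding set_plus_iff by blast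
    consider "q = 0" | "q \<in> S" | "- q \<in> S" using kq(2) by (auto simp: sym_gens_def)
    then have "shift_defect Y q \<le> m"
    proof cases
      case 3
      then show ?thesis using gen[of "- q"] by (simp add: shift_defect_minus)
    qed (simp_all add: gen shift_defect_zero)
    then show ?thesis using tr[of c q] kq by simp
  qed
  let ?QK = "K + sym_gens S"
  let ?C = "iter_plus K ?QK"
  have z0: "0 \<in> ?QK"
    using set_plus_memI[OF subgrp_zero[OF K] zero_in_sym_gens, of S] by simp
  have QKH: "?QK \<subseteq> H" by (intro set_plus_subset_subgrp[OF H KH] sym_gens_subset[OF H SH])
  have size: "min (2 * card Y) (h + 2 * size_out * j) \<le> card (?C j)" for j
    unfolding h_def
  proof (rule iter_plus_card[OF H KH QKH _ z0 Y(3)])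
    fix Z assume Z: "Z \<subseteq> H" "Z \<noteq> {}" "Z + ?QK \<noteq> H"
    have "sym_gens S \<subseteq> ?QK"
      using subset_set_plus[OF subgrp_zero[OF K], of "sym_gens S"] by (simp add: add.commute)
    then have "sym_gens S + Z \<subseteq> ?QK + Z" by (rule set_plus_mono_left)
    then have sub: "Z + sym_gens S \<subseteq> Z + ?QK" by (simp add: add.commute)
    moreover have "Z + ?QK \<subseteq> H" by (rule set_plus_subset_subgrp[OF H Z(1) QKH])
    ultimately have "card ?QK + card Z \<le> card (Z + sym_gens S) + card K"
      using Z by (intro growth) auto
    moreover have "card (Z + sym_gens S) \<le> card (Z + ?QK)" using sub by (intro card_mono) auto
    ultimately show "card Z + 2 * size_out \<le> card (Z + ?QK)" using card_K_sym_gens by simp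
  qed (use subgrp_zero[OF K] in auto)
  obtain q where q: "(int u - 1) * int q \<le> int y"
    "(int y)\<^sup>2 < (int u - 1) * (\<Sum>j<q. min (2 * int y) (1 + 2 * int u * int j))
      + (int y - (int u - 1) * int q) * min (2 * int y) (1 + 2 * int u * int q)"
  proof -
    have "int (u * (u - 1)) \<le> int y" using yu by (simp only: of_nat_le_iff)
    then have "int u * (int u - 1) \<le> int y" using u1 by (simp add: of_nat_diff)
    then show thesis using periodic_layers[of "int u" "int y"] u1 y1 that by auto
  qed
  let ?g = "\<lambda>j. int h * min (2 * int y) (1 + 2 * int u * int j)"
  have g: "?g j \<le> int (card (?C j))" for j
  proof -
    have "?g j = min (int h * (2 * int y)) (int h * (1 + 2 * int u * int j))"
      using h by (simp add: min_mult_distrib_left)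
    also have "\<dots> = int (min (2 * card Y) (h + 2 * size_out * j))"
      by (simp add: y u algebra_simps of_nat_min)
    also have "\<dots> \<le> int (card (?C j))" using size[of j] by (simp only: of_nat_le_iff)
    finally show ?thesis .
  qed
  have mi: "int m = int h * (int u - 1)" using u1 by (simp add: m_def of_nat_diff)
  have mq: "int m * int q \<le> int (card Y)"
    using mult_left_mono[OF q(1), of "int h"] h by (simp add: mi y algebra_simps)
  have "int m * (\<Sum>j<q. ?g j) + (int (card Y) - int m * int q) * ?g q \<le> (int (card Y))\<^sup>2"
  proof (rule layer_bound_card[where C = ?C])
    show "?C j \<subseteq> ?C (Suc j)" for j by (rule iter_plus_incr[OF z0])
    show "shift_defect Y c \<le> m * j" if "c \<in> ?C j" for j c
      using shift_defect_iter_plus[OF _ _ that] zero KQ by blast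
  qed (use g mq in auto)
  moreover have "int m * (\<Sum>j<q. ?g j) + (int (card Y) - int m * int q) * ?g q =
    (int h * int h) * ((int u - 1) * (\<Sum>j<q. min (2 * int y) (1 + 2 * int u * int j))
      + (int y - (int u - 1) * int q) * min (2 * int y) (1 + 2 * int u * int q))"
    unfolding mi y sum_distrib_left[symmetric] of_nat_mult by (simp only: ring_distribs ac_simps right_diff_distrib left_diff_distrib)
  moreover have "(int (card Y))\<^sup>2 = (int h * int h) * (int y)\<^sup>2"
    by (simp add: y power2_eq_square)
  moreover have "0 < int h * int h" using h by simp
  ultimately show False using q(2) by (simp add: mult_le_cancel_left_pos)
qed

lemma thick_remove:
  assumes "x \<in> A"
  shows "card (thick (A - {x})) + shift_defect (thick A) x \<le> card (thick A)"
proof -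
  have "thick A = thick (A - {x}) \<union> (+) x ` thick (A - {x})"
    using subset_sums_insert[of x "A - {x}"] assms
    by (simp add: thick_def insert_absorb Un_set_plus translate_set_plus)
  then show ?thesis using card_insert_shift[of "thick (A - {x})" x] by simp
qed

text \<open>\<open>large_defect\<close> is applied to \<open>thick A\<close>, or to its complement
  in \<open>H\<close> when \<open>thick A\<close> exceeds half of \<open>H\<close>; the defects are
  the same. Hence the two size conditions.\<close>

lemma peel_one:
  assumes A: "A \<subseteq> S" and meets: "\<And>x. x \<in> S \<Longrightarrow> x \<notin> K \<Longrightarrow> cls x \<inter> A \<noteq> {}"
    and lt: "card (thick A) < card H"
    and low: "size_out * (size_out - card K) \<le> card K * card (thick A)"
    and up: "size_out * (size_out - card K) \<le> card K * (card H - card (thick A))"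
  shows "\<exists>x\<in>A - K. card (thick (A - {x})) + size_out \<le> card (thick A)"
proof -
  have "\<exists>x\<in>A - K. size_out \<le> shift_defect (thick A) x"
  proof (cases "2 * card (thick A) \<le> card H")
    case True
    have "0 \<in> thick A" using thickI[of "{}" A 0] subgrp_zero[OF K] by simp
    then show ?thesis using large_defect[OF A meets thick_periodic _ True low] by blast
  next
    case False
    let ?Y = "H - thick A"
    have sub: "thick A \<subseteq> H" by (rule thick_subset[OF A])
    have cY: "card ?Y = card H - card (thick A)" using sub by (simp add: card_Diff_subset)
    have "?Y + K \<subseteq> ?Y"
    proof
      fix v assume "v \<in> ?Y + K"
      then obtain y k where yk: "y \<in> ?Y" "k \<in> K" "v = y + k" by (auto simp: set_plus_iff)
      have "v \<notin> thick A"
      proof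
        assume "v \<in> thick A"
        then have "v + - k \<in> thick A + K" using subgrp_minus[OF K yk(2)] by (rule set_plus_memI)
        then show False using yk thick_periodic by simp
      qed
      moreover have "v \<in> H" using yk KH subgrp_add[OF H] by auto
      ultimately show "v \<in> ?Y" by simp
    qed
    then have "?Y + K = ?Y" using subset_set_plus[OF subgrp_zero[OF K]] by (rule equalityI)
    moreover have "?Y \<noteq> {}"
    proof
      assume "?Y = {}"
      then show False using cY lt by (simp only: card.empty)
    qed
    moreover have "2 * card ?Y \<le> card H" using cY False by simp
    ultimately obtain x where "x \<in> A - K" "size_out \<le> shift_defect ?Y x"
      using large_defect[OF A meets, of ?Y] up cY by auto
    moreover from this have "shift_defect ?Y x = shift_defect (thick A) x"
      using A SH by (intro shift_defect_Diff[OF H sub]) auto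
    ultimately show ?thesis by auto
  qed
  then obtain x where x: "x \<in> A - K" "size_out \<le> shift_defect (thick A) x" ..
  then show ?thesis using thick_remove[of x A] by (intro bexI[of _ x]) simp_all
qed

lemma meets_of_small_complement:
  assumes "A \<subseteq> S" "card S < card A + card (cls x)"
  shows "cls x \<inter> A \<noteq> {}"
proof
  assume "cls x \<inter> A = {}"
  then have "card (A \<union> cls x) = card A + card (cls x)" by (intro card_Un_disjoint) auto
  moreover have "card (A \<union> cls x) \<le> card S" using assms(1) cls_subset by (intro card_mono) auto
  ultimately show False using assms(2) by simp
qed

text \<open>Each removal shrinks the thickened sumset, which preserves the last condition. The one
  on \<open>subset_sums B\<close> covers every intermediate set, and classes with more than
  \<open>t\<close> elements are still met after \<open>t\<close> removals.\<close>

lemma peel_many: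
  assumes "A \<subseteq> S"
    and "\<And>x. x \<in> S \<Longrightarrow> x \<notin> K \<Longrightarrow> card S + t < card A + card (cls x)"
    and "card (thick A) < card H"
    and "\<And>B. B \<subseteq> A \<Longrightarrow> card A < card B + t \<Longrightarrow>
      size_out * (size_out - card K) \<le> card K * card (subset_sums B)"
    and "size_out * (size_out - card K) \<le> card K * (card H - card (thick A))"
  shows "\<exists>B\<subseteq>A. card B + t = card A \<and> card (thick B) + t * size_out \<le> card (thick A)"
  using assms
proof (induction t arbitrary: A)
  case 0
  then show ?case by (intro exI[of _ A]) simp
next
  case (Suc t)
  have meets: "cls x \<inter> A \<noteq> {}" if "x \<in> S" "x \<notin> K" for x
    using meets_of_small_complement[OF Suc.prems(1)] Suc.prems(2)[OF that] by simp
  have "card K * card (subset_sums A) \<le> card K * card (thick A)"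
    by (intro mult_le_mono2 subset_sums_le_thick)
  then have "size_out * (size_out - card K) \<le> card K * card (thick A)"
    using Suc.prems(4)[OF order_refl] by linarith
  then obtain x where x: "x \<in> A - K" "card (thick (A - {x})) + size_out \<le> card (thick A)"
    using peel_one[OF Suc.prems(1) meets Suc.prems(3) _ Suc.prems(5)] by blast
  let ?A = "A - {x}"
  have cA: "card A = Suc (card ?A)" using x by (intro card_Suc_Diff1[symmetric]) auto
  have "card K * (card H - card (thick A)) \<le> card K * (card H - card (thick ?A))"
    using x(2) by (intro mult_le_mono2) simp
  then have up: "size_out * (size_out - card K) \<le> card K * (card H - card (thick ?A))"
    using Suc.prems(5) by linarith
  have "\<exists>B\<subseteq>?A. card B + t = card ?A \<and> card (thick B) + t * size_out \<le> card (thick ?A)"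
  proof (rule Suc.IH[OF _ _ _ _ up])
    show "card S + t < card ?A + card (cls y)" if "y \<in> S" "y \<notin> K" for y
      using Suc.prems(2)[OF that] cA by simp
    show "size_out * (size_out - card K) \<le> card K * card (subset_sums B)"
      if "B \<subseteq> ?A" "card ?A < card B + t" for B
      using Suc.prems(4)[of B] that cA by auto
  qed (use Suc.prems(1,3) x in auto)
  then obtain B where "B \<subseteq> ?A" "card B + t = card ?A" "card (thick B) + t * size_out \<le> card (thick ?A)"
    by blast
  then show ?case using x(2) cA by (intro exI[of _ B]) auto
qed

text \<open>Adding \<open>a\<close> but not \<open>b\<close> to a subset of the rest splits their
  class, so \<open>full_coset\<close> places the whole coset of the new sum in
  \<open>subset_sums S\<close>.\<close>

lemma thick_remove_pair:
  assumes x: "x \<in> S" "x \<notin> K" and ab: "a \<in> cls x" "b \<in> cls x" "a \<noteq> b"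
  shows "card (thick (S - {a, b})) \<le> card (subset_sums S)"
proof -
  have aS: "a \<in> S" "b \<in> S" using ab cls_subset by auto
  have "(+) a ` thick (S - {a, b}) \<subseteq> subset_sums S"
  proof
    fix v assume "v \<in> (+) a ` thick (S - {a, b})"
    then obtain y where y: "y \<in> thick (S - {a, b})" "v = a + y" by blast
    from y(1) obtain X where X: "X \<subseteq> S - {a, b}" "y - \<Sum>X \<in> K" by (rule thickE)
    have "a \<notin> X" using X by auto
    then have "v - \<Sum>(insert a X) = y - \<Sum>X" using y(2) by simp
    then show "v \<in> subset_sums S"
      using full_coset[of "insert a X" x v] X ab x aS by auto
  qed
  then have "card ((+) a ` thick (S - {a, b})) \<le> card (subset_sums S)" by (intro card_mono) auto
  then show ?thesis by (simp only: card_translate)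
qed

text \<open>Removing two elements of one class makes the thickened sumset fit into \<open>subset_sums S\<close>, hence into
  half of \<open>H\<close>. Either this removal already costs \<open>2 * size_out\<close>, or \<open>thick S\<close> itself leaves enough of \<open>H\<close>.\<close>

lemma structured_bound:
  assumes t: "2 \<le> t" "\<And>x. x \<in> S \<Longrightarrow> x \<notin> K \<Longrightarrow> t < card (cls x)"
    and low: "\<And>B. B \<subseteq> S \<Longrightarrow> card S < card B + t \<Longrightarrow>
      size_out * (size_out - card K) \<le> card K * card (subset_sums B)"
    and b: "size_out * (size_out - 1) + 2 \<le> 2 * card (subset_sums S)" and h3: "3 \<le> card K"
  shows "\<exists>B\<subseteq>S. card B + t = card S \<and> card (subset_sums B) + t * size_out \<le> card (subset_sums S)"
proof -
  have "\<exists>B\<subseteq>S. card B + t = card S \<and> card (thick B) + t * size_out \<le> card (thick S)"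
  proof (cases "\<exists>x a b. x \<in> S \<and> x \<notin> K \<and> a \<in> cls x \<and> b \<in> cls x \<and> a \<noteq> b \<and>
      card (thick (S - {a, b})) + 2 * size_out \<le> card (thick S)")
    case True
    then obtain x a b where x: "x \<in> S" "x \<notin> K" and ab: "a \<in> cls x" "b \<in> cls x" "a \<noteq> b"
      and gain: "card (thick (S - {a, b})) + 2 * size_out \<le> card (thick S)" by blast
    let ?A = "S - {a, b}"
    have "a \<in> S" "b \<in> S" using ab cls_subset by auto
    then have cA: "card S = card ?A + 2" using ab(3) card_mono[of S "{a, b}"] by (simp add: card_Diff_subset)
    have le: "card (thick ?A) \<le> card (subset_sums S)" by (rule thick_remove_pair[OF x ab])
    have "card K * card (subset_sums S) \<le> card K * (card H - card (thick ?A))"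
      using le half by (intro mult_le_mono2) simp
    then have up: "size_out * (size_out - card K) \<le> card K * (card H - card (thick ?A))"
      using low[of S, OF order_refl] t(1) by linarith
    have "0 < card (subset_sums S)" using b by simp
    then have "card (thick ?A) < card H" using le half by simp
    then have "\<exists>B\<subseteq>?A. card B + (t - 2) = card ?A \<and> card (thick B) + (t - 2) * size_out \<le> card (thick ?A)"
    proof (intro peel_many[OF _ _ _ _ up])
      show "card S + (t - 2) < card ?A + card (cls y)" if "y \<in> S" "y \<notin> K" for y
        using t(1) t(2)[OF that] cA by simp
      show "size_out * (size_out - card K) \<le> card K * card (subset_sums B)"
        if "B \<subseteq> ?A" "card ?A < card B + (t - 2)" for B
      proof (rule low)
        show "B \<subseteq> S" "card S < card B + t" using that cA t(1) by auto
      qed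
    qed auto
    then obtain B where B: "B \<subseteq> ?A" "card B + (t - 2) = card ?A"
      "card (thick B) + (t - 2) * size_out \<le> card (thick ?A)" by blast
    have "t * size_out = (t - 2) * size_out + 2 * size_out"
      using t(1) by (simp only: add_mult_distrib[symmetric] le_add_diff_inverse2)
    then show ?thesis using B gain cA t(1) by (intro exI[of _ B]) auto
  next
    case False
    obtain x where x: "x \<in> S" "x \<notin> K" using SK by blast
    have "2 \<le> card (cls x)" using t(1) t(2)[OF x] by simp
    then obtain a b where ab: "a \<in> cls x" "b \<in> cls x" "a \<noteq> b"
      by (metis card_le_Suc0_iff_eq finite not_less_eq_eq numeral_2_eq_2)
    have lt: "card (thick S) < card (thick (S - {a, b})) + 2 * size_out"
      using False x ab by (meson not_le)
    have "card K dvd card (thick A)" for A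
      by (rule card_subgrp_dvd_periodic[OF K _ thick_periodic]) simp
    then obtain p q u where pqu: "card (thick S) = card K * p" "card (thick (S - {a, b})) = card K * q"
      "size_out = card K * u" using card_K_dvd_size_out by (meson dvdE)
    \<comment> \<open>All sizes are multiples of \<open>|K|\<close>, so the strict inequality
      improves by a full \<open>|K|\<close>.\<close>
    have "card K * p < card K * (q + 2 * u)" using lt pqu by (simp add: algebra_simps)
    then have "p + 1 \<le> q + 2 * u" by simp
    then have "card K * (p + 1) \<le> card K * (q + 2 * u)" by (rule mult_le_mono2)
    then have "card (thick S) + card K \<le> card (thick (S - {a, b})) + 2 * size_out"
      using pqu by (simp add: algebra_simps)
    then have le: "card (thick S) + card K \<le> card (subset_sums S) + 2 * size_out"
      using thick_remove_pair[OF x ab] by linarith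
    define h where "h = int (card K)"
    define v where "v = int u"
    define z where "z = int size_out"
    define r where "r = int (card H) - int (card (thick S))"
    have h: "3 \<le> h" using h3 by (simp add: h_def)
    have zh: "z = h * v" using pqu by (simp add: z_def h_def v_def)
    have z1: "1 \<le> z" using size_out_pos by (simp add: z_def)
    then have v: "1 \<le> v" using zh by (cases u) (auto simp: v_def)
    have "int (size_out * (size_out - 1) + 2) \<le> int (2 * card (subset_sums S))" using b by (simp only: of_nat_le_iff)
    then have b': "z * (z - 1) + 2 \<le> 2 * int (card (subset_sums S))"
      using size_out_pos by (simp add: z_def of_nat_diff)
    have r: "z * z - 5 * z + 2 * h + 2 \<le> 2 * r"
      using b' half le by (simp add: r_def h_def z_def algebra_simps)
    \<comment> \<open>With \<open>z = h * v\<close>, the two sides of \<open>key\<close> differ by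
      \<open>(h - 3) * z^2 + h^2 * (v - 1) * (v - 2)\<close>; this is where
      \<open>|K| \<ge> 3\<close> enters.\<close>
    have "0 \<le> (v - 1) * (v - 2)" using v by (cases "v = 1") auto
    then have "0 \<le> (h * h) * ((v - 1) * (v - 2))" by simp
    moreover have "0 \<le> (h - 3) * (z * z)" using h by simp
    ultimately have key: "2 * (z * (z - h)) \<le> h * (z * z - 5 * z + 2 * h)"
      unfolding zh by (simp add: algebra_simps)
    have "card K \<le> size_out" using pqu size_out_pos by (cases u) auto
    then have "0 \<le> z * (z - h)" using z1 by (simp add: z_def h_def)
    then have "0 \<le> h * (z * z - 5 * z + 2 * h)" using key by linarith
    then have "0 \<le> z * z - 5 * z + 2 * h" using h by (simp add: zero_le_mult_iff)
    then have r0: "0 < r" using r by linarith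
    have "h * (z * z - 5 * z + 2 * h) \<le> h * (2 * r)" using r h by (intro mult_left_mono) auto
    then have zr: "z * (z - h) \<le> h * r" using key by linarith
    have r': "r = int (card H - card (thick S))" using r0 by (simp add: r_def)
    have zh': "z - h = int (size_out - card K)" using \<open>card K \<le> size_out\<close> by (simp add: z_def h_def)
    have "int (size_out * (size_out - card K)) \<le> int (card K * (card H - card (thick S)))"
      using zr unfolding r' zh' of_nat_mult by (simp only: z_def h_def)
    then have up: "size_out * (size_out - card K) \<le> card K * (card H - card (thick S))"
      by (simp only: of_nat_le_iff)
    have "card (thick S) < card H" using r0 by (simp add: r_def)
    then show ?thesis
      using peel_many[of S t, OF order_refl _ _ low up] t(2) by simp
  qed
  then obtain B where B: "B \<subseteq> S" "card B + t = card S" "card (thick B) + t * size_out \<le> card (thick S)"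
    by blast
  have "card (thick S) + card (subset_sums B) \<le> card (subset_sums S) + card (thick B)"
    using meets_of_small_complement[OF B(1)] t(2) B(2) by (intro defect_transfer[OF B(1)]) force
  then show ?thesis using B by (intro exI[of _ B]) auto
qed

end

section \<open>Arbitrary finite abelian groups\<close>

text \<open>The setting of the induction: the hypothesis on signs together with the failure of (ii),
  freed of the division by 2.\<close>

definition good :: "'a::ab_group_add set \<Rightarrow> bool" where
  "good S \<longleftrightarrow> S \<inter> uminus ` S = {} \<and>
     (\<forall>T\<subseteq>S. T \<noteq> {} \<longrightarrow> 2 * card (subset_sums T) \<le> card (group_closure T))"

lemma good_antisym: "good S \<Longrightarrow> S \<inter> uminus ` S = {}"
  by (simp add: good_def)

lemma good_minus: "good S \<Longrightarrow> x \<in> S \<Longrightarrow> - x \<notin> S"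
  using good_antisym[of S] by (metis IntI empty_iff imageI minus_minus)

lemma good_half: "good S \<Longrightarrow> S \<noteq> {} \<Longrightarrow> 2 * card (subset_sums S) \<le> card (group_closure S)"
  by (simp add: good_def)

lemma good_subset: "good S \<Longrightarrow> T \<subseteq> S \<Longrightarrow> good T"
  unfolding good_def by blast

lemma good_Int_half:
  fixes S V :: "'a::{finite,ab_group_add} set"
  assumes S: "good S" and V: "subgrp V" "S \<inter> V \<noteq> {}"
  shows "2 * card (subset_sums (S \<inter> V)) \<le> card V"
proof -
  have "card (group_closure (S \<inter> V)) \<le> card V"
    using V(1) by (intro card_mono group_closure_least) auto
  then show ?thesis using good_half[OF good_subset[OF S, of "S \<inter> V"] V(2)] by simp
qed

lemma good_double: "good S \<Longrightarrow> x \<in> S \<Longrightarrow> x + x \<noteq> 0"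
  using good_minus[of S x] by (metis add_eq_0_iff2)

text \<open>A subset \<open>A\<close> of \<open>T\<close> is, up to signs, the subset of
  \<open>S\<close> carried by the same pairs \<open>{v, - v}\<close>; it has equally many subset
  sums and the same closure.\<close>

lemma good_flip:
  fixes S T :: "'a::{finite,ab_group_add} set"
  assumes S: "good S" and T: "T \<inter> uminus ` T = {}" and eq: "S \<union> uminus ` S = T \<union> uminus ` T"
  shows "good T"
  unfolding good_def
proof (intro conjI T allI impI)
  fix A assume A: "A \<subseteq> T" "A \<noteq> {}"
  define B where "B = {x \<in> S. x \<in> A \<or> - x \<in> A}"
  have AT: "A \<inter> uminus ` A = {}" using A T by blast
  have B: "B \<inter> uminus ` B = {}" using good_antisym[OF S] by (auto simp: B_def)
  have "B \<union> uminus ` B = A \<union> uminus ` A"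
  proof
    show "B \<union> uminus ` B \<subseteq> A \<union> uminus ` A"
      by (auto simp: B_def image_iff) (metis minus_minus)+
    show "A \<union> uminus ` A \<subseteq> B \<union> uminus ` B"
    proof -
      have "a \<in> B \<union> uminus ` B" if a: "a \<in> A" for a
      proof -
        have "a \<in> S \<union> uminus ` S" using a A eq by blast
        then show ?thesis using a by (auto simp: B_def)
      qed
      then show ?thesis by (auto simp: image_iff) (metis minus_minus)+
    qed
  qed
  then have "card (subset_sums B) = card (subset_sums A)" "group_closure B = group_closure A" "B \<noteq> {}"
    using antisymmetric_same_span[OF B AT] group_closure_same_span[of B A] A(2) by auto
  moreover have "B \<subseteq> S" by (auto simp: B_def)
  ultimately show "2 * card (subset_sums A) \<le> card (group_closure A)"
    using S by (metis good_def)
qed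

lemma card_sym_gens:
  fixes S :: "'a::{finite,ab_group_add} set"
  assumes S: "good S"
  shows "card (sym_gens S) = 2 * card S + 1"
proof -
  have "0 \<notin> S" using good_minus[OF S, of 0] by auto
  then have "0 \<notin> S \<union> uminus ` S" by auto
  moreover have "card (S \<union> uminus ` S) = card S + card (uminus ` S)"
    using good_antisym[OF S] by (intro card_Un_disjoint) auto
  ultimately show ?thesis by (simp add: sym_gens_def card_reflect)
qed

lemma subset_sums_singleton:
  fixes S :: "'a::{finite,ab_group_add} set"
  assumes S: "good S" "card S = 1"
  shows "card (subset_sums S) = 2"
proof -
  obtain x where x: "S = {x}" using S(2) by (auto simp: card_1_singleton_iff)
  have "x \<noteq> 0" using good_double[OF S(1), of x] x by auto
  moreover have "subset_sums {x} = {0, x}"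
    using subset_sums_insert[of x "{}"] by (auto simp: subset_sums_empty)
  ultimately show ?thesis using x by simp
qed

lemma subset_sums_doubleton:
  fixes S :: "'a::{finite,ab_group_add} set"
  assumes S: "good S" "card S = 2"
  shows "card (subset_sums S) = 4"
proof -
  obtain x y where xy: "S = {x, y}" "x \<noteq> y" using S(2) by (auto simp: card_2_iff)
  have "x \<noteq> 0" "y \<noteq> 0" using good_double[OF S(1), of x] good_double[OF S(1), of y] xy by auto
  moreover have "x + y \<noteq> 0" using good_minus[OF S(1), of x] xy by (auto simp: add_eq_0_iff)
  moreover have "subset_sums {x, y} = {0, y, x, x + y}"
    using subset_sums_insert[of x "{y}"] subset_sums_insert[of y "{}"] xy(2) by (auto simp: subset_sums_empty)
  ultimately show ?thesis using xy by auto
qed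

lemma layer_bound_sym_gens:
  fixes B S :: "'a::{finite,ab_group_add} set" and m :: nat and g :: "nat \<Rightarrow> int"
  assumes m: "\<And>x. x \<in> S \<Longrightarrow> shift_defect B x \<le> m"
    and g: "\<And>j. g j \<le> int (card (iter_plus {0} (sym_gens S) j))" and q: "int m * int q \<le> int (card B)"
  shows "int m * (\<Sum>j<q. g j) + (int (card B) - int m * int q) * g q \<le> (int (card B))\<^sup>2"
proof (rule layer_bound_card[where C = "iter_plus {0} (sym_gens S)"])
  show "iter_plus {0} (sym_gens S) j \<subseteq> iter_plus {0} (sym_gens S) (Suc j)" for j
    by (rule iter_plus_incr[OF zero_in_sym_gens])
  show "shift_defect B c \<le> m * j" if "c \<in> iter_plus {0} (sym_gens S) j" for j c
  proof (rule shift_defect_iter_plus[OF _ _ that])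
    show "shift_defect B c \<le> m" if "c \<in> sym_gens S" for c
      using that m shift_defect_minus[of B] by (auto simp: sym_gens_def shift_defect_zero)
  qed (simp add: shift_defect_zero)
qed (rule g q)+

text \<open>Every defect is at most the excess \<open>m\<close> of \<open>|B|\<close> over the bound
  for \<open>k - 1\<close> elements, so \<open>general_layers\<close> refutes a failure of the bound
  once the sumsets grow by \<open>2 k\<close>.\<close>

lemma unstructured_bound:
  fixes S :: "'a::{finite,ab_group_add} set"
  assumes S: "good S" and k: "3 \<le> card S"
    and growth: "\<And>Y. Y \<subseteq> group_closure S \<Longrightarrow> Y \<noteq> {} \<Longrightarrow> Y + sym_gens S \<noteq> group_closure S \<Longrightarrow>
      card Y + 2 * card S \<le> card (Y + sym_gens S)"
    and IH: "\<And>x. x \<in> S \<Longrightarrow> (card S - 1) * (card S - 2) + 6 \<le> 2 * card (subset_sums (S - {x}))"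
  shows "card S * (card S - 1) + 6 \<le> 2 * card (subset_sums S)"
proof (rule ccontr)
  assume no: "\<not> ?thesis"
  define k where "k = card S"
  define B where "B = subset_sums S"
  define f where "f = ((k - 1) * (k - 2) + 6) div 2"
  have "even ((k - 1) * (k - 2))" using k by (cases "even k") (auto simp: k_def)
  then have f: "2 * f = (k - 1) * (k - 2) + 6" by (simp add: f_def)
  obtain x0 where "x0 \<in> S" using k by (metis card.empty equals0I not_numeral_le_zero)
  have def: "f + shift_defect B x \<le> card B" if "x \<in> S" for x
    using card_subset_sums_remove[OF that] IH[OF that] f by (simp add: B_def k_def)
  define m where "m = card B - f"
  have m: "card B = f + m" using def[OF \<open>x0 \<in> S\<close>] by (simp add: m_def)
  have dm: "shift_defect B x \<le> m" if "x \<in> S" for x using def[OF that] m by simp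
  have ik: "int ((k - 1) * (k - 2)) = (int k - 1) * (int k - 2)" using k by (simp add: k_def of_nat_diff)
  have "2 * int f = int ((k - 1) * (k - 2) + 6)" using f by (metis of_nat_mult of_nat_numeral)
  then have b: "2 * int (card B) = (int k - 1) * (int k - 2) + 6 + 2 * int m" using m ik by simp
  have "2 * card B < k * (k - 1) + 6" using no by (simp add: B_def k_def)
  then have "int (2 * card B) < int (k * (k - 1) + 6)" by (simp only: of_nat_less_iff)
  moreover have "int (k * (k - 1) + 6) = int k * (int k - 1) + 6" using k by (simp add: k_def of_nat_diff)
  ultimately have "2 * int (card B) < int k * (int k - 1) + 6" by (simp only: of_nat_mult of_nat_numeral)
  then have "2 * int m < 2 * int k - 2" using b by (simp add: algebra_simps)
  then have mk: "int m \<le> int k - 2" by linarith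
  obtain q where q: "int m * int q \<le> int (card B)"
    "(int (card B))\<^sup>2 < int m * (\<Sum>j<q. min (2 * int (card B)) (1 + 2 * int k * int j))
      + (int (card B) - int m * int q) * min (2 * int (card B)) (1 + 2 * int k * int q)"
    using general_layers[of "int k" "int m" "int (card B)"] k mk b by (auto simp: k_def)
  let ?Q = "sym_gens S" and ?H = "group_closure S"
  have "int m * (\<Sum>j<q. min (2 * int (card B)) (1 + 2 * int k * int j))
      + (int (card B) - int m * int q) * min (2 * int (card B)) (1 + 2 * int k * int q) \<le> (int (card B))\<^sup>2"
  proof (rule layer_bound_sym_gens[OF dm])
    show "min (2 * int (card B)) (1 + 2 * int k * int j) \<le> int (card (iter_plus {0} ?Q j))" for j
    proof -
      have hB: "2 * card B \<le> card ?H" using good_half[OF S] \<open>x0 \<in> S\<close> by (auto simp: B_def)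
      have "min (2 * card B) (card {0::'a} + 2 * k * j) \<le> card (iter_plus {0} ?Q j)"
      proof (rule iter_plus_card[OF subgrp_group_closure _ _ _ zero_in_sym_gens])
        show "sym_gens S \<subseteq> ?H" by (rule sym_gens_subset[OF subgrp_group_closure subset_group_closure])
        show "card Y + 2 * k \<le> card (Y + ?Q)" if "Y \<subseteq> ?H" "Y \<noteq> {}" "Y + ?Q \<noteq> ?H" for Y
          using growth[OF that] by (simp add: k_def)
      qed (use hB in simp_all)
      then have "int (min (2 * card B) (1 + 2 * k * j)) \<le> int (card (iter_plus {0} ?Q j))"
        by (simp only: of_nat_le_iff) simp
      then show ?thesis by (simp add: of_nat_min)
    qed
  qed (use q(1) in auto)
  then show False using q(2) by linarith
qed

text \<open>\<open>P\<close> is a largest \<open>K\<close>-periodic set disjoint from its negative.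
  If it contained neither of two distinct opposite cosets, one of them could be added.\<close>

lemma sign_choice:
  fixes K :: "'a::{finite,ab_group_add} set"
  assumes K: "subgrp K"
  obtains P where "\<And>v k. v \<in> P \<Longrightarrow> k \<in> K \<Longrightarrow> v + k \<in> P" "\<And>v. v \<in> P \<Longrightarrow> - v \<notin> P"
    "\<And>v. v + v \<notin> K \<Longrightarrow> v \<in> P \<or> - v \<in> P"
proof -
  define F where "F P \<longleftrightarrow> (\<forall>v\<in>P. \<forall>k\<in>K. v + k \<in> P) \<and> (\<forall>v\<in>P. - v \<notin> P)" for P :: "'a set"
  have F0: "F {}" by (simp add: F_def)
  have "\<forall>P. F P \<longrightarrow> card P < Suc (card (UNIV :: 'a set))"
    by (simp add: less_Suc_eq_le card_mono)
  from ex_has_greatest_nat[OF F0 this]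
  obtain P where "F P \<and> (\<forall>P'. F P' \<longrightarrow> card P' \<le> card P)" ..
  then have P: "F P" and max: "\<And>P'. F P' \<Longrightarrow> card P' \<le> card P" by simp_all
  have dich: "v \<in> P \<or> - v \<in> P" if v: "v + v \<notin> K" for v
  proof (rule ccontr)
    assume no: "\<not> (v \<in> P \<or> - v \<in> P)"
    let ?P = "P \<union> (+) v ` K"
    have "F ?P" unfolding F_def
    proof (intro conjI ballI)
      fix a k assume "a \<in> ?P" "k \<in> K"
      then show "a + k \<in> ?P" using P subgrp_add[OF K] by (auto simp: F_def add.assoc)
    next
      fix a assume a: "a \<in> ?P"
      show "- a \<notin> ?P"
      proof
        assume a': "- a \<in> ?P"
        have cross: False if "c \<in> P" "- c = v + k" "k \<in> K" for c k
        proof -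
          have "c = - (v + k)" using that(2) by (metis minus_minus)
          then have "- v = c + k" by simp
          then show False using P that no by (auto simp: F_def)
        qed
        from a a' consider "a \<in> P" "- a \<in> P" | k where "a \<in> P" "- a = v + k" "k \<in> K"
          | k where "- a \<in> P" "- (- a) = v + k" "k \<in> K" | k l where "a = v + k" "- a = v + l" "k \<in> K" "l \<in> K"
          by auto
        then show False
        proof cases
          case 1 then show ?thesis using P by (auto simp: F_def)
        next
          case 2 then show ?thesis by (rule cross)
        next
          case 3 then show ?thesis by (rule cross)
        next
          case 4
          have "v + v = - (k + l)" using 4(1,2) by (simp add: algebra_simps eq_neg_iff_add_eq_0)
          then show ?thesis using v subgrp_minus[OF K subgrp_add[OF K 4(3,4)]] by simp
        qed
      qed
    qed
    then have "card ?P \<le> card P" by (rule max)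
    then have "?P = P" by (intro card_seteq[symmetric]) auto
    moreover have "v \<in> (+) v ` K" using subgrp_zero[OF K] by (intro image_eqI[of _ _ 0]) auto
    ultimately show False using no by blast
  qed
  show thesis
  proof (rule that)
    show "v + k \<in> P" if "v \<in> P" "k \<in> K" for v k using P that by (simp add: F_def)
    show "- v \<notin> P" if "v \<in> P" for v using P that by (simp add: F_def)
  qed (rule dich)
qed

text \<open>Inclusion-exclusion for \<open>sym_gens S \<union> V\<close> inside
  \<open>K + sym_gens S\<close>. It bounds \<open>S \<inter> V\<close> from below when
  \<open>K + sym_gens S\<close> is small.\<close>

lemma card_closure_ge:
  fixes K :: "'a::{finite,ab_group_add} set"
  assumes S: "good S" and K: "subgrp K" and V: "subgrp V" "V \<subseteq> K + sym_gens S"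
  shows "2 * card S + card V \<le> card (K + sym_gens S) + 2 * card (S \<inter> V)"
proof -
  let ?Q = "sym_gens S"
  have QV: "?Q \<inter> V = sym_gens (S \<inter> V)"
    using subgrp_zero[OF V(1)] subgrp_minus[OF V(1)] subgrp_minus_iff[OF V(1)] by (auto simp: sym_gens_def)
  have "?Q \<subseteq> K + ?Q" using subset_set_plus[OF subgrp_zero[OF K], of ?Q] by (simp add: add.commute)
  then have "card (?Q \<union> V) \<le> card (K + ?Q)" using V(2) by (intro card_mono) auto
  moreover have "card ?Q + card V = card (?Q \<union> V) + card (?Q \<inter> V)" by (intro card_Un_Int) auto
  ultimately show ?thesis
    using card_sym_gens[OF S] card_sym_gens[OF good_subset[OF S, of "S \<inter> V"]] QV by simp
qed

text \<open>A sign change \<open>T\<close> of \<open>S\<close> satisfies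
  \<open>coset_structure\<close>. The sets \<open>B\<close> found are subsets of \<open>T\<close>
  rather than of \<open>S\<close>, so \<open>low\<close> and the conclusion speak of arbitrary good
  sets of a given size, which the induction hypothesis covers as well.\<close>

lemma structured_conclusion:
  fixes S K :: "'a::{finite,ab_group_add} set"
  assumes S: "good S" and K: "subgrp K" "K \<subseteq> group_closure S" "K + sym_gens S \<noteq> group_closure S"
    and growth: "\<And>Y. Y \<subseteq> group_closure S \<Longrightarrow> Y \<noteq> {} \<Longrightarrow> Y + sym_gens S \<noteq> group_closure S \<Longrightarrow>
      card (K + sym_gens S) + card Y \<le> card (Y + sym_gens S) + card K"
    and noinv: "\<And>y. y \<in> S \<Longrightarrow> y \<notin> K \<Longrightarrow> y + y \<notin> K"
    and tors: "\<exists>s\<in>K. s + s \<noteq> 0"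
    and z: "card (K + sym_gens S) = card K + 2 * z" and e: "z + e = card S"
    and dens: "4 * (card (S \<inter> K) - e) < card K" "card (S \<inter> K) < e + card (subset_sums (S \<inter> K))"
    and t: "2 \<le> t" "t + card (S \<inter> K) < card K + e"
    and low: "\<And>B :: 'a set. good B \<Longrightarrow> card B < card S \<Longrightarrow> card S < card B + t \<Longrightarrow>
      z * (z - card K) \<le> card K * card (subset_sums B)"
    and low0: "z * (z - card K) \<le> card K * card (subset_sums S)"
    and b: "z * (z - 1) + 2 \<le> 2 * card (subset_sums S)" and h3: "3 \<le> card K"
  shows "\<exists>B :: 'a set. good B \<and> card B + t = card S \<and>
    card (subset_sums B) + t * z \<le> card (subset_sums S)"
proof -
  obtain P where P: "\<And>v k. v \<in> P \<Longrightarrow> k \<in> K \<Longrightarrow> v + k \<in> P" "\<And>v. v \<in> P \<Longrightarrow> - v \<notin> P"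
    "\<And>v. v + v \<notin> K \<Longrightarrow> v \<in> P \<or> - v \<in> P" using sign_choice[OF K(1)] by metis
  define T where "T = {x. (x \<in> S \<or> - x \<in> S) \<and> (if x \<in> K then x \<in> S else x \<in> P)}"
  have Kneg: "- x \<in> K \<longleftrightarrow> x \<in> K" for x by (rule subgrp_minus_iff[OF K(1)])
  have Tanti: "T \<inter> uminus ` T = {}"
  proof -
    have "- x \<notin> T" if "x \<in> T" for x
      using that good_minus[OF S, of x] P(2)[of x] Kneg[of x] by (auto simp: T_def split: if_splits)
    then show ?thesis by auto
  qed
  have span: "S \<union> uminus ` S = T \<union> uminus ` T"
  proof -
    have "x \<in> T \<or> - x \<in> T" if x: "x \<in> S" for x
    proof (cases "x \<in> K")
      case False
      then show ?thesis using P(3)[OF noinv[OF x False]] x Kneg[of x] by (auto simp: T_def)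
    qed (use x in \<open>simp add: T_def\<close>)
    then have "S \<subseteq> T \<union> uminus ` T" by (metis UnI1 UnI2 image_eqI minus_minus subsetI)
    then have "S \<union> uminus ` S \<subseteq> T \<union> uminus ` T" by (auto simp: subset_iff)
    moreover have "T \<subseteq> S \<union> uminus ` S"
    proof
      fix x assume "x \<in> T"
      then have "x \<in> S \<or> - x \<in> S" by (simp add: T_def)
      then show "x \<in> S \<union> uminus ` S" by (metis UnI1 UnI2 image_eqI minus_minus)
    qed
    then have "T \<union> uminus ` T \<subseteq> S \<union> uminus ` S" by (auto simp: subset_iff)
    ultimately show ?thesis by blast
  qed
  have gT: "good T" by (rule good_flip[OF S Tanti span])
  have cT: "card S = card T" "card (subset_sums S) = card (subset_sums T)"
    by (rule antisymmetric_same_span[OF good_antisym[OF S] Tanti span])+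
  have HT: "group_closure S = group_closure T" by (rule group_closure_same_span[OF span])
  have QT: "sym_gens S = sym_gens T" unfolding sym_gens_def span ..
  have KT: "T \<inter> K = S \<inter> K" by (auto simp: T_def)
  have TP: "x \<in> P" if "x \<in> T" "x \<notin> K" for x using that by (simp add: T_def)
  have signs: "x + y \<notin> K" if "x \<in> T" "y \<in> T" "x \<notin> K" "y \<notin> K" for x y
  proof
    assume "x + y \<in> K"
    then have "x + - (x + y) \<in> P" using TP[OF that(1,3)] P(1) Kneg by blast
    then have "- y \<in> P" by simp
    then show False using P(2) TP[OF that(2,4)] by blast
  qed
  have SK: "\<not> T \<subseteq> K"
  proof
    assume "T \<subseteq> K"
    then have "group_closure S \<subseteq> K" unfolding HT by (rule group_closure_least[OF K(1)])
    then have "K = group_closure S" using K(2) by auto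
    moreover have "K + sym_gens S \<subseteq> group_closure S"
      by (intro set_plus_subset_subgrp subgrp_group_closure K(2) sym_gens_subset subset_group_closure)
    moreover have "K \<subseteq> K + sym_gens S" by (rule subset_set_plus[OF zero_in_sym_gens])
    ultimately show False using K(3) by auto
  qed
  define R where "R = (T - K) + K"
  \<comment> \<open>\<open>R\<close> has \<open>z\<close> elements and contains all of
    \<open>T - K\<close>, which has \<open>z + e - |S \<inter> K|\<close>. So every coset in
    \<open>R\<close> misses at most \<open>|S \<inter> K| - e\<close> elements.\<close>
  have fibre: "card K + e \<le> card {y \<in> T. y - x \<in> K} + card (S \<inter> K)" if x: "x \<in> T" "x \<notin> K" and R: "card R = z" for x
  proof -
    have TR: "T - K \<subseteq> R" unfolding R_def by (rule subset_set_plus[OF subgrp_zero[OF K(1)]])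
    have "(+) x ` K \<subseteq> {y \<in> T. y - x \<in> K} \<union> (R - (T - K))"
    proof
      fix y assume "y \<in> (+) x ` K"
      then obtain k where k: "k \<in> K" "y = x + k" by blast
      have "y \<in> R" using x k unfolding R_def by (auto intro: set_plus_memI)
      then show "y \<in> {y \<in> T. y - x \<in> K} \<union> (R - (T - K))" using k by auto
    qed
    then have "card ((+) x ` K) \<le> card ({y \<in> T. y - x \<in> K} \<union> (R - (T - K)))" by (intro card_mono) auto
    also have "\<dots> \<le> card {y \<in> T. y - x \<in> K} + card (R - (T - K))" by (rule card_Un_le)
    finally have "card K \<le> card {y \<in> T. y - x \<in> K} + card (R - (T - K))" by (simp only: card_translate)
    moreover have "card (R - (T - K)) = card R - card (T - K)" using TR by (intro card_Diff_subset) auto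
    moreover have "card (T - K) \<le> card R" using TR by (intro card_mono) auto
    moreover have "card T = card (T - K) + card (T \<inter> K)"
      by (metis Int_commute add.commute card_Diff_subset_Int card_mono finite inf_le1 le_add_diff_inverse2)
    ultimately show ?thesis using R e cT(1) KT by simp
  qed
  have cR: "card R = z"
    using card_coset_sym_gens[OF K(1) signs] z unfolding R_def QT by simp
  interpret coset_structure T K "group_closure T"
  proof
    show "4 * (card K - card {y \<in> T. y - x \<in> K}) < card K" if "x \<in> T" "x \<notin> K" for x
      using fibre[OF that cR] dens(1) by linarith
    show "card K < card {y \<in> T. y - x \<in> K} + card (subset_sums (T \<inter> K))" if "x \<in> T" "x \<notin> K" for x
      using fibre[OF that cR] dens(2) KT by simp
    show "2 * card (subset_sums T) \<le> card (group_closure T)"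
      using good_half[OF gT] SK by auto
    show "card (K + sym_gens T) + card Y \<le> card (Y + sym_gens T) + card K"
      if "Y \<subseteq> group_closure T" "Y \<noteq> {}" "Y + sym_gens T \<noteq> group_closure T" for Y
      using growth[of Y] that QT HT by simp
  qed (use K(1,2) tors HT SK signs in \<open>simp_all add: subset_group_closure subgrp_group_closure\<close>)
  have so: "size_out = z" using cR by (simp add: size_out_def R_def)
  have "\<exists>B\<subseteq>T. card B + t = card T \<and> card (subset_sums B) + t * size_out \<le> card (subset_sums T)"
  proof (rule structured_bound[OF t(1)])
    show "t < card (cls x)" if "x \<in> T" "x \<notin> K" for x
      using fibre[OF that cR] t(2) by (simp add: cls_def)
    show "size_out * (size_out - card K) \<le> card K * card (subset_sums B)"
      if B: "B \<subseteq> T" "card T < card B + t" for B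
    proof (cases "B = T")
      case True
      then show ?thesis using low0 so cT by simp
    next
      case False
      then have "card B < card T" using B(1) by (intro psubset_card_mono) auto
      then show ?thesis using low[OF good_subset[OF gT B(1)]] B(2) so cT by simp
    qed
  qed (use b h3 so cT in auto)
  then obtain B where B: "B \<subseteq> T" "card B + t = card T" "card (subset_sums B) + t * z \<le> card (subset_sums T)"
    using so by auto
  then show ?thesis using good_subset[OF gT B(1)] cT by (intro exI[of _ B]) simp
qed

text \<open>By \<open>noinv\<close>, negation has no fixed point on \<open>K + sym_gens S\<close>
  outside \<open>K\<close>, whence the even difference. For the same reason \<open>x + K\<close> and
  \<open>- x + K\<close> are disjoint, which gives \<open>|K| \<le> z\<close>.\<close>

lemma card_outside:
  fixes S K :: "'a::{finite,ab_group_add} set"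
  assumes K: "subgrp K" and noinv: "\<And>y. y \<in> S \<Longrightarrow> y \<notin> K \<Longrightarrow> y + y \<notin> K" and SK: "\<not> S \<subseteq> K"
  obtains z where "card (K + sym_gens S) = card K + 2 * z" "card K \<le> z"
proof -
  let ?W = "K + sym_gens S"
  have KW: "K \<subseteq> ?W" by (rule subset_set_plus[OF zero_in_sym_gens])
  have sym: "symm ?W" by (intro symm_set_plus symm_subgrp[OF K] symm_sym_gens)
  have "even (card (?W - K))"
  proof (rule even_card_fixpoint_free_involution[where f = uminus])
    fix v assume v: "v \<in> ?W - K"
    then show "- v \<in> ?W - K" using symm_minus_iff[OF sym] subgrp_minus_iff[OF K] by simp
    show "- v \<noteq> v"
    proof
      assume "- v = v"
      then have v0: "v + v = 0" by (metis add.right_inverse)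
      have "v \<in> ?W" using v by simp
      then obtain k q where kq: "k \<in> K" "q \<in> sym_gens S" "v = k + q" unfolding set_plus_iff by blast
      have "q \<notin> K" using v kq subgrp_add[OF K] by auto
      have "q + q = - (k + k)" using v0 kq(3) by (simp add: algebra_simps eq_neg_iff_add_eq_0)
      then have qq: "q + q \<in> K"
        using subgrp_minus[OF K subgrp_add[OF K kq(1) kq(1)]] by simp
      have "- (q + q) \<in> K" by (rule subgrp_minus[OF K qq])
      then have "- q + - q \<in> K" by simp
      moreover note qq
      moreover have "q \<in> S \<or> - q \<in> S" using kq(2) \<open>q \<notin> K\<close> subgrp_zero[OF K] by (auto simp: sym_gens_def)
      ultimately show False using noinv[of q] noinv[of "- q"] \<open>q \<notin> K\<close> subgrp_minus_iff[OF K] by auto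
    qed
  qed simp_all
  then obtain z where z: "card (?W - K) = 2 * z" by (rule evenE)
  have cW: "card ?W = card K + 2 * z"
    using z KW card_mono[OF _ KW] by (simp add: card_Diff_subset)
  obtain x where x: "x \<in> S" "x \<notin> K" using SK by blast
  let ?A = "(+) x ` K" and ?B = "(+) (- x) ` K"
  have A: "y \<in> ?A \<longleftrightarrow> y - x \<in> K" for y using mem_translate_minus[of y "- x" K] by simp
  have B: "y \<in> ?B \<longleftrightarrow> y + x \<in> K" for y using mem_translate_minus[of y x K] by (simp add: add.commute)
  have "?A \<union> ?B \<subseteq> ?W - K"
  proof -
    have "k + q \<in> ?W - K" if "q = x \<or> q = - x" "k \<in> K" for k q
    proof -
      have "q \<notin> K" using that x subgrp_minus_iff[OF K] by auto
      then have "q + k \<notin> K" using subgrp_add_cancel_right[OF K that(2)] by simp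
      moreover have "k + q \<in> ?W" using that x by (intro set_plus_memI) (auto simp: sym_gens_def)
      ultimately show ?thesis by (simp add: add.commute)
    qed
    note in_W = this
    show ?thesis
    proof
      fix v assume "v \<in> ?A \<union> ?B"
      then obtain k where "k \<in> K" "v = k + x \<or> v = k + - x" by (auto simp: add.commute)
      then show "v \<in> ?W - K" using in_W by blast
    qed
  qed
  moreover have "?A \<inter> ?B = {}"
  proof -
    have False if "y - x \<in> K" "y + x \<in> K" for y
    proof -
      have "(y + x) - (y - x) \<in> K" by (rule subgrp_diff[OF K that(2,1)])
      then show False using noinv[OF x] by simp
    qed
    then show ?thesis using A B by blast
  qed
  ultimately have "card ?A + card ?B \<le> card (?W - K)"
    by (metis card_Un_disjoint card_mono finite)
  then have "card K \<le> z" using z unfolding card_translate by linarith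
  then show thesis using that cW by blast
qed

text \<open>This verifies the size condition of \<open>peel_many\<close> for a set whose number
  \<open>b\<close> of subset sums obeys a quadratic bound with parameter
  \<open>c \<ge> z - e - 1\<close>.\<close>

lemma structured_arith:
  fixes h e z c b :: nat
  assumes "4 * e \<le> h" "3 \<le> h" "h \<le> z" "z < c + e + 2"
    and b: "c * (c + 1) \<le> 2 * b"
  shows "z * (z - h) \<le> h * b"
proof -
  define H E Z C where "H = int h" and "E = int e" and "Z = int z" and "C = int c"
  have *: "4 * E \<le> H" "3 \<le> H" "0 \<le> E" "H \<le> Z" "Z - E - 1 \<le> C"
    using assms by (simp_all add: H_def E_def Z_def C_def)
  have "int (c * (c + 1)) \<le> int (2 * b)" using b by (simp only: of_nat_le_iff)
  then have b': "C * (C + 1) \<le> 2 * int b" by (simp add: C_def algebra_simps)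
  have "(Z - E - 1) * (Z - E) \<le> C * (C + 1)" using * by (intro mult_mono) auto
  then have "H * ((Z - E - 1) * (Z - E)) \<le> H * (2 * int b)" using b' * by (intro mult_left_mono) auto
  \<comment> \<open>This term and \<open>H * (E * E + E)\<close> add up to
    \<open>H * ((Z - E - 1) * (Z - E)) - 2 * Z * (Z - H)\<close>; \<open>4 * E \<le> H\<close> makes
    its last factor non-negative.\<close>
  moreover have "0 \<le> Z * ((Z - H) * (H - 2) + H * (H - 1 - 2 * E))"
    using * by (intro mult_nonneg_nonneg add_nonneg_nonneg) auto
  moreover have "0 \<le> H * (E * E + E)" using * by simp
  ultimately have main: "Z * (Z - H) \<le> H * int b" by (simp add: algebra_simps)
  have zh: "int (z - h) = Z - H" using assms by (simp add: Z_def H_def of_nat_diff)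
  have "int (z * (z - h)) \<le> int (h * b)"
    unfolding of_nat_mult zh using main by (simp only: Z_def H_def)
  then show ?thesis by (simp only: of_nat_le_iff)
qed

theorem general_bound:
  fixes S :: "'a::{finite,ab_group_add} set"
  assumes "good S" "2 \<le> card S"
  shows "card S * (card S - 1) + 6 \<le> 2 * card (subset_sums S)"
  using assms
proof (induction "card S" arbitrary: S rule: less_induct)
  case less
  note S = less.prems(1)
  have IH: "card B * (card B - 1) + 6 \<le> 2 * card (subset_sums B)"
    if "good B" "2 \<le> card B" "card B < card S" for B :: "'a set"
    using less.hyps[OF that(3,1,2)] .
  show ?case
  proof (cases "card S = 2")
    case True
    then show ?thesis using subset_sums_doubleton[OF S] by simp
  next
    case False
    define k where "k = card S"
    have k3: "3 \<le> k" using False less.prems by (simp add: k_def)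
    define H where "H = group_closure S"
    define Q where "Q = sym_gens S"
    have Sne: "S \<noteq> {}" using k3 by (auto simp: k_def)
    have half: "2 * card (subset_sums S) \<le> card H" unfolding H_def by (rule good_half[OF S Sne])
    have sub: "(k - 1) * (k - 2) + 6 \<le> 2 * card (subset_sums (S - {x}))" if "x \<in> S" for x
    proof -
      have "card (S - {x}) = k - 1" "k - 2 = k - 1 - 1" using that by (simp_all add: k_def)
      then show ?thesis using IH[OF good_subset[OF S, of "S - {x}"]] k3 by (simp add: k_def)
    qed
    have sub': "(k - 1) * (k - 2) + 6 \<le> 2 * card (subset_sums S)"
    proof -
      obtain x where x: "x \<in> S" using Sne by auto
      have "card (subset_sums (S - {x})) \<le> card (subset_sums S)"
        by (intro card_mono subset_sums_mono) auto
      then show ?thesis using sub[OF x] by linarith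
    qed
    have cQ: "card Q = 2 * k + 1" unfolding Q_def k_def by (rule card_sym_gens[OF S])
    have QH: "Q \<subseteq> H" unfolding Q_def H_def
      by (intro sym_gens_subset subgrp_group_closure subset_group_closure)
    have "Q \<noteq> H"
    proof
      assume "Q = H"
      then have "(k - 1) * (k - 2) + 6 \<le> 2 * k + 1" using half sub' cQ by simp
      moreover obtain j where "k = j + 3" using k3 by (metis add.commute le_Suc_ex)
      ultimately show False by (simp add: algebra_simps)
    qed
    then obtain K where K: "subgrp K" "K \<subseteq> H" "K + Q \<noteq> H"
      and growth: "\<And>Y. Y \<subseteq> H \<Longrightarrow> Y \<noteq> {} \<Longrightarrow> Y + Q \<noteq> H \<Longrightarrow> card (K + Q) + card Y \<le> card (Y + Q) + card K"
      using isoperimetric_subgroup[of H Q] QH subgrp_group_closure[of S] symm_sym_gens[of S] zero_in_sym_gens[of S]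
      unfolding H_def Q_def by metis
    show ?thesis
    proof (cases "card K + 2 * k \<le> card (K + Q)")
      case True
      show ?thesis
      proof (rule unstructured_bound[OF S])
        show "card Y + 2 * card S \<le> card (Y + sym_gens S)"
          if "Y \<subseteq> group_closure S" "Y \<noteq> {}" "Y + sym_gens S \<noteq> group_closure S" for Y
          using growth[of Y] that True by (simp add: H_def Q_def k_def)
      qed (use k3 sub in \<open>simp_all add: k_def\<close>)
    next
      case False
      define h where "h = card K"
      define k0 where "k0 = card (S \<inter> K)"
      have KQ: "K \<subseteq> K + Q" unfolding Q_def by (rule subset_set_plus[OF zero_in_sym_gens])
      have notsub: "\<not> S \<subseteq> V" if V: "subgrp V" "V \<subseteq> K + Q" for V
      proof
        assume "S \<subseteq> V"
        then have "H \<subseteq> V" unfolding H_def by (rule group_closure_least[OF V(1)])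
        moreover have "K + Q \<subseteq> H" using K(2) QH subgrp_group_closure[of S]
          unfolding H_def by (intro set_plus_subset_subgrp)
        ultimately show False using V(2) K(3) by auto
      qed
      have count: "2 * k + card V \<le> card (K + Q) + 2 * card (S \<inter> V)" if "subgrp V" "V \<subseteq> K + Q" for V
        using card_closure_ge[OF S K(1) that(1)] that(2) by (simp add: Q_def k_def)
      have lt: "card (S \<inter> V) < k" if "subgrp V" "V \<subseteq> K + Q" for V
        unfolding k_def using notsub[OF that] by (intro psubset_card_mono) auto
      \<comment> \<open>Otherwise \<open>V = K \<union> (y + K)\<close> is a subgroup inside
        \<open>K + Q\<close>, and counting gives \<open>h < 2 * s\<close> for
        \<open>s = |S \<inter> V|\<close>. But the subset sums of \<open>S \<inter> V\<close> number
        at most \<open>|V| / 2 = h\<close>, too few by induction.\<close>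
      have noinv: "y + y \<notin> K" if y: "y \<in> S" "y \<notin> K" for y
      proof
        assume yy: "y + y \<in> K"
        let ?V = "K \<union> (+) y ` K"
        have memV: "v \<in> (+) y ` K \<longleftrightarrow> v - y \<in> K" for v using mem_translate_minus[of v "- y" K] by simp
        have V: "subgrp ?V"
        proof (rule subgrp_of_add_closed)
          show "0 \<in> ?V" using subgrp_zero[OF K(1)] by simp
          fix a b assume ab: "a \<in> ?V" "b \<in> ?V"
          consider "a \<in> K" "b \<in> K" | "a \<in> K" "b - y \<in> K" | "a - y \<in> K" "b \<in> K" | "a - y \<in> K" "b - y \<in> K"
            using ab memV by blast
          then show "a + b \<in> ?V"
          proof cases
            case 1
            then show ?thesis using subgrp_add[OF K(1)] by blast
          next
            case 2
            then show ?thesis using memV[of "a + b"] subgrp_add[OF K(1), of a "b - y"] by (simp add: algebra_simps)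
          next
            case 3
            then show ?thesis using memV[of "a + b"] subgrp_add[OF K(1), of "a - y" b] by (simp add: algebra_simps)
          next
            case 4
            have "(a - y) + (b - y) + (y + y) \<in> K" by (intro subgrp_add[OF K(1)] 4 yy)
            then show ?thesis by (simp add: algebra_simps)
          qed
        qed
        have VQ: "?V \<subseteq> K + Q"
        proof -
          have "k + y \<in> K + Q" if "k \<in> K" for k
            using that y(1) by (intro set_plus_memI) (auto simp: Q_def sym_gens_def)
          then show ?thesis using KQ by (auto simp: add.commute)
        qed
        have "K \<inter> (+) y ` K = {}"
        proof -
          have False if "v \<in> K" "v - y \<in> K" for v
            using subgrp_diff[OF K(1) that] y(2) by simp
          then show ?thesis using memV by blast
        qed
        then have cV: "card ?V = 2 * h"
          using card_Un_disjoint[of K "(+) y ` K"] card_translate[of y K] by (simp add: h_def)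
        define s where "s = card (S \<inter> ?V)"
        have s: "h < 2 * s" using count[OF V VQ] cV False by (simp add: s_def h_def)
        have "0 < h" using subgrp_zero[OF K(1)] by (auto simp: h_def card_gt_0_iff)
        then have s1: "1 \<le> s" "S \<inter> ?V \<noteq> {}" using s by (auto simp: s_def)
        have hs: "2 * card (subset_sums (S \<inter> ?V)) \<le> 2 * h" using good_Int_half[OF S V s1(2)] cV by simp
        show False
        proof (cases "s = 1")
          case True
          then show False using subset_sums_singleton[OF good_subset[OF S, of "S \<inter> ?V"]] hs s by (simp add: s_def)
        next
          case False
          then have "s * (s - 1) + 6 \<le> 2 * h"
            using IH[OF good_subset[OF S, of "S \<inter> ?V"]] lt[OF V VQ] hs s1 by (simp add: s_def k_def)
          then have "s * (s - 1) + 6 \<le> 4 * s - 2" using s by linarith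
          moreover obtain j where "s = j + 1" using s1(1) by (metis add.commute le_Suc_ex)
          ultimately have "j * j + 4 \<le> 3 * j" by (simp add: algebra_simps)
          then have "j * j < j * 3" by linarith
          then have "j < 3" by simp
          then have "j = 0 \<or> j = 1 \<or> j = 2" by linarith
          then show False using \<open>j * j + 4 \<le> 3 * j\<close> by auto
        qed
      qed
      have SK: "\<not> S \<subseteq> K" by (rule notsub[OF K(1) KQ])
      obtain z where z: "card (K + Q) = h + 2 * z" "h \<le> z"
        using card_outside[OF K(1) noinv SK] unfolding Q_def h_def by metis
      have zk: "z < k" using False z by (simp add: h_def)
      define e where "e = k - z"
      have e: "z + e = k" "1 \<le> e" using zk by (auto simp: e_def)
      have ek: "e \<le> k0" using count[OF K(1) KQ] z e by (simp add: h_def k0_def)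
      have SKne: "S \<inter> K \<noteq> {}" using ek e by (auto simp: k0_def)
      have gK: "good (S \<inter> K)" by (rule good_subset[OF S]) simp
      \<comment> \<open>\<open>k0 * (k0 - 1) + 6 - 4 * k0\<close> equals
        \<open>(k0 - 2) * (k0 - 3)\<close>. The resulting \<open>4 * k0 \<le> h\<close> is what
        makes the classes dense.\<close>
      have sK: "2 * k0 \<le> card (subset_sums (S \<inter> K))"
      proof (cases "k0 = 1")
        case True
        then show ?thesis using subset_sums_singleton[OF gK] by (simp add: k0_def)
      next
        case False
        then have "k0 * (k0 - 1) + 6 \<le> 2 * card (subset_sums (S \<inter> K))"
          using IH[OF gK] ek e lt[OF K(1) KQ] by (simp add: k0_def k_def)
        moreover have "4 * k0 \<le> k0 * (k0 - 1) + 6"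
        proof -
          obtain j where j: "k0 = j + 2" using False ek e by (metis One_nat_def Suc_1 Suc_leI le_Suc_ex add.commute le_neq_implies_less le_trans)
          have "3 * j \<le> j * j + 2"
          proof (cases "j \<le> 2")
            case True
            then have "j = 0 \<or> j = 1 \<or> j = 2" by linarith
            then show ?thesis by auto
          next
            case False
            then have "3 * j \<le> j * j" by (intro mult_le_mono1) simp
            then show ?thesis by linarith
          qed
          then show ?thesis by (simp add: j algebra_simps)
        qed
        ultimately show ?thesis by linarith
      qed
      have h: "4 * k0 \<le> h" using good_Int_half[OF S K(1) SKne] sK by (simp add: h_def)
      have e4: "4 * e \<le> h" using h ek e by linarith+
      have h3: "3 \<le> h" using h ek e by linarith
      obtain s where s: "s \<in> S" "s \<in> K" using SKne by blast
      have "\<exists>B :: 'a set. good B \<and> card B + 2 * e = card S \<and>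
        card (subset_sums B) + 2 * e * z \<le> card (subset_sums S)"
      proof (rule structured_conclusion[OF S K(1) _ _ _ noinv])
        show "K \<subseteq> group_closure S" "K + sym_gens S \<noteq> group_closure S" using K by (simp_all add: H_def Q_def)
        show "card (K + sym_gens S) + card Y \<le> card (Y + sym_gens S) + card K"
          if "Y \<subseteq> group_closure S" "Y \<noteq> {}" "Y + sym_gens S \<noteq> group_closure S" for Y
          using growth[of Y] that by (simp add: H_def Q_def)
        show "\<exists>s\<in>K. s + s \<noteq> 0" using s good_double[OF S s(1)] by blast
        show "card (K + sym_gens S) = card K + 2 * z" using z by (simp add: Q_def h_def)
        show "z + e = card S" using e by (simp add: k_def)
        show "4 * (card (S \<inter> K) - e) < card K" using h ek e by (simp add: h_def k0_def)
        show "card (S \<inter> K) < e + card (subset_sums (S \<inter> K))" using sK e ek by (simp add: k0_def)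
        show "2 \<le> 2 * e" "2 * e + card (S \<inter> K) < card K + e" "3 \<le> card K"
          using h e ek by (simp_all add: h_def k0_def)
        show "z * (z - card K) \<le> card K * card (subset_sums B)"
          if B: "good B" "card B < card S" "card S < card B + 2 * e" for B :: "'a set"
        proof -
          have "2 \<le> card B" using B e h ek z by (simp add: k_def)
          then have "card B * (card B - 1) + 6 \<le> 2 * card (subset_sums B)" by (rule IH[OF B(1) _ B(2)])
          \<comment> \<open>The shift matches the quadratic forms:
            \<open>card B * (card B - 1)\<close> is \<open>c * (c + 1)\<close>.\<close>
          moreover obtain c where c: "card B = c + 1" using \<open>2 \<le> card B\<close> by (metis add.commute le_Suc_ex le_trans one_le_numeral)
          moreover have "z < c + e + 2" using B(3) e c by (simp add: k_def)
          ultimately show ?thesis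
            unfolding h_def[symmetric] by (intro structured_arith[OF e4 h3 z(2), of c]) (simp_all add: algebra_simps)
        qed
        \<comment> \<open>For \<open>S\<close> itself only the bound for \<open>k - 1\<close>
          elements, passed up by monotonicity, is available; hence \<open>c = k - 2\<close>.\<close>
        have "k - 2 + 1 = k - 1" using k3 by simp
        then have "(k - 2) * (k - 2 + 1) \<le> (k - 1) * (k - 2)" by (simp only: mult.commute order_refl)
        then show "z * (z - card K) \<le> card K * card (subset_sums S)"
          unfolding h_def[symmetric] using sub' e k3 by (intro structured_arith[OF e4 h3 z(2), of "k - 2"]) linarith+
        have "z * (z - 1) \<le> (k - 1) * (k - 2)" using zk by (intro mult_le_mono) auto
        then show "z * (z - 1) + 2 \<le> 2 * card (subset_sums S)" using sub' by linarith
      qed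
      then obtain B :: "'a set" where B: "good B" "card B + 2 * e = k"
        "card (subset_sums B) + 2 * e * z \<le> card (subset_sums S)" by (auto simp: k_def)
      have cB: "card B + e = z" using B(2) e by simp
      then have "2 \<le> card B" using z h ek e by linarith
      then have "card B * (card B - 1) + 6 \<le> 2 * card (subset_sums B)"
        using IH[OF B(1)] B(2) e by (simp add: k_def)
      then have "card B * (card B - 1) + 6 + 4 * e * z \<le> 2 * card (subset_sums S)" using B(3) by linarith
      moreover have "k * (k - 1) \<le> card B * (card B - 1) + 4 * e * z"
      proof -
        obtain c where c: "card B = c + 1" using \<open>2 \<le> card B\<close> by (metis add.commute le_Suc_ex le_trans one_le_numeral)
        have "k = c + 1 + 2 * e" "z = c + 1 + e" using B(2) cB c by simp_all
        then show ?thesis by (simp add: c algebra_simps)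
      qed
      ultimately show ?thesis unfolding k_def[symmetric] by linarith
    qed
  qed
qed

section \<open>Groups without elements of order two\<close>

primrec multiple :: "nat \<Rightarrow> 'a::ab_group_add \<Rightarrow> 'a" where
  "multiple 0 x = 0"
| "multiple (Suc n) x = x + multiple n x"

lemma multiple_add: "multiple (m + n) x = multiple m x + multiple n x"
  by (induction m) (simp_all add: add.assoc)

lemma multiple_in: "subgrp K \<Longrightarrow> x \<in> K \<Longrightarrow> multiple n x \<in> K"
  by (induction n) (auto intro: subgrp_add subgrp_zero)

lemma group_closure_singleton:
  fixes x :: "'a::{finite,ab_group_add}"
  shows "group_closure {x} = range (\<lambda>n. multiple n x)"
proof
  have "subgrp (range (\<lambda>n. multiple n x))"
  proof (rule subgrp_of_add_closed)
    show "0 \<in> range (\<lambda>n. multiple n x)" by (rule range_eqI[of _ _ 0]) simp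
    show "a + b \<in> range (\<lambda>n. multiple n x)"
      if "a \<in> range (\<lambda>n. multiple n x)" "b \<in> range (\<lambda>n. multiple n x)" for a b
      using that by (auto simp flip: multiple_add)
  qed
  moreover have "x \<in> range (\<lambda>n. multiple n x)" by (rule range_eqI[of _ _ 1]) simp
  ultimately show "group_closure {x} \<subseteq> range (\<lambda>n. multiple n x)"
    by (intro group_closure_least) auto
  have "x \<in> group_closure {x}" using subset_group_closure[of "{x}"] by simp
  then show "range (\<lambda>n. multiple n x) \<subseteq> group_closure {x}"
    using multiple_in[OF subgrp_group_closure] by blast
qed

lemma defect_zero_on_closure:
  fixes B :: "'a::{finite,ab_group_add} set"
  assumes "\<And>x. x \<in> S \<Longrightarrow> shift_defect B x = 0" "c \<in> group_closure S"
  shows "shift_defect B c = 0"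
proof -
  have "subgrp {c. shift_defect B c = 0}"
  proof (rule subgrp_of_add_closed)
    show "a + b \<in> {c. shift_defect B c = 0}" if "a \<in> {c. shift_defect B c = 0}" "b \<in> {c. shift_defect B c = 0}" for a b
      using that shift_defect_add[of B a b] by simp
  qed (simp add: shift_defect_zero)
  then show ?thesis using group_closure_least[of "{c. shift_defect B c = 0}" S] assms by blast
qed

lemma defect_zero_closed:
  fixes B :: "'a::{finite,ab_group_add} set"
  shows "shift_defect B c = 0 \<Longrightarrow> b \<in> B \<Longrightarrow> b + c \<in> B"
  by (auto simp: shift_defect_def)

text \<open>If no removal lost anything, all defects would vanish and the subset sums would fill the
  whole closure. The one extra sum serves in the structured case, where the induction hypothesis may
  come with \<open>xi\<close> equal to 0.\<close>

lemma strict_remove: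
  fixes S :: "'a::{finite,ab_group_add} set"
  assumes S: "good S" "S \<noteq> {}"
  shows "\<exists>x\<in>S. card (subset_sums (S - {x})) < card (subset_sums S)"
proof (rule ccontr)
  assume no: "\<not> ?thesis"
  have "shift_defect (subset_sums S) x = 0" if "x \<in> S" for x
    using no card_subset_sums_remove[OF that] that by fastforce
  then have z: "shift_defect (subset_sums S) c = 0" if "c \<in> group_closure S" for c
    using defect_zero_on_closure that by blast
  have "group_closure S \<subseteq> subset_sums S"
    using defect_zero_closed[OF z zero_in_subset_sums] by auto
  then have "card (group_closure S) \<le> card (subset_sums S)" by (intro card_mono) auto
  moreover have "0 < card (subset_sums S)" using zero_in_subset_sums[of S] by (auto simp: card_gt_0_iff)
  ultimately show False using good_half[OF S] by simp
qed

text \<open>Without elements of order two doubling is injective, hence bijective on the finite set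
  \<open>K\<close>, so the half of \<open>y + y\<close> lies in \<open>K\<close> and is
  \<open>y\<close>.\<close>

lemma halve_in_subgrp:
  fixes K :: "'a::{finite,ab_group_add} set"
  assumes tors: "\<And>x::'a. x + x = 0 \<Longrightarrow> x = 0" and K: "subgrp K" and y: "y + y \<in> K"
  shows "y \<in> K"
proof -
  have cancel: "a = b" if "a + a = b + b" for a b :: 'a
    using tors[of "a - b"] that by (simp add: algebra_simps)
  then have "inj_on (\<lambda>k. k + k) K" by (intro inj_onI)
  then have "card ((\<lambda>k. k + k) ` K) = card K" by (rule card_image)
  moreover have "(\<lambda>k. k + k) ` K \<subseteq> K" using subgrp_add[OF K] by blast
  ultimately have "(\<lambda>k. k + k) ` K = K" by (intro card_subset_eq) auto
  then obtain k where "k \<in> K" "y + y = k + k" using y by blast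
  then show ?thesis using cancel by blast
qed

section \<open>Sets close to arithmetic progressions\<close>

lemma card_Un_shift:
  fixes Q :: "'a::{finite,ab_group_add} set"
  shows "card (Q \<union> (+) x ` Q) = card Q + shift_defect Q x"
proof -
  have "card ((+) x ` Q - Q) = card ((+) x ` {b \<in> Q. b + x \<notin> Q})"
    by (rule arg_cong[of _ _ card]) (auto simp: add.commute)
  also have "\<dots> = shift_defect Q x" by (simp only: card_translate shift_defect_def)
  finally have "card ((+) x ` Q - Q) = shift_defect Q x" .
  moreover have "card (Q \<union> ((+) x ` Q - Q)) = card Q + card ((+) x ` Q - Q)"
    by (intro card_Un_disjoint) auto
  ultimately show ?thesis by simp
qed

text \<open>Greedy representation: the largest term is used as soon as \<open>i\<close> exceeds what
  the smaller terms can reach.\<close>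

lemma subset_sums_progression:
  fixes x :: "'a::{finite,ab_group_add}"
  assumes "inj_on (\<lambda>i. multiple i x) {..k}" "2 * i \<le> k * (k + 1)"
  shows "multiple i x \<in> subset_sums ((\<lambda>j. multiple j x) ` {1..k})"
  using assms
proof (induction k arbitrary: i)
  case 0
  then show ?case by (simp add: zero_in_subset_sums)
next
  case (Suc k)
  let ?T = "(\<lambda>j. multiple j x) ` {1..k}"
  have inj: "inj_on (\<lambda>i. multiple i x) {..k}" using Suc.prems(1) by (rule inj_on_subset) auto
  have "multiple (Suc k) x \<notin> ?T"
  proof
    assume "multiple (Suc k) x \<in> ?T"
    then obtain j where "j \<in> {1..k}" "multiple (Suc k) x = multiple j x" by auto
    then show False using inj_onD[OF Suc.prems(1), of "Suc k" j] by auto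
  qed
  moreover have "(\<lambda>j. multiple j x) ` {1..Suc k} = insert (multiple (Suc k) x) ?T"
    by (simp add: atLeastAtMostSuc_conv del: multiple.simps)
  ultimately have eq: "subset_sums ((\<lambda>j. multiple j x) ` {1..Suc k})
      = subset_sums ?T \<union> (+) (multiple (Suc k) x) ` subset_sums ?T"
    using subset_sums_insert by metis
  show ?case
  proof (cases "2 * i \<le> k * (k + 1)")
    case True
    then show ?thesis using Suc.IH[OF inj] eq by blast
  next
    case False
    have "k * 2 \<le> k * (k + 1)" by (cases k) simp_all
    then have "Suc k \<le> i" using False by linarith
    then obtain l where l: "i = Suc k + l" by (metis le_Suc_ex)
    have "2 * l \<le> k * (k + 1)" using Suc.prems(2) l by (simp add: algebra_simps)
    then have "multiple l x \<in> subset_sums ?T" by (rule Suc.IH[OF inj])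
    then have "multiple (Suc k) x + multiple l x \<in> (+) (multiple (Suc k) x) ` subset_sums ?T" by blast
    then show ?thesis using eq unfolding l multiple_add by blast
  qed
qed

text \<open>If two of the multiples coincide, some positive \<open>d \<le> m\<close> has
  \<open>multiple d x = 0\<close>, and the multiples below \<open>d\<close>, all in
  \<open>B\<close>, are the whole subgroup.\<close>

lemma card_multiples_le:
  fixes x :: "'a::{finite,ab_group_add}"
  assumes "\<And>i. i \<le> m \<Longrightarrow> multiple i x \<in> B"
  shows "m + 1 \<le> card B \<or> group_closure {x} \<subseteq> B"
proof (cases "inj_on (\<lambda>i. multiple i x) {..m}")
  case True
  have "card ((\<lambda>i. multiple i x) ` {..m}) \<le> card B" using assms by (intro card_mono) auto
  then show ?thesis using card_image[OF True] by simp
next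
  case False
  then obtain i j where "i < j" "j \<le> m" "multiple i x = multiple j x"
    unfolding inj_on_def by (metis atMost_iff linorder_neqE_nat)
  then obtain d where d: "0 < d" "d \<le> m" "multiple d x = 0"
    using multiple_add[of i "j - i" x] by (intro that[of "j - i"]) auto
  have "multiple i x \<in> B" for i
  proof (induction i rule: less_induct)
    case (less i)
    show ?case
    proof (cases "i < d")
      case False
      then have "multiple i x = multiple (i - d) x" using multiple_add[of d "i - d" x] d by simp
      then show ?thesis using less[of "i - d"] d False by simp
    qed (use assms d in simp)
  qed
  then show ?thesis by (auto simp: group_closure_singleton)
qed

text \<open>In steps of \<open>x\<close>, \<open>Q\<close> can be left only at \<open>y\<close>. So
  the multiples of \<open>x\<close> stay in \<open>Q\<close> up to \<open>N x = y\<close>, by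
  symmetry \<open>Q\<close> is the progression from \<open>- N x\<close> to \<open>N x\<close>, and
  up to signs \<open>S\<close> is \<open>x, 2 x, ..., N x\<close>. Its subset sums contain all
  multiples up to \<open>N (N + 1) / 2\<close>.\<close>

lemma progression_bound:
  fixes S :: "'a::{finite,ab_group_add} set"
  assumes S: "good S" "S \<noteq> {}" and exit: "\<And>q. q \<in> sym_gens S \<Longrightarrow> q + x \<notin> sym_gens S \<Longrightarrow> q = y"
    and H: "group_closure {x} = group_closure S" and QH: "sym_gens S \<noteq> group_closure S"
  shows "card S * (card S + 1) + 2 \<le> 2 * card (subset_sums S)"
proof -
  define Q where "Q = sym_gens S"
  let ?m = "\<lambda>i. multiple i x"
  have sym: "- v \<in> Q \<longleftrightarrow> v \<in> Q" for v unfolding Q_def by (rule symm_minus_iff[OF symm_sym_gens])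
  have Q0: "0 \<in> Q" unfolding Q_def by (rule zero_in_sym_gens)
  have QsubH: "Q \<subseteq> group_closure {x}" unfolding Q_def H
    by (intro sym_gens_subset subgrp_group_closure subset_group_closure)
  then obtain v where "v \<in> group_closure {x}" "v \<notin> Q" using QH H unfolding Q_def by blast
  then obtain n0 where n0: "?m n0 \<notin> Q" by (auto simp: group_closure_singleton)
  define N where "N = (LEAST n. ?m n \<notin> Q) - 1"
  have least: "?m (LEAST n. ?m n \<notin> Q) \<notin> Q" using n0 by (rule LeastI)
  then have "(LEAST n. ?m n \<notin> Q) \<noteq> 0" using Q0 by (metis multiple.simps(1))
  then have Suc_N: "(LEAST n. ?m n \<notin> Q) = Suc N" by (simp add: N_def)
  have out: "?m (Suc N) \<notin> Q" using least unfolding Suc_N .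
  have mQ: "?m i \<in> Q" if "i \<le> N" for i
    using not_less_Least[of i "\<lambda>n. ?m n \<notin> Q"] that unfolding Suc_N by auto
  have Q_exit: "q = y" if "q \<in> Q" "q + x \<notin> Q" for q using exit that by (simp only: Q_def)
  have y: "?m N = y" using Q_exit[OF mQ[OF order_refl]] out by (simp add: add.commute)
  have nz: "?m d \<noteq> 0" if "1 \<le> d" "d \<le> 2 * N" for d
  proof
    assume d: "?m d = 0"
    show False
    proof (cases "d \<le> Suc N")
      case True
      then have "?m (Suc N) = ?m (Suc N - d)" using multiple_add[of d "Suc N - d" x] d by (simp del: multiple.simps)
      then show False using out mQ[of "Suc N - d"] that by simp
    next
      case False
      then have "?m (Suc N) + ?m (d - Suc N) = 0" using multiple_add[of "Suc N" "d - Suc N" x] d by (simp del: multiple.simps)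
      then have "?m (Suc N) = - ?m (d - Suc N)" by (simp only: eq_neg_iff_add_eq_0)
      moreover have "?m (d - Suc N) \<in> Q" using that by (intro mQ) simp
      ultimately show False using out sym by simp
    qed
  qed
  have inj: "inj_on ?m {..N}"
  proof (rule ccontr)
    assume "\<not> ?thesis"
    then obtain i j where "i < j" "j \<le> N" "?m i = ?m j"
      unfolding inj_on_def by (metis atMost_iff linorder_neqE_nat)
    then show False using multiple_add[of i "j - i" x] nz[of "j - i"] by simp
  qed
  define T where "T = ?m ` {1..N}"
  have T0: "0 \<notin> T" using nz by (auto simp: T_def)
  have Tanti: "T \<inter> uminus ` T = {}"
  proof -
    have "?m i \<noteq> - ?m j" if "i \<in> {1..N}" "j \<in> {1..N}" for i j
    proof
      assume "?m i = - ?m j"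
      then have "?m (i + j) = 0" unfolding multiple_add by simp
      then show False using nz[of "i + j"] that by simp
    qed
    then show ?thesis unfolding T_def by blast
  qed
  \<comment> \<open>From \<open>q\<close> the steps stay in \<open>Q\<close> until \<open>y\<close>
    is reached. With more than \<open>2 N\<close> steps the walk would pass through
    \<open>y - (2 N + 1) x = - (N + 1) x\<close>, which is not in \<open>Q\<close>.\<close>
  have walk: "\<exists>n \<le> 2 * N. q = y - ?m n" if q: "q \<in> Q" for q
  proof -
    have "y - q \<in> group_closure {x}"
      using q QsubH mQ[of N] unfolding y by (intro subgrp_diff[OF subgrp_group_closure]) auto
    then have ex: "\<exists>n. y - q = ?m n" by (auto simp: group_closure_singleton)
    define n where "n = (LEAST n. y - q = ?m n)"
    have n: "y - q = ?m n" unfolding n_def using ex by (rule LeastI_ex)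
    have inQ: "q + ?m i \<in> Q" if "i \<le> n" for i
      using that
    proof (induction i)
      case (Suc i)
      have "q + ?m i \<noteq> y" using not_less_Least[of i "\<lambda>n. y - q = ?m n"] Suc.prems
        by (auto simp: n_def[symmetric])
      then have "q + ?m i + x \<in> Q" using Suc Q_exit[of "q + ?m i"] by auto
      then show ?case by (simp add: ac_simps)
    qed (use q in simp)
    have "n \<le> 2 * N"
    proof (rule ccontr)
      assume "\<not> n \<le> 2 * N"
      then have i: "n = (n - Suc (2 * N)) + (Suc N + N)" by simp
      have "y - q = ?m (n - Suc (2 * N)) + (?m (Suc N) + ?m N)"
        unfolding n by (subst i) (simp only: multiple_add)
      then have "q + ?m (n - Suc (2 * N)) = - ?m (Suc N)" unfolding y by (simp add: algebra_simps eq_neg_iff_add_eq_0)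
      then show False using inQ[of "n - Suc (2 * N)"] out sym[of "?m (Suc N)"] by (simp del: multiple.simps)
    qed
    moreover have "q = y - ?m n" using n by (simp add: algebra_simps)
    ultimately show ?thesis by blast
  qed
  have "Q - {0} = T \<union> uminus ` T"
  proof (intro equalityI subsetI)
    fix q assume q: "q \<in> Q - {0}"
    then obtain n where n: "n \<le> 2 * N" "q = y - ?m n" using walk by blast
    show "q \<in> T \<union> uminus ` T"
    proof (cases "n \<le> N")
      case True
      then have "q = ?m (N - n)" using multiple_add[of n "N - n" x] n y by simp
      moreover from this have "N - n \<noteq> 0" using q by (metis DiffD2 multiple.simps(1) singletonI)
      ultimately show ?thesis unfolding T_def by auto
    next
      case False
      then have "q = - ?m (n - N)" using multiple_add[of N "n - N" x] n y by simp
      moreover have "?m (n - N) \<in> T" unfolding T_def using False n(1) by (intro imageI) auto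
      ultimately show ?thesis by blast
    qed
  next
    fix q assume q: "q \<in> T \<union> uminus ` T"
    then have "q \<in> Q" using mQ sym by (auto simp: T_def)
    then show "q \<in> Q - {0}" using q T0 by auto
  qed
  moreover have "Q - {0} = S \<union> uminus ` S"
  proof -
    have "0 \<notin> S" using good_minus[OF S(1), of 0] by auto
    then show ?thesis by (auto simp: Q_def sym_gens_def)
  qed
  ultimately have c: "card S = card T" "card (subset_sums S) = card (subset_sums T)"
    using antisymmetric_same_span[OF good_antisym[OF S(1)] Tanti] by simp_all
  have "card T = N" unfolding T_def using inj_on_subset[OF inj, of "{1..N}"] by (subst card_image) auto
  moreover have "even (N * (N + 1))" by simp
  then obtain m where m: "N * (N + 1) = 2 * m" by (rule evenE)
  have "?m i \<in> subset_sums T" if "i \<le> m" for i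
    unfolding T_def by (rule subset_sums_progression[OF inj]) (use that m in simp)
  then have "m + 1 \<le> card (subset_sums T) \<or> group_closure {x} \<subseteq> subset_sums T"
    by (rule card_multiples_le)
  moreover have "\<not> group_closure {x} \<subseteq> subset_sums T"
  proof
    assume "group_closure {x} \<subseteq> subset_sums T"
    then have "card (group_closure S) \<le> card (subset_sums T)" unfolding H by (intro card_mono) auto
    moreover have "0 < card (group_closure S)" by (metis card_gt_0_iff empty_iff finite zero_in_group_closure)
    ultimately show False using good_half[OF S] c by linarith
  qed
  ultimately show ?thesis using m c by simp
qed

context
  fixes S :: "'a::{finite,ab_group_add} set"
  assumes tors: "\<And>x::'a. x + x = 0 \<Longrightarrow> x = 0" and S: "good S"
begin

text \<open>If \<open>Q\<close> gains at most one element under translation by \<open>x\<close>, then \<open>Q\<close> is a progression with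
  difference \<open>x\<close> up to full cosets of the subgroup \<open>L\<close> generated by \<open>x\<close>.\<close>

lemma near_period_bound:
  assumes k: "2 \<le> card S" and x: "x \<in> group_closure S" "x \<noteq> 0"
    and near: "card (sym_gens S \<union> (+) x ` sym_gens S) \<le> card (sym_gens S) + 1"
    and QH: "sym_gens S \<noteq> group_closure S"
    and nostruct: "\<And>K. subgrp K \<Longrightarrow> K \<subseteq> group_closure S \<Longrightarrow> K \<noteq> {0} \<Longrightarrow> K + sym_gens S \<noteq> group_closure S \<Longrightarrow>
      card K + card (sym_gens S) \<le> card (K + sym_gens S)"
  shows "card S * (card S + 1) + 2 \<le> 2 * card (subset_sums S)"
proof -
  define Q where "Q = sym_gens S"
  define H where "H = group_closure S"
  define L where "L = group_closure {x}"
  have H: "subgrp H" and L: "subgrp L" by (simp_all add: H_def L_def subgrp_group_closure)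
  have Sne: "S \<noteq> {}" using k by auto
  have xL: "x \<in> L" unfolding L_def using subset_group_closure[of "{x}"] by simp
  have LH: "L \<subseteq> H" unfolding L_def H_def using x by (intro group_closure_least subgrp_group_closure) auto
  have L0: "L \<noteq> {0}" using xL x by auto
  have QsubH: "Q \<subseteq> H" unfolding Q_def H_def
    by (intro sym_gens_subset subgrp_group_closure subset_group_closure)
  have Q0: "0 \<in> Q" unfolding Q_def by (rule zero_in_sym_gens)
  have sym: "- v \<in> Q \<longleftrightarrow> v \<in> Q" for v unfolding Q_def by (rule symm_minus_iff[OF symm_sym_gens])
  have defect: "shift_defect Q x \<le> 1" using near unfolding card_Un_shift Q_def by simp
  have struct: "L + Q = H" if "card (L + Q) < card L + card Q"
    using nostruct[OF L LH[unfolded H_def] L0] that unfolding Q_def H_def by force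
  have QL: "Q \<subseteq> L + Q" using subset_set_plus[OF subgrp_zero[OF L], of Q] by (simp add: add.commute)
  have Lpos: "0 < card L" using xL by (auto simp: card_gt_0_iff)
  have "shift_defect Q x \<noteq> 0"
  proof
    assume "shift_defect Q x = 0"
    then have zero: "shift_defect Q c = 0" if "c \<in> L" for c
      using defect_zero_on_closure[of "{x}" Q c] that by (simp add: L_def)
    have "L + Q \<subseteq> Q"
    proof
      fix v assume "v \<in> L + Q"
      then obtain l q where lq: "l \<in> L" "q \<in> Q" "v = l + q" unfolding set_plus_iff by blast
      then show "v \<in> Q" using defect_zero_closed[OF zero[OF lq(1)] lq(2)] by (simp add: add.commute)
    qed
    then have "L + Q = Q" using QL by blast
    then show False using struct Lpos QH unfolding Q_def H_def by simp
  qed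
  then have "shift_defect Q x = 1" using defect by linarith
  then have "card {b \<in> Q. b + x \<notin> Q} = 1" by (simp only: shift_defect_def)
  then obtain y where y: "{b \<in> Q. b + x \<notin> Q} = {y}" by (auto simp: card_1_singleton_iff)
  have yQ: "y \<in> Q" and exit: "\<And>q. q \<in> Q \<Longrightarrow> q + x \<notin> Q \<Longrightarrow> q = y" using y by blast+
  have stay: "q + l \<in> Q" if q: "q \<in> Q" "y - q \<notin> L" and l: "l \<in> L" for q l
  proof -
    obtain n where n: "l = multiple n x" using l by (auto simp: L_def group_closure_singleton)
    have "q + multiple n x \<in> Q" for n
    proof (induction n)
      case (Suc n)
      have "q + multiple n x \<noteq> y"
      proof
        assume "q + multiple n x = y"
        then have "y - q = multiple n x" by (simp add: algebra_simps)
        then show False using q(2) multiple_in[OF L xL] by simp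
      qed
      then have "(q + multiple n x) + x \<in> Q" using Suc.IH exit by blast
      moreover have "(q + multiple n x) + x = q + multiple (Suc n) x" by (simp add: ac_simps)
      ultimately show ?case by (simp only:)
    qed (use q in simp)
    then show ?thesis using n by simp
  qed
  have LQ: "L + Q \<subseteq> Q \<union> (+) y ` L"
  proof
    fix v assume "v \<in> L + Q"
    then obtain l q where lq: "l \<in> L" "q \<in> Q" "v = l + q" unfolding set_plus_iff by blast
    show "v \<in> Q \<union> (+) y ` L"
    proof (cases "y - q \<in> L")
      case True
      have "l - (y - q) \<in> L" by (rule subgrp_diff[OF L lq(1) True])
      moreover have "v = y + (l - (y - q))" using lq by simp
      ultimately show ?thesis by blast
    next
      case False
      then show ?thesis using stay[OF lq(2) False lq(1)] lq(3) by (simp add: add.commute)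
    qed
  qed
  have yL: "y \<in> (+) y ` L" using subgrp_zero[OF L] by (intro image_eqI[of _ _ 0]) auto
  have "card (L + Q) \<le> card (Q \<union> ((+) y ` L - {y}))"
    using LQ yQ by (intro card_mono) auto
  also have "\<dots> \<le> card Q + card ((+) y ` L - {y})" by (rule card_Un_le)
  also have "card ((+) y ` L - {y}) = card L - 1" using yL by (simp add: card_translate)
  finally have LQH: "L + Q = H" using Lpos by (intro struct) simp
  obtain v where v: "v \<in> H" "v \<notin> Q" using QsubH QH unfolding Q_def H_def by blast
  have inL: "w - y \<in> L" if "w \<in> H" "w \<notin> Q" for w
  proof -
    have "w \<in> (+) y ` L" using that LQ LQH by blast
    then show ?thesis by auto
  qed
  \<comment> \<open>All of \<open>H\<close> outside \<open>Q\<close> lies in \<open>y + L\<close>,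
    and this complement is symmetric; comparing \<open>v\<close> with \<open>- v\<close> gives
    \<open>2 y \<in> L\<close>.\<close>
  have "(v - y) + (- v - y) \<in> L"
    using inL[OF v] inL[of "- v"] v sym[of v] subgrp_minus[OF H] by (intro subgrp_add[OF L]) auto
  then have "- (y + y) \<in> L" by (simp add: algebra_simps)
  then have "y + y \<in> L" by (simp only: subgrp_minus_iff[OF L])
  then have "y \<in> L" using halve_in_subgrp[of L y] tors L by blast
  then have inL': "w \<in> L" if "w \<in> H" "w \<notin> Q" for w using subgrp_add[OF L inL[OF that], of y] by simp
  have half: "2 * card (subset_sums S) \<le> card H" unfolding H_def by (rule good_half[OF S Sne])
  show ?thesis
  proof (cases "L = H")
    case True
    show ?thesis
      by (rule progression_bound[OF S Sne, of x y]) (use exit True QH in \<open>simp_all add: Q_def L_def H_def\<close>)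
  next
    case False
    \<comment> \<open>A proper \<open>L\<close> has odd index, at least 3. As everything of
      \<open>H\<close> outside \<open>Q\<close> lies in \<open>L\<close>, \<open>Q\<close> fills at
      least two thirds of \<open>H\<close>, which contradicts \<open>general_bound\<close> and
      \<open>half\<close>.\<close>
    have "card L dvd card H"
    proof (rule card_subgrp_dvd_periodic[OF L])
      have "H + L \<subseteq> H" by (intro set_plus_subset_subgrp[OF H] LH) simp
      then show "H + L = H" using subset_set_plus[OF subgrp_zero[OF L], of H] by blast
    qed simp
    then obtain d where d: "card H = card L * d" by (rule dvdE)
    have "card L < card H" using False LH by (intro psubset_card_mono) auto
    moreover have "odd (card H)"
      by (rule odd_card_symm[OF tors]) (simp_all add: symm_subgrp[OF H] subgrp_zero[OF H])
    ultimately have "d \<noteq> 0 \<and> d \<noteq> 1 \<and> d \<noteq> 2" using d by auto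
    then have "3 \<le> d" by linarith
    then have "card L * 3 \<le> card H" unfolding d by (rule mult_le_mono2)
    moreover have "H \<subseteq> Q \<union> L" using inL' by blast
    then have "card H \<le> card Q + card L" using card_mono[of "Q \<union> L" H] card_Un_le[of Q L] by simp
    ultimately have "2 * card H \<le> 3 * card Q" by linarith
    then have "2 * (2 * card (subset_sums S)) \<le> 3 * (2 * card S + 1)"
      using half card_sym_gens[OF S] by (simp add: Q_def)
    moreover have "card S * (card S - 1) + 6 \<le> 2 * card (subset_sums S)" by (rule general_bound[OF S k])
    moreover obtain j where "card S = j + 2" using k by (metis add.commute le_Suc_ex)
    ultimately have False by (simp add: algebra_simps)
    then show ?thesis ..
  qed
qed

text \<open>The sumsets of \<open>Q\<close> are symmetric and contain 0, so their orders are odd.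
  Growth by exactly \<open>2 k + 1\<close> is therefore impossible, and so is a sumset missing just
  one element of \<open>H\<close>, the situation that Vosper's dichotomy leaves open.\<close>

lemma unstructured_odd_bound:
  assumes k: "3 \<le> card S"
    and QH: "sym_gens S \<noteq> group_closure S"
    and nostruct: "\<And>K. subgrp K \<Longrightarrow> K \<subseteq> group_closure S \<Longrightarrow> K \<noteq> {0} \<Longrightarrow> K + sym_gens S \<noteq> group_closure S \<Longrightarrow>
      card K + card (sym_gens S) \<le> card (K + sym_gens S)"
    and IH: "\<And>x. x \<in> S \<Longrightarrow> card S * (card S - 1) + 2 * xi (S - {x}) \<le> 2 * card (subset_sums (S - {x}))"
  shows "card S * (card S + 1) + 2 * xi S \<le> 2 * card (subset_sums S)"
proof (rule ccontr)
  assume no: "\<not> ?thesis"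
  define k where "k = card S"
  define Q where "Q = sym_gens S"
  define H where "H = group_closure S"
  define B where "B = subset_sums S"
  define b where "b = card B"
  have H: "subgrp H" by (simp add: H_def subgrp_group_closure)
  have Sne: "S \<noteq> {}" using k by auto
  have xi1: "xi T \<le> 1" for T :: "'a set" by (simp add: xi_def)
  have half: "2 * b \<le> card H" unfolding H_def b_def B_def by (rule good_half[OF S Sne])
  have QsubH: "Q \<subseteq> H" unfolding Q_def H_def
    by (intro sym_gens_subset subgrp_group_closure subset_group_closure)
  have Q0: "0 \<in> Q" unfolding Q_def by (rule zero_in_sym_gens)
  have Qs: "symm Q" unfolding Q_def by (rule symm_sym_gens)
  have cQ: "card Q = 2 * k + 1" using card_sym_gens[OF S] by (simp add: Q_def k_def)
  have lt: "2 * b < k * (k + 1) + 2 * xi S" using no by (simp add: b_def B_def k_def)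
  have oddsym: "odd (card X)" if "symm X" "0 \<in> X" for X :: "'a set"
    by (rule odd_card_symm[OF tors]) (simp_all add: that)
  have step: "card (X + Q) = card H \<or> card X + (2 * k + 2) \<le> card (X + Q)"
    if X: "X \<subseteq> H" "symm X" "0 \<in> X" "2 \<le> card X" for X
  proof -
    have XQ: "X + Q \<subseteq> H" by (rule set_plus_subset_subgrp[OF H X(1) QsubH])
    have o: "odd (card X)" "odd (card (X + Q))" "odd (card H)"
      using oddsym[OF X(2,3)] oddsym[OF symm_set_plus[OF X(2) Qs]] set_plus_memI[OF X(3) Q0]
        oddsym[OF symm_subgrp[OF H] subgrp_zero[OF H]] by auto
    show ?thesis
    proof (cases "2 + card (X + Q) \<le> card H")
      case True
      have "\<not> card (X + Q) + 1 \<le> card X + card Q"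
      proof
        assume small: "card (X + Q) + 1 \<le> card X + card Q"
        show False
        proof (rule vosper_symmetric[OF H QsubH Qs Q0 X(1,4) True small])
          fix x assume x: "x \<in> H" "x \<noteq> 0" "card (Q \<union> (+) x ` Q) \<le> card Q + 1"
          have "k * (k + 1) + 2 \<le> 2 * b" unfolding k_def b_def B_def
          proof (rule near_period_bound[of x])
            show "card K + card (sym_gens S) \<le> card (K + sym_gens S)"
              if "subgrp K" "K \<subseteq> group_closure S" "K \<noteq> {0}" "K + sym_gens S \<noteq> group_closure S" for K
              using nostruct that by blast
          qed (use k x QH in \<open>simp_all add: H_def Q_def\<close>)
          then show False using lt xi1[of S] by linarith
        next
          fix K assume K: "subgrp K" "K \<subseteq> H" "K \<noteq> {0}" "K + Q \<noteq> H" "card (K + Q) + 1 \<le> card K + card Q"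
          then have "card K + card Q \<le> card (K + Q)" using nostruct[of K] by (simp add: H_def Q_def)
          then show False using K(5) by linarith
        qed
      qed
      then have ge: "card X + (2 * k + 1) \<le> card (X + Q)" using cQ by linarith
      moreover have "card X + (2 * k + 1) \<noteq> card (X + Q)" using o by (metis even_add even_mult_iff odd_one even_two_times_div_two dvd_triv_left)
      ultimately show ?thesis by linarith
    next
      case False
      have "card (X + Q) \<le> card H" using XQ by (intro card_mono) auto
      then have "card (X + Q) = card H \<or> card H = card (X + Q) + 1" using False by linarith
      then show ?thesis using o by auto
    qed
  qed
  let ?C = "iter_plus {0} Q"
  have CH: "?C j \<subseteq> H" for j using subgrp_zero[OF H] by (intro iter_plus_subset[OF H _ QsubH]) simp
  have Cs: "symm (?C j)" for j by (rule iter_plus_symm[OF _ Qs]) (simp add: symm_def)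
  have C0: "0 \<in> ?C j" for j by (induction j) (use set_plus_memI[OF _ Q0] in force)+
  have C1: "?C 1 = Q" by (auto simp: set_plus_iff)
  have Cmono: "card (?C j) \<le> card (?C (Suc j))" for j by (intro card_mono iter_plus_incr[OF Q0]) simp
  have size: "min (card H) ((2 * k + 2) * j) \<le> card (?C j) + 1 \<and> (card (?C j) = card H \<or> (2 * k + 2) * j \<le> card (?C j) + 1)"
    if "1 \<le> j" for j
    using that
  proof (induction j rule: nat_induct_at_least)
    case base
    then show ?case using C1 cQ by simp
  next
    case (Suc j)
    have "?C 1 \<subseteq> ?C j" by (rule lift_Suc_mono_le[of ?C, OF iter_plus_incr[OF Q0] Suc.hyps])
    then have "card (?C 1) \<le> card (?C j)" by (intro card_mono) auto
    then have "2 \<le> card (?C j)" using C1 cQ k by (simp add: k_def)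
    then have "card (?C j + Q) = card H \<or> card (?C j) + (2 * k + 2) \<le> card (?C j + Q)"
      by (intro step CH Cs C0)
    moreover have "card (?C (Suc j)) \<le> card H" by (rule card_mono[OF finite CH])
    ultimately show ?case using Suc.IH Cmono[of j] by (auto simp: algebra_simps)
  qed
  have "even (k * (k - 1))" by (cases "even k") auto
  then obtain p where p: "k * (k - 1) = 2 * p" by (rule evenE)
  have p': "k * (k + 1) = 2 * p + 2 * k"
  proof -
    obtain j where "k = j + 1" using k by (metis k_def add.commute le_Suc_ex le_trans one_le_numeral)
    then show ?thesis using p by (simp add: algebra_simps)
  qed
  define d where "d x = card (subset_sums (S - {x}))" for x
  have d: "d x + shift_defect B x \<le> b" "p + xi (S - {x}) \<le> d x" if "x \<in> S" for x
    using card_subset_sums_remove[OF that] IH[OF that] p by (simp_all add: d_def b_def B_def k_def)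
  obtain x0 where x0: "x0 \<in> S" using Sne by auto
  have bound: "b \<le> p + k" using lt p' xi1[of S] by linarith
  have cS: "card (S - {x}) = k - 1" if "x \<in> S" for x using that by (simp add: k_def)
  have k3: "3 \<le> k" using k by (simp add: k_def)
  \<comment> \<open>By induction \<open>S - {x}\<close> has at least \<open>p + xi (S - {x})\<close>
    subset sums. For odd \<open>k\<close> this \<open>xi\<close> is 1. For even \<open>k\<close> it
    may vanish, which matters only if \<open>b = p + k\<close>, where the defect \<open>k\<close>
    has to be excluded.\<close>
  have "\<exists>m. (\<forall>x\<in>S. shift_defect B x \<le> m) \<and>
    (even k \<and> (b = p + m \<and> m \<le> k - 1 \<or> b = p + k \<and> m = k - 1) \<or>
      odd k \<and> b = p + 1 + m \<and> (m \<le> k - 2 \<or> m = k - 1 \<and> 2 * k\<^sup>2 + 3 * k \<le> 2 * card H + 5))"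
  proof (cases "even k")
    case True
    show ?thesis
    proof (cases "b = p + k")
      case top: True
      \<comment> \<open>Otherwise \<open>S - {x}\<close> spans a small subgroup. Either that
        contains \<open>x\<close>, and \<open>H\<close> is too small for \<open>2 * b\<close>, or
        \<open>b = 2 * p\<close>, which forces \<open>k = 3\<close>.\<close>
      have "p + 1 \<le> d x" if x: "x \<in> S" for x
      proof (rule ccontr)
        assume "\<not> p + 1 \<le> d x"
        then have dx: "d x = p" "xi (S - {x}) = 0" using d(2)[OF x] by linarith+
        have "\<not> 2 * card (S - {x}) ^ 2 + 3 * card (S - {x}) \<le> 2 * card (group_closure (S - {x})) + 5"
          using dx(2) cS[OF x] True k3 by (auto simp: xi_def split: if_splits)
        then have small: "2 * card (group_closure (S - {x})) + 5 < 2 * ((k - 1) * (k - 1)) + 3 * (k - 1)"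
          using cS[OF x] by (simp add: power2_eq_square)
        obtain j where j: "k = j + 1" using k3 by (metis add.commute le_Suc_ex le_trans one_le_numeral)
        show False
        proof (cases "x \<in> group_closure (S - {x})")
          case True
          have "S \<subseteq> group_closure (S - {x})" using True subset_group_closure[of "S - {x}"] by blast
          then have "H \<subseteq> group_closure (S - {x})" unfolding H_def
            by (rule group_closure_least[OF subgrp_group_closure])
          then have "card H \<le> card (group_closure (S - {x}))" by (intro card_mono) auto
          then have "2 * p + 2 * k \<le> card (group_closure (S - {x}))" using half top by linarith
          moreover have "2 * card (group_closure (S - {x})) + 5 < 2 * (j * j) + 3 * j" using small by (simp add: j)
          moreover have "j * j + j = 2 * p" using p by (simp add: j)
          ultimately show False by (simp add: j)
        next
          case False
          let ?A = "subset_sums (S - {x})"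
          have "?A \<inter> (+) x ` ?A = {}"
          proof (rule ccontr)
            assume "?A \<inter> (+) x ` ?A \<noteq> {}"
            then obtain u v where uv: "u \<in> ?A" "v \<in> ?A" "u = x + v" by blast
            have "u - v \<in> group_closure (S - {x})"
              using uv(1,2) subset_sums_subset_closure[of "S - {x}"] by (intro subgrp_diff[OF subgrp_group_closure]) auto
            then show False using False uv(3) by simp
          qed
          then have "card (?A \<union> (+) x ` ?A) = card ?A + card ((+) x ` ?A)" by (intro card_Un_disjoint) auto
          then have "b = 2 * d x"
            using subset_sums_insert[of x "S - {x}"] x by (simp add: insert_absorb b_def B_def d_def card_translate)
          then have "p = k" using top dx by simp
          then have "k * (k - 1) = k * 2" using p by linarith
          then have "k = 3" using k3 by simp
          then show False using True by simp
        qed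
      qed
      then have "\<forall>x\<in>S. shift_defect B x \<le> k - 1" using d(1) top k3 by fastforce
      then show ?thesis using True top by blast
    next
      case False
      have "p \<le> b" using d[OF x0] by linarith
      then have "b = p + (b - p)" "b - p \<le> k - 1" using bound False by simp_all
      moreover have "\<forall>x\<in>S. shift_defect B x \<le> b - p" using d by fastforce
      ultimately show ?thesis using True by blast
    qed
  next
    case False
    have xix: "xi (S - {x}) = 1" if "x \<in> S" for x using False cS[OF that] by (simp add: xi_def)
    define m where "m = b - (p + 1)"
    have bm: "b = p + 1 + m" using d[OF x0] xix[OF x0] by (simp add: m_def)
    moreover have "\<forall>x\<in>S. shift_defect B x \<le> m"
    proof
      fix x assume x: "x \<in> S"
      show "shift_defect B x \<le> m" using d[OF x] xix[OF x] bm by linarith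
    qed
    moreover have "m \<le> k - 2 \<or> m = k - 1 \<and> 2 * k\<^sup>2 + 3 * k \<le> 2 * card H + 5"
    proof (cases "xi S = 1")
      case True
      then have "2 * k\<^sup>2 + 3 * k \<le> 2 * card H + 5"
        using False by (auto simp: xi_def k_def H_def split: if_splits)
      then show ?thesis using bound bm by linarith
    next
      case xi: False
      then have "xi S = 0" using xi1[of S] by linarith
      then show ?thesis using lt p' bm by linarith
    qed
    ultimately show ?thesis using False by blast
  qed
  then obtain m where m: "\<And>x. x \<in> S \<Longrightarrow> shift_defect B x \<le> m" and cases:
    "even k \<and> (b = p + m \<and> m \<le> k - 1 \<or> b = p + k \<and> m = k - 1) \<or>
      odd k \<and> b = p + 1 + m \<and> (m \<le> k - 2 \<or> m = k - 1 \<and> 2 * k\<^sup>2 + 3 * k \<le> 2 * card H + 5)"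
    by blast
  define g where "g j = min (int (card H)) (if j = 0 then 1 else (2 * int k + 2) * int j - 1)" for j
  have "\<exists>q. int m * int q \<le> int b \<and> (int b)\<^sup>2 < int m * (\<Sum>j<q. g j) + (int b - int m * int q) * g q"
    unfolding g_def
  proof (rule odd_layers)
    have "int (k * (k - 1)) = 2 * int p" "int (k * (k + 1)) = 2 * int p + 2 * int k" unfolding p p' by simp_all
    then have ip: "int k * (int k - 1) = 2 * int p" "int k * (int k + 1) = 2 * int p + 2 * int k"
      using k3 by (simp_all add: of_nat_diff algebra_simps)
    have ic: "2 * (int k)\<^sup>2 + 3 * int k \<le> 2 * int (card H) + 5" if "2 * k\<^sup>2 + 3 * k \<le> 2 * card H + 5"
    proof -
      have "int (2 * k\<^sup>2 + 3 * k) \<le> int (2 * card H + 5)" using that by (simp only: of_nat_le_iff)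
      then show ?thesis by simp
    qed
    have i: "m \<le> k - 1 \<Longrightarrow> int m \<le> int k - 1" "m \<le> k - 2 \<Longrightarrow> int m \<le> int k - 2"
      "m = k - 1 \<Longrightarrow> int m = int k - 1" using k3 by linarith+
    from cases show "even (int k) \<and> (2 * int b = int k * (int k - 1) + 2 * int m \<and> int m \<le> int k - 1 \<or>
        2 * int b = int k * (int k + 1) \<and> int m = int k - 1) \<or>
      odd (int k) \<and> 2 * int b = int k * (int k - 1) + 2 + 2 * int m \<and>
        (int m \<le> int k - 2 \<or> int m = int k - 1 \<and> 2 * (int k)\<^sup>2 + 3 * int k \<le> 2 * int (card H) + 5)"
      unfolding ip using ic i by (elim disjE conjE) auto
  qed (use k half in \<open>simp_all add: k_def\<close>)
  then obtain q where q: "int m * int q \<le> int b"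
    "(int b)\<^sup>2 < int m * (\<Sum>j<q. g j) + (int b - int m * int q) * g q" by blast
  have "int m * (\<Sum>j<q. g j) + (int b - int m * int q) * g q \<le> (int b)\<^sup>2"
    unfolding b_def
  proof (rule layer_bound_sym_gens[of S, folded Q_def])
    show "shift_defect B x \<le> m" if "x \<in> S" for x by (rule m[OF that])
    show "g j \<le> int (card (?C j))" for j
    proof (cases "j = 0")
      case False
      then have "card (?C j) = card H \<or> (2 * k + 2) * j \<le> card (?C j) + 1" using size[of j] by simp
      then have "card (?C j) = card H \<or> int ((2 * k + 2) * j) \<le> int (card (?C j) + 1)"
        by (simp only: of_nat_le_iff)
      then have "int (card H) \<le> int (card (?C j)) \<or> (2 * int k + 2) * int j - 1 \<le> int (card (?C j))"
        by (auto simp: algebra_simps)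
      then show ?thesis using False by (simp only: g_def if_False min_le_iff_disj)
    qed (simp add: g_def)
  qed (use q(1) in \<open>simp add: b_def\<close>)
  then show False using q(2) by linarith
qed

end

text \<open>Carrying \<open>xi\<close> through the induction supplies the additional 1 from which
  the unstructured step for odd \<open>k\<close> starts, where \<open>S - {x}\<close> has even
  size.\<close>

theorem odd_bound:
  fixes S :: "'a::{finite,ab_group_add} set"
  assumes tors: "\<And>x::'a. x + x = 0 \<Longrightarrow> x = 0" and "good S"
  shows "card S * (card S + 1) + 2 * xi S \<le> 2 * card (subset_sums S)"
  using assms(2)
proof (induction "card S" arbitrary: S rule: less_induct)
  case less
  note S = less.prems
  have IHxi: "card B * (card B + 1) + 2 * xi B \<le> 2 * card (subset_sums B)"
    if "good B" "card B < card S" for B :: "'a set"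
    using less.hyps[OF that(2,1)] .
  have IH: "card B * (card B + 1) \<le> 2 * card (subset_sums B)"
    if "good B" "card B < card S" for B :: "'a set"
    using IHxi[OF that] by linarith
  have xi1: "xi S \<le> 1" by (simp add: xi_def)
  consider "card S = 0" | "card S = 1" | "card S = 2" | "3 \<le> card S" by linarith
  then show ?case
  proof cases
    case 1
    then have "S = {}" by simp
    then show ?thesis using xi1 by (simp add: subset_sums_empty)
  next
    case 2
    then show ?thesis using subset_sums_singleton[OF S] xi1 by simp
  next
    case 3
    then show ?thesis using subset_sums_doubleton[OF S] xi1 by simp
  next
    case k3: 4
    define k where "k = card S"
    define H where "H = group_closure S"
    define Q where "Q = sym_gens S"
    have Sne: "S \<noteq> {}" using k3 by auto
    have H: "subgrp H" by (simp add: H_def subgrp_group_closure)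
    have half: "2 * card (subset_sums S) \<le> card H" unfolding H_def by (rule good_half[OF S Sne])
    have cQ: "card Q = 2 * k + 1" unfolding Q_def k_def by (rule card_sym_gens[OF S])
    have QsubH: "Q \<subseteq> H" unfolding Q_def H_def
      by (intro sym_gens_subset subgrp_group_closure subset_group_closure)
    have QH: "Q \<noteq> H"
    proof
      assume "Q = H"
      then have "k * (k - 1) + 6 \<le> 2 * k + 1" using half general_bound[OF S] k3 cQ by (simp add: k_def)
      moreover obtain j where "k = j + 3" using k3 unfolding k_def by (metis add.commute le_Suc_ex)
      ultimately show False by (simp add: algebra_simps)
    qed
    have sub: "(k - 1) * k + 2 * xi (S - {x}) \<le> 2 * card (subset_sums (S - {x}))" if "x \<in> S" for x
    proof -
      have "card (S - {x}) = k - 1" using that by (simp add: k_def)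
      then show ?thesis using IHxi[OF good_subset[OF S, of "S - {x}"]] k3 by (simp add: k_def)
    qed
    show ?thesis
    proof (cases "\<forall>K. subgrp K \<longrightarrow> K \<subseteq> H \<longrightarrow> K \<noteq> {0} \<longrightarrow> K + Q \<noteq> H \<longrightarrow> card K + card Q \<le> card (K + Q)")
      case True
      show ?thesis
      proof (rule unstructured_odd_bound[OF tors S k3])
        show "sym_gens S \<noteq> group_closure S" using QH by (simp add: Q_def H_def)
        show "card K + card (sym_gens S) \<le> card (K + sym_gens S)"
          if "subgrp K" "K \<subseteq> group_closure S" "K \<noteq> {0}" "K + sym_gens S \<noteq> group_closure S" for K
          using True that unfolding Q_def H_def by blast
        show "card S * (card S - 1) + 2 * xi (S - {x}) \<le> 2 * card (subset_sums (S - {x}))" if "x \<in> S" for x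
          using sub[OF that] by (simp add: k_def mult.commute)
      qed
    next
      case False
      then obtain K' where K': "subgrp K'" "K' \<subseteq> H" "K' \<noteq> {0}" "K' + Q \<noteq> H" "card (K' + Q) \<le> card K' + 2 * k"
        using cQ by fastforce
      obtain L where L: "subgrp L" "L \<subseteq> H" "L + Q \<noteq> H"
        and growthL: "\<And>Y. Y \<subseteq> H \<Longrightarrow> Y \<noteq> {} \<Longrightarrow> Y + Q \<noteq> H \<Longrightarrow> card (L + Q) + card Y \<le> card (Y + Q) + card L"
        using isoperimetric_subgroup[of H Q] QsubH QH H symm_sym_gens[of S] zero_in_sym_gens[of S]
        unfolding Q_def by metis
      have K'ne: "K' \<noteq> {}" using subgrp_zero[OF K'(1)] by blast
      have gK': "card (L + Q) + card K' \<le> card (K' + Q) + card L" by (rule growthL[OF K'(2) K'ne K'(4)])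
      \<comment> \<open>A non-trivial minimiser is wanted. If \<open>L\<close> is trivial, the
        minimum is \<open>2 k\<close>; as the excess for \<open>K'\<close> is at most
        \<open>2 k\<close>, \<open>K'\<close> itself is a minimiser.\<close>
      obtain K where K: "subgrp K" "K \<subseteq> H" "K \<noteq> {0}" "K + Q \<noteq> H" "card (K + Q) \<le> card K + 2 * k"
        and growth: "\<And>Y. Y \<subseteq> H \<Longrightarrow> Y \<noteq> {} \<Longrightarrow> Y + Q \<noteq> H \<Longrightarrow> card (K + Q) + card Y \<le> card (Y + Q) + card K"
      proof (cases "L = {0}")
        case True
        have "{0} + Q = Q" by (auto simp: set_plus_iff)
        then have "card (L + Q) = card L + 2 * k" using cQ True by simp
        then have "card (K' + Q) + card L \<le> card (L + Q) + card K'" using K'(5) by linarith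
        then have "card (K' + Q) + card Y \<le> card (Y + Q) + card K'"
          if Y: "Y \<subseteq> H" "Y \<noteq> {}" "Y + Q \<noteq> H" for Y
          using growthL[OF Y] by linarith
        then show thesis by (rule that[OF K'])
      next
        case False
        have "card (L + Q) \<le> card L + 2 * k" using gK' K'(5) by linarith
        then show thesis by (rule that[OF L(1,2) False L(3) _ growthL])
      qed
      define h where "h = card K"
      define k0 where "k0 = card (S \<inter> K)"
      have KQ: "K \<subseteq> K + Q" unfolding Q_def by (rule subset_set_plus[OF zero_in_sym_gens])
      have noinv: "y + y \<notin> K" if "y \<notin> K" for y
        using halve_in_subgrp[of K y] tors K(1) that by blast
      obtain s where s: "s \<in> K" "s \<noteq> 0" using K(3) subgrp_zero[OF K(1)] by blast
      have ho: "odd h" unfolding h_def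
        by (rule odd_card_symm[OF tors]) (simp_all add: symm_subgrp[OF K(1)] subgrp_zero[OF K(1)])
      moreover have "h \<noteq> 1"
      proof
        assume "h = 1"
        then obtain w where "K = {w}" by (auto simp: h_def card_1_singleton_iff)
        then show False using s subgrp_zero[OF K(1)] by simp
      qed
      ultimately have h3: "3 \<le> h" by presburger
      have SK: "\<not> S \<subseteq> K"
      proof
        assume "S \<subseteq> K"
        then have "H \<subseteq> K" unfolding H_def by (rule group_closure_least[OF K(1)])
        moreover have "K + Q \<subseteq> H" by (rule set_plus_subset_subgrp[OF H K(2) QsubH])
        ultimately show False using KQ K(2,4) by auto
      qed
      obtain z where z: "card (K + Q) = h + 2 * z" "h \<le> z"
        using card_outside[OF K(1) noinv SK] unfolding Q_def h_def by metis
      have zk: "z \<le> k" using K(5) z by (simp add: h_def)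
      define e where "e = k - z"
      have e: "z + e = k" using zk by (simp add: e_def)
      have ek: "e \<le> k0" using card_closure_ge[OF S K(1) K(1)] KQ z e by (simp add: Q_def h_def k0_def k_def)
      have k0k: "k0 < card S" unfolding k0_def using SK by (intro psubset_card_mono) auto
      have gK: "good (S \<inter> K)" by (rule good_subset[OF S]) simp
      have sK: "2 * k0 \<le> card (subset_sums (S \<inter> K))"
      proof -
        consider "k0 = 0" | "k0 = 1" | "k0 = 2" | "3 \<le> k0" by linarith
        then show ?thesis
        proof cases
          case 2
          then show ?thesis using subset_sums_singleton[OF gK] by (simp add: k0_def)
        next
          case 3
          then show ?thesis using subset_sums_doubleton[OF gK] by (simp add: k0_def)
        next
          case 4
          have "k0 * 4 \<le> k0 * (k0 + 1)" using 4 by (intro mult_le_mono2) simp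
          then show ?thesis using IH[OF gK] k0k unfolding k0_def by linarith
        qed simp
      qed
      \<comment> \<open>Strictness, due to the odd \<open>h\<close>, is what the density condition
        needs when \<open>e = 0\<close>.\<close>
      have h: "4 * k0 < h"
      proof (cases "S \<inter> K = {}")
        case False
        have "4 * k0 \<le> h" using good_Int_half[OF S K(1) False] sK by (simp add: h_def)
        then show ?thesis using ho by (cases "4 * k0 = h") auto
      qed (use h3 in \<open>simp add: k0_def\<close>)
      obtain x where x: "x \<in> S" "card (subset_sums (S - {x})) < card (subset_sums S)"
        using strict_remove[OF S Sne] by blast
      then have sub': "(k - 1) * k + 2 \<le> 2 * card (subset_sums S)" using sub[OF x(1)] by linarith
      have e4: "4 * e \<le> h" using h ek by linarith
      \<comment> \<open>As \<open>z = k\<close> is possible, \<open>e\<close> may be 0;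
        \<open>2 * e + 2\<close> still provides the two removals that
        \<open>structured_bound\<close> requires.\<close>
      have "\<exists>B :: 'a set. good B \<and> card B + (2 * e + 2) = card S \<and>
        card (subset_sums B) + (2 * e + 2) * z \<le> card (subset_sums S)"
      proof (rule structured_conclusion[OF S K(1)])
        show "K \<subseteq> group_closure S" "K + sym_gens S \<noteq> group_closure S" using K by (simp_all add: H_def Q_def)
        show "card (K + sym_gens S) + card Y \<le> card (Y + sym_gens S) + card K"
          if "Y \<subseteq> group_closure S" "Y \<noteq> {}" "Y + sym_gens S \<noteq> group_closure S" for Y
          using growth[of Y] that by (simp add: H_def Q_def)
        show "\<exists>s\<in>K. s + s \<noteq> 0" using s tors by blast
        show "y + y \<notin> K" if "y \<notin> K" for y by (rule noinv[OF that])
        show "card (K + sym_gens S) = card K + 2 * z" using z by (simp add: Q_def h_def)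
        show "z + e = card S" using e by (simp add: k_def)
        show "4 * (card (S \<inter> K) - e) < card K" using h by (simp add: h_def k0_def)
        show "card (S \<inter> K) < e + card (subset_sums (S \<inter> K))"
        proof (cases "k0 = 0")
          case True
          then have "S \<inter> K = {}" by (simp add: k0_def)
          then show ?thesis by (simp add: subset_sums_empty)
        next
          case False
          then show ?thesis using sK unfolding k0_def by linarith
        qed
        show "2 \<le> 2 * e + 2" by simp
        show "2 * e + 2 + card (S \<inter> K) < card K + e" using h h3 ek
          unfolding h_def k0_def by (cases "card (S \<inter> K) = 0") linarith+
        show "3 \<le> card K" using h3 by (simp add: h_def)
        show "z * (z - card K) \<le> card K * card (subset_sums B)"
          if B: "good B" "card B < card S" "card S < card B + (2 * e + 2)" for B :: "'a set"
        proof -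
          have "z < card B + e + 2" using B(3) e by (simp add: k_def)
          then show ?thesis unfolding h_def[symmetric] by (rule structured_arith[OF e4 h3 z(2) _ IH[OF B(1,2)]])
        qed
        have "(k - 1) * (k - 1 + 1) \<le> 2 * card (subset_sums S)" using sub' k3 by (simp add: k_def)
        then show "z * (z - card K) \<le> card K * card (subset_sums S)"
          unfolding h_def[symmetric] using e h3 z(2) by (intro structured_arith[OF e4 h3 z(2), of "k - 1"]) linarith+
        have "(z - 1) * z \<le> (k - 1) * k" using zk by (intro mult_le_mono) auto
        then show "z * (z - 1) + 2 \<le> 2 * card (subset_sums S)" using sub' by (simp add: mult.commute)
      qed
      then obtain B :: "'a set" where B: "good B" "card B + (2 * e + 2) = k"
        "card (subset_sums B) + (2 * e + 2) * z \<le> card (subset_sums S)" by (auto simp: k_def)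
      define c where "c = card B"
      have c: "k = c + 2 * e + 2" "z = c + e + 2" using B(2) e by (simp_all add: c_def)
      have "c * (c + 1) \<le> 2 * card (subset_sums B)" using IH[OF B(1)] B(2) by (simp add: c_def k_def)
      then have "c * (c + 1) + 2 * ((2 * e + 2) * z) \<le> 2 * card (subset_sums S)" using B(3) by linarith
      moreover have "k * (k + 1) + 2 \<le> c * (c + 1) + 2 * ((2 * e + 2) * z)"
        unfolding c by (simp add: algebra_simps)
      ultimately show ?thesis using xi1 unfolding k_def[symmetric] by linarith
    qed
  qed
qed

theorem theorem1p2:
  fixes S :: "'a::{finite, ab_group_add} set"
  assumes "S \<inter> uminus ` S = {}"
    and "card S \<ge> 2"
  shows "(real (card (subset_sums S)) \<ge> real (card S) * (real (card S) - 1) / 2 + 3 \<or>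
          (\<exists>S'\<subseteq>S. S' \<noteq> {} \<and>
             real (card (subset_sums S')) > real (card (group_closure S')) / 2)) \<and>
         (odd (card (UNIV :: 'a set)) \<longrightarrow>
           real (card (subset_sums S)) \<ge> real (card S) * (real (card S) + 1) / 2 + real (xi S) \<or>
           (\<exists>S'\<subseteq>S. S' \<noteq> {} \<and>
             real (card (subset_sums S')) > real (card (group_closure S')) / 2))"
proof (cases "\<exists>S'\<subseteq>S. S' \<noteq> {} \<and> real (card (subset_sums S')) > real (card (group_closure S')) / 2")
  case True
  then show ?thesis by blast
next
  case False
  have "2 * card (subset_sums T) \<le> card (group_closure T)" if "T \<subseteq> S" "T \<noteq> {}" for T
  proof -
    have "real (card (subset_sums T)) \<le> real (card (group_closure T)) / 2"
      using False that by (meson not_le)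
    then have "real (2 * card (subset_sums T)) \<le> real (card (group_closure T))" by simp
    then show ?thesis by (simp only: of_nat_le_iff)
  qed
  then have good: "good S" using assms(1) by (simp add: good_def)
  have "real (card S * (card S - 1) + 6) \<le> real (2 * card (subset_sums S))"
    using general_bound[OF good assms(2)] by (simp only: of_nat_le_iff)
  then have "real (card S) * (real (card S) - 1) / 2 + 3 \<le> real (card (subset_sums S))"
    using assms(2) by (simp add: of_nat_diff)
  moreover have "real (card S) * (real (card S) + 1) / 2 + real (xi S) \<le> real (card (subset_sums S))"
    if "odd (card (UNIV :: 'a set))"
  proof -
    have "real (card S * (card S + 1) + 2 * xi S) \<le> real (2 * card (subset_sums S))"
      using odd_bound[OF no_2_torsion_of_odd_card[OF that] good] by (simp only: of_nat_le_iff)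
    then show ?thesis by (simp add: field_simps)
  qed
  ultimately show ?thesis by blast
qed

end
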